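(* Consider the randomized urn model $(C_0,(\chi_n,R_n)_{n\ge 1})$ with $K$ colors, configuration vectors $C_n$, total contents $S_n$, count vectors $N_n$ and filtration $(\mathcal F_n)_{n\ge 0}$ as described in the context (including the basic assumptions (i)--(iv) there). Let $H_{n-1}:=\mathbb E(R_n\mid\mathcal F_{n-1})$, $n\ge1$. Assume: (1) There exists a (possibly random) $K\times K$ matrix $H$ with nonnegative entries, almost surely irreducible, such that $\frac1n\sum_{k=0}^{n-1}\rho(H_k-H)\to0$ almost surely. (2) There is a nonnegative function $\phi$ on $[0,\infty)$ which is eventually positive and nondecreasing, with $\sum_n \frac{1}{n\phi(n)}<\infty$ (sum over all sufficiently large $n$) and $x/\phi(x)$ eventually nondecreasing, such that $\sup_{n\ge1}\mathbb E\left(\rho(R_n)\phi(\rho(R_n))\right)<\infty$. Let $\lambda_H$ be the dominant eigenvalue of $H$ and $\pi_H$ the unique left eigenvector of $H$ for $\lambda_H$ which has all coordinates strictly positive and is normalized to be a probability vector. Then, as $n\to\infty$, both almost surely and in $L^1$, $$\frac{C_n}{S_n}\to\pi_H,\qquad \frac{S_n}{n}\to\lambda_H,\qquad \frac{C_n}{n}\to\lambda_H\pi_H,\qquad \frac{N_n}{n}\to\pi_H .$$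
   Context: Vectors are row vectors; $[K]=\{1,\dots,K\}$; $e_i$ is the $i$-th coordinate vector of $\mathbb R^K$. For a matrix $A$, $\rho(A):=\max_i\sum_j|A_{ij}|$. A square matrix $A$ with nonnegative entries is irreducible if for all $i,j\in[K]$ there is a positive integer $N$ (depending on $i,j$) such that the $(i,j)$ entry of $A^N$ is positive. The dominant eigenvalue of an irreducible matrix is its eigenvalue with largest real part; by Perron--Frobenius it is simple and positive with strictly positive left and right eigenvectors. Urn model: on a probability space, $C_0$ is a random vector in $\mathbb R^K$, $(R_n)_{n\ge1}$ are random $K\times K$ matrices with nonnegative entries (replacement matrices), and $(\chi_n)_{n\ge1}$ are random vectors with values in $\{e_1,\dots,e_K\}$ (the color drawn at trial $n$). The configuration vectors $C_n=(C_{n1},\dots,C_{nK})$ satisfy $C_n=C_{n-1}+\chi_nR_n$ for $n\ge1$; $S_n=\sum_{i=1}^KC_{ni}$; $N_n=\sum_{k=1}^n\chi_k$. $\mathcal F_n$ is the $\sigma$-field generated by $C_0$ and $(R_m,\chi_m)_{m=1}^n$ (so $\mathcal F_0=\sigma(C_0)$). Basic assumptions: (i) $C_0$ is almost surely nonzero with nonnegative entries, and has finite mean; (ii) for $n\ge1$, $i\in[K]$, $\mathbb P(\chi_n=e_i\mid\mathcal F_{n-1})=C_{n-1,i}/S_{n-1}$; (iii) each $R_n$ has finite mean; (iv) for each $n\ge 1$, $\chi_n$ and $R_n$ are conditionally independent given $\mathcal F_{n-1}$. *)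

theory Defs
  imports "HOL-Probability.Probability"
begin

text \<open>
  The finite nonempty type \<open>'k\<close> is the set of colors. Vectors are row vectors, so matrices act
  by \<open>v*\<close>, and \<open>axis i 1\<close> is the coordinate vector of color \<open>i\<close>.
\<close>

definition rho :: "real^'k^'k \<Rightarrow> real" where
  "rho A = (MAX i. \<Sum>j\<in>UNIV. \<bar>A $ i $ j\<bar>)"

text \<open>The operation \<open>*\<close> on type \<open>vec\<close> is componentwise, so \<open>A ^ n\<close> would not be the matrix power.\<close>

definition mat_power :: "'a::semiring_1^'k^'k \<Rightarrow> nat \<Rightarrow> 'a^'k^'k" where
  "mat_power A n = (((**) A) ^^ n) (mat 1)"

definition nonneg_matrix :: "real^'k^'k \<Rightarrow> bool" where
  "nonneg_matrix A \<longleftrightarrow> (\<forall>i j. 0 \<le> A $ i $ j)"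

definition irreducible_matrix :: "real^'k^'k \<Rightarrow> bool" where
  "irreducible_matrix A \<longleftrightarrow>
     nonneg_matrix A \<and> (\<forall>i j. \<exists>N>0. 0 < mat_power A N $ i $ j)"

definition eigenvalues :: "real^'k^'k \<Rightarrow> complex set" where
  "eigenvalues A = {\<mu>. \<exists>v. v \<noteq> 0 \<and> v v* map_matrix complex_of_real A = \<mu> *s v}"

text \<open>
  The dominant eigenvalue is the eigenvalue with largest real part among all complex
  eigenvalues; it is real by Perron--Frobenius. It and the left eigenvector below are only
  meaningful for irreducible matrices; elsewhere they are set to 0, so that composing them with
  a random matrix that is only almost surely irreducible gives a definite function everywhere.
\<close>

definition dominant_eigenvalue :: "real^'k^'k \<Rightarrow> real" where
  "dominant_eigenvalue A =
     (if irreducible_matrix A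
      then (THE l. complex_of_real l \<in> eigenvalues A \<and>
                   (\<forall>\<mu>\<in>eigenvalues A. \<mu> \<noteq> complex_of_real l \<longrightarrow> Re \<mu> < l))
      else 0)"

definition perron_vector :: "real^'k^'k \<Rightarrow> real^'k" where
  "perron_vector A =
     (if irreducible_matrix A
      then (THE v. v v* A = dominant_eigenvalue A *\<^sub>R v \<and> (\<forall>i. 0 < v $ i) \<and> (\<Sum>i\<in>UNIV. v $ i) = 1)
      else 0)"

definition cond_exp_matrix ::
    "'a measure \<Rightarrow> 'a measure \<Rightarrow> ('a \<Rightarrow> real^'k^'k) \<Rightarrow> 'a \<Rightarrow> real^'k^'k" where
  "cond_exp_matrix M F X \<omega> = (\<chi> i j. real_cond_exp M F (\<lambda>\<omega>. X \<omega> $ i $ j) \<omega>)"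

definition cond_prob :: "'a measure \<Rightarrow> 'a measure \<Rightarrow> ('a \<Rightarrow> bool) \<Rightarrow> 'a \<Rightarrow> real" where
  "cond_prob M F P = real_cond_exp M F (indicator {\<omega>\<in>space M. P \<omega>})"

definition cond_indep ::
    "'a measure \<Rightarrow> 'a measure \<Rightarrow> ('a \<Rightarrow> 'b::topological_space) \<Rightarrow> ('a \<Rightarrow> 'c::topological_space) \<Rightarrow> bool"
where
  "cond_indep M F X Y \<longleftrightarrow>
     (\<forall>A\<in>sets borel. \<forall>B\<in>sets borel. AE \<omega> in M.
        cond_prob M F (\<lambda>\<omega>. X \<omega> \<in> A \<and> Y \<omega> \<in> B) \<omega>
          = cond_prob M F (\<lambda>\<omega>. X \<omega> \<in> A) \<omega> * cond_prob M F (\<lambda>\<omega>. Y \<omega> \<in> B) \<omega>)"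

definition tendsto_L1 ::
    "'a measure \<Rightarrow> (nat \<Rightarrow> 'a \<Rightarrow> 'b::{banach,second_countable_topology}) \<Rightarrow> ('a \<Rightarrow> 'b) \<Rightarrow> bool" where
  "tendsto_L1 M X Y \<longleftrightarrow>
     (\<forall>n. integrable M (X n)) \<and> integrable M Y \<and>
     (\<lambda>n. \<integral>\<omega>. norm (X n \<omega> - Y \<omega>) \<partial>M) \<longlonglongrightarrow> 0"

text \<open>In the urn model the trials are numbered from 1; \<open>R 0\<close> and \<open>chi 0\<close> are never used.\<close>

primrec config ::
    "('a \<Rightarrow> real^'k) \<Rightarrow> (nat \<Rightarrow> 'a \<Rightarrow> real^'k^'k) \<Rightarrow> (nat \<Rightarrow> 'a \<Rightarrow> real^'k) \<Rightarrow> nat \<Rightarrow> 'a \<Rightarrow> real^'k"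
where
  "config C0 R chi 0 = C0"
| "config C0 R chi (Suc n) = (\<lambda>\<omega>. config C0 R chi n \<omega> + chi (Suc n) \<omega> v* R (Suc n) \<omega>)"

definition total_contents ::
    "('a \<Rightarrow> real^'k) \<Rightarrow> (nat \<Rightarrow> 'a \<Rightarrow> real^'k^'k) \<Rightarrow> (nat \<Rightarrow> 'a \<Rightarrow> real^'k) \<Rightarrow> nat \<Rightarrow> 'a \<Rightarrow> real"
where
  "total_contents C0 R chi n \<omega> = (\<Sum>i\<in>UNIV. config C0 R chi n \<omega> $ i)"

definition color_count :: "(nat \<Rightarrow> 'a \<Rightarrow> real^'k) \<Rightarrow> nat \<Rightarrow> 'a \<Rightarrow> real^'k" where
  "color_count chi n \<omega> = (\<Sum>k=1..n. chi k \<omega>)"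

definition urn_filtration ::
    "'a measure \<Rightarrow> ('a \<Rightarrow> real^'k) \<Rightarrow> (nat \<Rightarrow> 'a \<Rightarrow> real^'k^'k) \<Rightarrow> (nat \<Rightarrow> 'a \<Rightarrow> real^'k) \<Rightarrow> nat \<Rightarrow> 'a measure"
where
  "urn_filtration M C0 R chi n = sigma (space M)
     ({C0 -` A \<inter> space M |A. A \<in> sets borel} \<union>
      (\<Union>m\<in>{1..n}. {R m -` A \<inter> space M |A. A \<in> sets borel} \<union>
                  {chi m -` A \<inter> space M |A. A \<in> sets borel}))"

locale randomized_urn = prob_space M
  for M :: "'a measure"
    and C0 :: "'a \<Rightarrow> real^'k"
    and R :: "nat \<Rightarrow> 'a \<Rightarrow> real^'k^'k"
    and chi :: "nat \<Rightarrow> 'a \<Rightarrow> real^'k" +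
  assumes C0_measurable: "C0 \<in> borel_measurable M"
    and R_measurable: "\<And>n. 1 \<le> n \<Longrightarrow> R n \<in> borel_measurable M"
    and R_nonneg: "\<And>n \<omega>. 1 \<le> n \<Longrightarrow> \<omega> \<in> space M \<Longrightarrow> nonneg_matrix (R n \<omega>)"
    and chi_measurable: "\<And>n. 1 \<le> n \<Longrightarrow> chi n \<in> borel_measurable M"
    and chi_range: "\<And>n \<omega>. 1 \<le> n \<Longrightarrow> \<omega> \<in> space M \<Longrightarrow> \<exists>i. chi n \<omega> = axis i 1"
    and C0_nonneg_nonzero: "AE \<omega> in M. C0 \<omega> \<noteq> 0 \<and> (\<forall>i. 0 \<le> C0 \<omega> $ i)"
    and C0_integrable: "integrable M C0"
    and draw: "\<And>n i. 1 \<le> n \<Longrightarrow> AE \<omega> in M.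
          cond_prob M (urn_filtration M C0 R chi (n - 1)) (\<lambda>\<omega>. chi n \<omega> = axis i 1) \<omega>
            = config C0 R chi (n - 1) \<omega> $ i / total_contents C0 R chi (n - 1) \<omega>"
    and R_integrable: "\<And>n. 1 \<le> n \<Longrightarrow> integrable M (R n)"
    and chi_R_cond_indep:
      "\<And>n. 1 \<le> n \<Longrightarrow> cond_indep M (urn_filtration M C0 R chi (n - 1)) (chi n) (R n)"

text \<open>\<open>replacement_mean M C0 R chi n\<close> is the conditional mean of \<open>R (Suc n)\<close> given time \<open>n\<close>, the paper's $H_n$.\<close>

definition replacement_mean ::
    "'a measure \<Rightarrow> ('a \<Rightarrow> real^'k) \<Rightarrow> (nat \<Rightarrow> 'a \<Rightarrow> real^'k^'k) \<Rightarrow> (nat \<Rightarrow> 'a \<Rightarrow> real^'k)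
      \<Rightarrow> nat \<Rightarrow> 'a \<Rightarrow> real^'k^'k"
where
  "replacement_mean M C0 R chi n = cond_exp_matrix M (urn_filtration M C0 R chi n) (R (Suc n))"

end

theory Submission
  imports Defs
begin

text \<open>
  Let \<open>x\<^sub>n = C\<^sub>n / S\<^sub>n\<close> be the proportions of the colors and \<open>y\<^sub>n = x\<^sub>0 + \<dots> + x\<^sub>n\<^sub>-\<^sub>1\<close>. Given the past, the
  addition at trial \<open>n + 1\<close> has mean \<open>x\<^sub>n H\<^sub>n\<close> (lemma \<open>addition_mean\<close>). The strong law for martingale
  differences makes the noise negligible, and the averages of \<open>H\<^sub>n - H\<close> vanish by assumption, so
  \<open>C\<^sub>n = y\<^sub>n H + o(n)\<close> almost surely (lemma \<open>mean_field_equation\<close>). What remains is a deterministic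
  question about a single outcome.

  Since \<open>y\<^sub>n\<^sub>+\<^sub>1 = y\<^sub>n + C\<^sub>n / S\<^sub>n\<close>, the accumulated proportions obey \<open>y\<^sub>n\<^sub>+\<^sub>1 = y\<^sub>n (I + H / S\<^sub>n) + o(1)\<close> with
  \<open>S\<^sub>n\<close> of order \<open>n\<close>: up to a change of time this is the linear flow of \<open>H\<close>, which turns every positive
  vector into the Perron direction. Let \<open>v\<close> be the positive right eigenvector. The mass
  \<open>y\<^sub>n \<bullet> v\<close> grows by the factors \<open>1 + \<lambda> / S\<^sub>n\<close>. The deviation from the Perron direction, measured in a suitable
  Euclidean norm, grows by factors of at most \<open>1 + \<kappa> / S\<^sub>n\<close> with some \<open>\<kappa> < \<lambda>\<close> (lemma
  \<open>perron_deviation_gap\<close>, a Poincare inequality for irreducible matrices). As the series of \<open>1 / S\<^sub>n\<close>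
  diverges, the ratio tends to zero, hence \<open>y\<^sub>n / n\<close> tends to the Perron vector (theorem
  \<open>mean_field_urn_limit\<close>). The limits of \<open>C\<^sub>n / n\<close>, \<open>S\<^sub>n / n\<close> and \<open>C\<^sub>n / S\<^sub>n\<close> follow from \<open>C\<^sub>n = y\<^sub>n H + o(n)\<close>, and
  that of \<open>N\<^sub>n / n\<close> from the strong law for the draws.

  The strong law (theorem \<open>conditional_strong_law\<close>) is proved by truncation: the summable
  terms \<open>1 / (n phi n)\<close> bound both the scaled variances of the truncated variables and the scaled
  means of the remainders. Its martingale part rests on Kolmogorov's maximal inequality and Kronecker's
  lemma.

  Convergence in mean follows from almost sure convergence because \<open>S\<^sub>n / n\<close> is bounded by averages of
  variables whose excess over a high level has uniformly small mean (lemmas \<open>small_excess\<close> and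
  \<open>L1_limit_of_small_excess\<close>). It also requires the limits to be random variables: the Perron vector is a
  measurable function of the matrix because it is the limit of the urn without noise, by the
  deterministic theorem once more (lemma \<open>noiseless_count_limit\<close>).
\<close>

section \<open>Perron--Frobenius theory for irreducible matrices\<close>

lemma vec_mult_nth: "(x v* A) $ j = (\<Sum>i\<in>UNIV. x $ i * A $ i $ j)"
  by (simp add: vector_matrix_mult_def)

lemma vec_mult_nonneg:
  assumes "nonneg_matrix A" "\<And>i. 0 \<le> x $ i"
  shows "0 \<le> (x v* A) $ j"
  using assms by (auto simp: vec_mult_nth nonneg_matrix_def intro!: sum_nonneg)

lemma mat_vec_mult_nth: "(A *v x) $ i = (\<Sum>j\<in>UNIV. A $ i $ j * x $ j)"
  by (simp add: matrix_vector_mult_def)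

lemma mat_power_0 [simp]: "mat_power A 0 = mat 1"
  by (simp add: mat_power_def)

lemma mat_power_Suc [simp]: "mat_power A (Suc n) = A ** mat_power A n"
  by (simp add: mat_power_def)

lemma mat_power_commutes: "A ** mat_power A n = mat_power A n ** A"
  by (induction n) (auto simp: matrix_mul_assoc)

lemma mat_power_transpose: "mat_power (transpose A) n = transpose (mat_power (A::real^'k^'k) n)"
  by (induction n) (auto simp: matrix_transpose_mul[symmetric] mat_power_commutes)

lemma irreducible_transpose:
  assumes "irreducible_matrix A"
  shows "irreducible_matrix (transpose A)"
  using assms unfolding irreducible_matrix_def nonneg_matrix_def mat_power_transpose
  by (simp add: transpose_def)

lemma nonneg_mat_power: "nonneg_matrix A \<Longrightarrow> nonneg_matrix (mat_power A n)"
  by (induction n)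
     (auto simp: nonneg_matrix_def mat_def matrix_matrix_mult_def intro!: sum_nonneg)

lemma eigenvector_mat_power:
  fixes A :: "real^'k^'k"
  assumes "x v* A = l *\<^sub>R x"
  shows "x v* mat_power A n = l ^ n *\<^sub>R x"
proof (induction n)
  case (Suc n)
  have "x v* mat_power A (Suc n) = (x v* A) v* mat_power A n"
    by (simp add: vector_matrix_mul_assoc)
  then show ?case
    by (simp add: assms Suc scaleR_vector_matrix_assoc)
qed simp

text \<open>Irreducibility transports the mass sitting at one coordinate to any other one, so a nonzero
  nonnegative eigenvector cannot have a zero coordinate.\<close>

lemma nonneg_eigenvector_pos:
  fixes A :: "real^'k^'k"
  assumes irr: "irreducible_matrix A" and u: "\<And>i. 0 \<le> u $ i" "u \<noteq> 0"
    and eig: "u v* A = l *\<^sub>R u"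
  shows "0 < l" "0 < u $ j"
proof -
  have nn: "nonneg_matrix A" using irr by (simp add: irreducible_matrix_def)
  obtain i where "u $ i \<noteq> 0" using u(2) by (auto simp: vec_eq_iff)
  then have i: "0 < u $ i" using u(1)[of i] by linarith
  have key: "\<exists>N>0. 0 < l ^ N * u $ j" for j
  proof -
    obtain N where N: "N > 0" "0 < mat_power A N $ i $ j"
      using irr unfolding irreducible_matrix_def by blast
    have "0 < u $ i * mat_power A N $ i $ j" using i N by simp
    also have "\<dots> \<le> (\<Sum>k\<in>UNIV. u $ k * mat_power A N $ k $ j)"
      using nonneg_mat_power[OF nn, of N] u(1)
      by (intro member_le_sum) (auto simp: nonneg_matrix_def)
    also have "\<dots> = l ^ N * u $ j"
      using arg_cong[OF eigenvector_mat_power[OF eig, of N], of "\<lambda>x. x $ j"]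
      by (simp add: vec_mult_nth)
    finally show ?thesis using N by blast
  qed
  show pos: "0 < u $ j" for j
    using key[of j] u(1)[of j] by (cases "u $ j = 0") auto
  have "l * u $ i = (\<Sum>k\<in>UNIV. u $ k * A $ k $ i)"
    using arg_cong[OF eig, of "\<lambda>x. x $ i"] by (simp add: vec_mult_nth)
  also have "\<dots> \<ge> 0"
    using u(1) nn by (intro sum_nonneg) (auto simp: nonneg_matrix_def)
  finally have "0 \<le> l" using i by (simp add: zero_le_mult_iff)
  moreover have "l \<noteq> 0" using key[of i] by (auto simp: zero_power)
  ultimately show "0 < l" by simp
qed

text \<open>The map \<open>u \<mapsto> u (I + A)\<close>, renormalised to total mass one, is a continuous self-map of the simplex;
  Brouwer's theorem provides a fixed point, which is a nonnegative eigenvector. Adding the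
  identity keeps the normalising constant away from zero.\<close>

lemma nonneg_left_eigenvector_exists:
  fixes A :: "real^'k^'k"
  assumes nn: "nonneg_matrix A"
  shows "\<exists>u l. (\<forall>i. 0 \<le> u $ i) \<and> (\<Sum>i\<in>UNIV. u $ i) = 1 \<and> u v* A = l *\<^sub>R u"
proof -
  define S where "S = {u::real^'k. (\<forall>i. 0 \<le> u $ i) \<and> (\<Sum>i\<in>UNIV. u $ i) = 1}"
  define s where "s = (\<lambda>u::real^'k. \<Sum>j\<in>UNIV. (u v* A) $ j)"
  define f where "f = (\<lambda>u. (1 / (1 + s u)) *\<^sub>R (u + u v* A))"
  have uA: "0 \<le> (u v* A) $ j" if "u \<in> S" for u j
    using that nn by (intro vec_mult_nonneg) (auto simp: S_def)
  then have s: "0 \<le> s u" if "u \<in> S" for u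
    using that unfolding s_def by (auto intro!: sum_nonneg)
  have cont_vA: "continuous_on T (\<lambda>u::real^'k. (u v* A) $ j)" for T j
    unfolding vec_mult_nth by (intro continuous_intros)
  then have cont_vA': "continuous_on T (\<lambda>u::real^'k. u v* A)" for T
    by (subst continuous_on_vec_lambda[of T "\<lambda>j u. (u v* A) $ j", simplified]) auto
  have cont_s: "continuous_on T s" for T
    unfolding s_def by (intro continuous_on_sum cont_vA)
  have bounded: "bounded S"
  proof -
    have "norm u \<le> 1" if "u \<in> S" for u
    proof -
      have "norm u \<le> (\<Sum>i\<in>UNIV. \<bar>u $ i\<bar>)" by (rule norm_le_l1_cart)
      also have "\<dots> = 1" using that by (auto simp: S_def intro!: sum.cong)
      finally show ?thesis .
    qed
    then show ?thesis by (auto simp: bounded_iff)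
  qed
  have "closed S"
  proof -
    have "S = (\<Inter>i. {u. 0 \<le> u $ i}) \<inter> {u. (\<Sum>i\<in>UNIV. u $ i) = 1}"
      by (auto simp: S_def)
    also have "closed \<dots>"
      by (intro closed_Int closed_INT ballI closed_Collect_le closed_Collect_eq continuous_intros)
    finally show ?thesis .
  qed
  then have "compact S" using bounded by (simp add: compact_eq_bounded_closed)
  moreover have "convex S"
    unfolding convex_def S_def
    by (auto simp: sum.distrib sum_distrib_left[symmetric])
  moreover have "axis undefined 1 \<in> S"
    by (auto simp: S_def axis_def)
  then have "S \<noteq> {}" by blast
  moreover have "continuous_on S f"
    unfolding f_def using s cont_s[of S] cont_vA'[of S]
    by (intro continuous_intros) (auto simp: add_nonneg_eq_0_iff)
  moreover have "f \<in> S \<rightarrow> S"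
  proof
    fix u assume u: "u \<in> S"
    have "(\<Sum>i\<in>UNIV. f u $ i) = 1 / (1 + s u) * (\<Sum>i\<in>UNIV. u $ i + (u v* A) $ i)"
      by (simp add: f_def sum_distrib_left)
    also have "\<dots> = 1"
    proof -
      have "(\<Sum>i\<in>UNIV. u $ i + (u v* A) $ i) = 1 + s u"
        using u by (simp add: sum.distrib S_def s_def)
      then show ?thesis using s[OF u] by simp
    qed
    finally have "(\<Sum>i\<in>UNIV. f u $ i) = 1" .
    moreover have "0 \<le> f u $ i" for i
      using uA[OF u, of i] s[OF u] u by (auto simp: f_def S_def)
    ultimately show "f u \<in> S" by (simp add: S_def)
  qed
  ultimately obtain u where u: "u \<in> S" "f u = u" using brouwer by metis
  have "(1 + s u) *\<^sub>R u = (1 + s u) *\<^sub>R f u" using u by simp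
  also have "\<dots> = u + u v* A" using s[OF u(1)] by (simp add: f_def)
  finally have "u v* A = s u *\<^sub>R u" by (simp add: algebra_simps)
  then show ?thesis using u(1) by (auto simp: S_def)
qed

text \<open>Left eigenvectors of the transposed matrix are right eigenvectors, so both kinds come from the same
  existence statement.\<close>

lemma left_right_eigenvectors:
  fixes A :: "real^'k^'k"
  assumes irr: "irreducible_matrix A"
  obtains l u v where "0 < l" "\<And>i. 0 < u $ i" "(\<Sum>i\<in>UNIV. u $ i) = 1" "u v* A = l *\<^sub>R u"
    "\<And>i. 0 < v $ i" "A *v v = l *\<^sub>R v" "u \<bullet> v = 1"
proof -
  have ex: "\<exists>u l. 0 < l \<and> (\<forall>i. 0 < u $ i) \<and> (\<Sum>i\<in>UNIV. u $ i) = 1 \<and> u v* B = l *\<^sub>R u"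
    if B: "irreducible_matrix B" for B :: "real^'k^'k"
  proof -
    obtain u l where u: "\<And>i. 0 \<le> u $ i" "(\<Sum>i\<in>UNIV. u $ i) = 1" "u v* B = l *\<^sub>R u"
      using nonneg_left_eigenvector_exists[of B] B unfolding irreducible_matrix_def by blast
    have "u \<noteq> 0" using u(2) by auto
    with nonneg_eigenvector_pos[OF B u(1) _ u(3)] u show ?thesis by blast
  qed
  obtain u l where u: "0 < l" "\<And>i. 0 < u $ i" "(\<Sum>i\<in>UNIV. u $ i) = 1" "u v* A = l *\<^sub>R u"
    using ex[OF irr] by blast
  obtain w k where w: "\<And>i. 0 < w $ i" "w v* transpose A = k *\<^sub>R w"
    using ex[OF irreducible_transpose[OF irr]] by blast
  have uw: "0 < u \<bullet> w" using u(2) w(1) by (auto simp: inner_vec_def intro!: sum_pos)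
  \<comment> \<open>Evaluating \<open>u A w\<close> in both orders identifies the two eigenvalues.\<close>
  have "l * (u \<bullet> w) = (u v* A) \<bullet> w" by (simp add: u)
  also have "\<dots> = u \<bullet> (A *v w)" by (rule dot_lmul_matrix)
  also have "\<dots> = k * (u \<bullet> w)" using w(2) by simp
  finally have "l = k" using uw by simp
  show ?thesis
    by (rule that[of l u "(1 / (u \<bullet> w)) *\<^sub>R w"])
       (use u w uw \<open>l = k\<close> in \<open>auto simp: matrix_vector_mult_scaleR\<close>)
qed

text \<open>Pairing the entrywise absolute value of an eigenvector with the positive right eigenvector bounds
  the modulus of every eigenvalue; hence \<open>l\<close> strictly dominates the real parts of the others.\<close>

lemma eigenvalue_cmod_le:
  fixes A :: "real^'k^'k"
  assumes nn: "nonneg_matrix A" and v: "\<And>i. 0 < v $ i" "A *v v = l *\<^sub>R v"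
    and mu: "\<mu> \<in> eigenvalues A"
  shows "cmod \<mu> \<le> l"
proof -
  obtain w where w: "w \<noteq> 0" "w v* map_matrix complex_of_real A = \<mu> *s w"
    using mu by (auto simp: eigenvalues_def)
  have comp: "cmod \<mu> * cmod (w $ j) \<le> (\<Sum>i\<in>UNIV. cmod (w $ i) * A $ i $ j)" for j
  proof -
    have "\<mu> * w $ j = (\<Sum>i\<in>UNIV. w $ i * complex_of_real (A $ i $ j))"
      using arg_cong[OF w(2), of "\<lambda>x. x $ j"] by (simp add: vec_mult_nth map_matrix_def)
    then have "cmod \<mu> * cmod (w $ j) = cmod (\<Sum>i\<in>UNIV. w $ i * complex_of_real (A $ i $ j))"
      by (metis norm_mult)
    also have "\<dots> \<le> (\<Sum>i\<in>UNIV. cmod (w $ i * complex_of_real (A $ i $ j)))"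
      by (rule norm_sum)
    also have "\<dots> = (\<Sum>i\<in>UNIV. cmod (w $ i) * A $ i $ j)"
      using nn by (intro sum.cong) (auto simp: norm_mult nonneg_matrix_def)
    finally show ?thesis .
  qed
  define p where "p = (\<Sum>j\<in>UNIV. cmod (w $ j) * v $ j)"
  obtain j where "w $ j \<noteq> 0" using w(1) by (auto simp: vec_eq_iff)
  then have p: "0 < p"
    unfolding p_def using v(1) by (intro sum_pos2[of _ j]) (auto simp: less_imp_le)
  have "cmod \<mu> * p = (\<Sum>j\<in>UNIV. (cmod \<mu> * cmod (w $ j)) * v $ j)"
    by (simp add: p_def sum_distrib_left mult.assoc)
  also have "\<dots> \<le> (\<Sum>j\<in>UNIV. (\<Sum>i\<in>UNIV. cmod (w $ i) * A $ i $ j) * v $ j)"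
    by (intro sum_mono mult_right_mono comp) (simp add: v(1) less_imp_le)
  also have "\<dots> = (\<Sum>j\<in>UNIV. \<Sum>i\<in>UNIV. cmod (w $ i) * A $ i $ j * v $ j)"
    by (simp add: sum_distrib_right)
  also have "\<dots> = (\<Sum>i\<in>UNIV. \<Sum>j\<in>UNIV. cmod (w $ i) * A $ i $ j * v $ j)"
    by (rule sum.swap)
  also have "\<dots> = (\<Sum>i\<in>UNIV. cmod (w $ i) * (A *v v) $ i)"
    by (simp add: mat_vec_mult_nth sum_distrib_left mult.assoc)
  also have "\<dots> = l * p" by (simp add: v(2) p_def sum_distrib_left mult_ac)
  finally show ?thesis using p by simp
qed

lemma dominant_eigenvalue_eq:
  fixes A :: "real^'k^'k"
  assumes irr: "irreducible_matrix A" and u: "u \<noteq> 0" "u v* A = l *\<^sub>R u"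
    and v: "\<And>i. 0 < v $ i" "A *v v = l *\<^sub>R v"
  shows "dominant_eigenvalue A = l"
proof -
  have nn: "nonneg_matrix A" using irr by (simp add: irreducible_matrix_def)
  have "(\<chi> i. complex_of_real (u $ i)) v* map_matrix complex_of_real A
          = complex_of_real l *s (\<chi> i. complex_of_real (u $ i))"
  proof -
    have "(\<Sum>i\<in>UNIV. complex_of_real (u $ i) * complex_of_real (A $ i $ j))
        = complex_of_real l * complex_of_real (u $ j)" for j
      using arg_cong[OF u(2), of "\<lambda>x. complex_of_real (x $ j)"] by (simp add: vec_mult_nth)
    then show ?thesis by (simp add: vec_eq_iff vec_mult_nth map_matrix_def)
  qed
  moreover have "(\<chi> i. complex_of_real (u $ i)) \<noteq> 0" using u(1) by (auto simp: vec_eq_iff)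
  ultimately have l: "complex_of_real l \<in> eigenvalues A" unfolding eigenvalues_def by blast
  have dom: "Re \<mu> < l" if "\<mu> \<in> eigenvalues A" "\<mu> \<noteq> complex_of_real l" for \<mu>
  proof -
    have le: "cmod \<mu> \<le> l" by (rule eigenvalue_cmod_le[OF nn v that(1)])
    then have "Re \<mu> \<le> l" using complex_Re_le_cmod[of \<mu>] by linarith
    moreover have "Re \<mu> \<noteq> l"
    proof
      assume eq: "Re \<mu> = l"
      have "l\<^sup>2 + (Im \<mu>)\<^sup>2 \<le> l\<^sup>2"
        using power_mono[OF le, of 2] by (simp add: cmod_power2 eq)
      then have "Im \<mu> = 0" by simp
      then show False using that(2) eq by (simp add: complex_eq_iff)
    qed
    ultimately show ?thesis by linarith
  qed
  have "(THE l. complex_of_real l \<in> eigenvalues A \<and>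
           (\<forall>\<mu>\<in>eigenvalues A. \<mu> \<noteq> complex_of_real l \<longrightarrow> Re \<mu> < l)) = l"
  proof (rule the_equality)
    fix k assume k: "complex_of_real k \<in> eigenvalues A \<and>
      (\<forall>\<mu>\<in>eigenvalues A. \<mu> \<noteq> complex_of_real k \<longrightarrow> Re \<mu> < k)"
    show "k = l"
    proof (rule ccontr)
      assume "k \<noteq> l"
      then have "k < l" "l < k" using k l dom[of "complex_of_real k"] by auto
      then show False by simp
    qed
  qed (use l dom in auto)
  then show ?thesis using irr by (simp add: dominant_eigenvalue_def)
qed

lemma perron_vector_eq:
  fixes A :: "real^'k^'k"
  assumes irr: "irreducible_matrix A" and u: "\<And>i. 0 < u $ i" "(\<Sum>i\<in>UNIV. u $ i) = 1"
    "u v* A = dominant_eigenvalue A *\<^sub>R u"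
  shows "perron_vector A = u"
proof -
  let ?l = "dominant_eigenvalue A"
  have "(THE v. v v* A = ?l *\<^sub>R v \<and> (\<forall>i. 0 < v $ i) \<and> (\<Sum>i\<in>UNIV. v $ i) = 1) = u"
  proof (rule the_equality)
    fix w assume w: "w v* A = ?l *\<^sub>R w \<and> (\<forall>i. 0 < w $ i) \<and> (\<Sum>i\<in>UNIV. w $ i) = 1"
    \<comment> \<open>Subtract the largest multiple of \<open>u\<close> below \<open>w\<close>: the difference has a zero coordinate.\<close>
    define t where "t = (MIN i. w $ i / u $ i)"
    define d where "d = w - t *\<^sub>R u"
    have t_le: "t \<le> w $ i / u $ i" for i unfolding t_def by (intro Min_le) auto
    have d_nn: "0 \<le> d $ i" for i
      using t_le[of i] u(1)[of i] by (simp add: d_def pos_le_divide_eq)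
    have "t \<in> range (\<lambda>i. w $ i / u $ i)" unfolding t_def by (intro Min_in) auto
    then obtain i where "t = w $ i / u $ i" by blast
    then have d0: "d $ i = 0" using u(1)[of i] by (simp add: d_def)
    have "d v* A = ?l *\<^sub>R d"
      using w u(3) by (simp add: d_def vector_matrix_mult_diff_distrib scaleR_vector_matrix_assoc
        algebra_simps)
    then have "d = 0"
      using nonneg_eigenvector_pos(2)[OF irr, of d ?l i] d_nn d0 by force
    then have "w = t *\<^sub>R u" by (simp add: d_def)
    moreover have "t = 1"
      using w u(2) by (simp add: \<open>w = t *\<^sub>R u\<close> sum_distrib_left[symmetric])
    ultimately show "w = u" by simp
  qed (use u in auto)
  then show ?thesis using irr by (simp add: perron_vector_def)
qed

text \<open>The part of Perron--Frobenius theory used below. The right eigenvector \<open>v\<close>, normalised against the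
  Perron vector, provides the weights in which the growth of the urn is measured.\<close>

theorem perron_frobenius:
  fixes A :: "real^'k^'k"
  assumes irr: "irreducible_matrix A"
  obtains v where "0 < dominant_eigenvalue A" "\<And>i. 0 < perron_vector A $ i"
    "(\<Sum>i\<in>UNIV. perron_vector A $ i) = 1"
    "perron_vector A v* A = dominant_eigenvalue A *\<^sub>R perron_vector A"
    "\<And>i. 0 < v $ i" "A *v v = dominant_eigenvalue A *\<^sub>R v" "perron_vector A \<bullet> v = 1"
proof (rule left_right_eigenvectors[OF irr])
  fix l u v
  assume uv: "0 < l" "\<And>i. 0 < u $ i" "(\<Sum>i\<in>UNIV. u $ i) = 1" "u v* A = l *\<^sub>R u"
    "\<And>i. 0 < v $ i" "A *v v = l *\<^sub>R v" "u \<bullet> v = 1"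
  have "u \<noteq> 0" using uv(3) by auto
  then have l: "dominant_eigenvalue A = l" by (rule dominant_eigenvalue_eq[OF irr _ uv(4-6)])
  then have "perron_vector A = u" using uv by (intro perron_vector_eq[OF irr]) auto
  then show ?thesis using that[of v] uv l by simp
qed

section \<open>A spectral gap away from the Perron direction\<close>

text \<open>A positive entry of a power of \<open>A\<close> is a path of positive entries of \<open>A\<close>.\<close>

lemma irreducible_const:
  fixes A :: "real^'k^'k"
  assumes irr: "irreducible_matrix A" and g: "\<And>i j. 0 < A $ i $ j \<Longrightarrow> g i = g j"
  shows "g i = g j"
proof -
  have nn: "nonneg_matrix A" using irr by (simp add: irreducible_matrix_def)
  have step: "g i = g j" if "0 < mat_power A N $ i $ j" for N i j
    using that
  proof (induction N arbitrary: i)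
    case (Suc N)
    have "0 < (\<Sum>k\<in>UNIV. A $ i $ k * mat_power A N $ k $ j)"
      using Suc.prems by (simp add: matrix_matrix_mult_def)
    then obtain k where k: "0 < A $ i $ k * mat_power A N $ k $ j"
      by (meson not_le sum_nonpos)
    have "0 \<le> A $ i $ k" "0 \<le> mat_power A N $ k $ j"
      using nn nonneg_mat_power[OF nn] by (auto simp: nonneg_matrix_def)
    with k have "0 < A $ i $ k" "0 < mat_power A N $ k $ j"
      by (auto simp: zero_less_mult_iff)
    then show ?case using g Suc.IH by metis
  qed (auto simp: mat_def split: if_splits)
  show ?thesis using irr step unfolding irreducible_matrix_def by blast
qed

text \<open>A Poincare inequality. A vector on which the quadratic form vanishes is constant along the positive
  entries of \<open>A\<close>, hence constant, hence zero if it is orthogonal to the positive vector \<open>a\<close>. The form is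
  therefore positive on a compact piece of the unit sphere, and its minimum there is the gap.\<close>

lemma dirichlet_form_gap:
  fixes A :: "real^'k^'k" and a :: "real^'k"
  assumes irr: "irreducible_matrix A" and a: "\<And>i. 0 < a $ i"
    and q: "\<And>i j. 0 \<le> q i j" "\<And>i j. 0 < A $ i $ j \<Longrightarrow> 0 < q i j"
  shows "\<exists>c>0. \<forall>g::real^'k. a \<bullet> g = 0 \<longrightarrow>
    c * (g \<bullet> g) \<le> (\<Sum>i\<in>UNIV. \<Sum>j\<in>UNIV. q i j * (g $ i - g $ j)\<^sup>2)"
proof -
  define E where "E = (\<lambda>g::real^'k. \<Sum>i\<in>UNIV. \<Sum>j\<in>UNIV. q i j * (g $ i - g $ j)\<^sup>2)"
  define T where "T = sphere 0 1 \<inter> {g. a \<bullet> g = 0}"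
  have E_scale: "E (t *\<^sub>R g) = t\<^sup>2 * E g" for t g
    by (simp add: E_def sum_distrib_left right_diff_distrib[symmetric] power_mult_distrib mult_ac)
  have E_pos: "0 < E g" if g: "g \<in> T" for g
  proof -
    have "E g \<ge> 0" unfolding E_def by (intro sum_nonneg mult_nonneg_nonneg q) auto
    moreover have "E g \<noteq> 0"
    proof
      assume "E g = 0"
      then have "\<forall>i j. q i j * (g $ i - g $ j)\<^sup>2 = 0"
        unfolding E_def by (simp add: sum_nonneg_eq_0_iff sum_nonneg q)
      then have "g $ i = g $ j" if "0 < A $ i $ j" for i j
        using q(2)[OF that] by (metis less_irrefl mult_eq_0_iff power_eq_0_iff right_minus_eq)
      then have const: "g $ i = g $ j" for i j
        by (rule irreducible_const[OF irr])
      have "a \<bullet> g = (\<Sum>i\<in>UNIV. a $ i) * g $ undefined"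
        unfolding inner_vec_def sum_distrib_right
        by (intro sum.cong refl) (metis const inner_real_def)
      moreover have "0 < (\<Sum>i\<in>UNIV. a $ i)" by (intro sum_pos) (auto simp: a)
      ultimately have "g $ undefined = 0" using g by (auto simp: T_def)
      then have "g = 0" using const by (metis vec_eq_iff zero_index)
      then show False using g by (simp add: T_def)
    qed
    ultimately show ?thesis by simp
  qed
  have "\<exists>c>0. \<forall>g\<in>T. c \<le> E g"
  proof (cases "T = {}")
    case False
    have "compact T"
      unfolding T_def
      by (intro compact_Int_closed compact_sphere closed_Collect_eq continuous_intros)
    moreover have "continuous_on T E"
      unfolding E_def by (intro continuous_intros)
    ultimately obtain g where "g \<in> T" "\<forall>h\<in>T. E g \<le> E h"
      using continuous_attains_inf[OF _ False] by blast
    then show ?thesis using E_pos by blast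
  qed (auto intro: exI[of _ 1])
  then obtain c where c: "c > 0" "\<And>g. g \<in> T \<Longrightarrow> c \<le> E g" by blast
  have "c * (g \<bullet> g) \<le> E g" if "a \<bullet> g = 0" for g
  proof (cases "g = 0")
    case False
    then have "(1 / norm g) *\<^sub>R g \<in> T" using that by (simp add: T_def)
    then have "c \<le> (1 / norm g)\<^sup>2 * E g" using c(2) E_scale by metis
    then have "c * (norm g)\<^sup>2 \<le> E g" using False by (simp add: power_divide field_simps)
    then show ?thesis by (simp add: power2_norm_eq_inner)
  qed (simp add: E_def)
  then show ?thesis using c(1) by (auto simp: E_def)
qed

text \<open>The projection of \<open>y\<close> along \<open>u\<close> to the hyperplane orthogonal to \<open>v\<close>, if \<open>u \<bullet> v = 1\<close>, with rescaled coordinates. The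
  squared Euclidean norm then is the variance of the ratios \<open>y\<^sub>i / u\<^sub>i\<close> under the probability vector \<open>u\<^sub>i v\<^sub>i\<close>;
  in this norm multiplication by \<open>A\<close> is controlled by a Dirichlet form even if \<open>A\<close> is not symmetric.\<close>

definition perron_deviation :: "real^'k \<Rightarrow> real^'k \<Rightarrow> real^'k \<Rightarrow> real^'k" where
  "perron_deviation u v y = (\<chi> i. sqrt (v $ i / u $ i) * (y $ i - (y \<bullet> v) * u $ i))"

lemma perron_deviation_linear: "linear (perron_deviation u v)"
  unfolding perron_deviation_def
  by (intro linearI) (auto simp: vec_eq_iff algebra_simps)

text \<open>With \<open>g\<^sub>i\<close> for the centred ratios and \<open>q\<^sub>i\<^sub>j = u\<^sub>i A\<^sub>i\<^sub>j v\<^sub>j\<close>, both marginals of \<open>q\<close> are \<open>l u\<^sub>i v\<^sub>i\<close>. Hence \<open>l\<close> times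
  the variance of \<open>g\<close> exceeds the inner product on the left by half the sum of \<open>q\<^sub>i\<^sub>j (g\<^sub>i - g\<^sub>j)\<^sup>2\<close>, to which the
  Poincare inequality applies. Only the inner product has a gap: if \<open>A\<close> is periodic then the norm of the
  image can be as large as \<open>l\<close> times the norm of the argument.\<close>

lemma perron_deviation_gap:
  fixes A :: "real^'k^'k"
  assumes irr: "irreducible_matrix A"
    and u: "\<And>i. 0 < u $ i" "u v* A = l *\<^sub>R u"
    and v: "\<And>i. 0 < v $ i" "A *v v = l *\<^sub>R v" and uv: "u \<bullet> v = 1"
  shows "\<exists>c>0. \<forall>y. perron_deviation u v y \<bullet> perron_deviation u v (y v* A)
    \<le> (l - c) * (perron_deviation u v y \<bullet> perron_deviation u v y)"
proof -
  let ?Z = "perron_deviation u v"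
  have nn: "nonneg_matrix A" using irr by (simp add: irreducible_matrix_def)
  define a where "a = (\<chi> i. u $ i * v $ i)"
  define q where "q = (\<lambda>i j. u $ i * A $ i $ j * v $ j)"
  have a_pos: "0 < a $ i" for i using u v by (simp add: a_def)
  have a_le: "a $ i \<le> 1" for i
  proof -
    have "a $ i \<le> (\<Sum>i\<in>UNIV. a $ i)"
      using a_pos by (intro member_le_sum) (auto simp: less_imp_le)
    also have "\<dots> = 1" using uv by (simp add: a_def inner_vec_def)
    finally show ?thesis .
  qed
  have q1: "0 \<le> q i j" for i j
    using nn u(1)[of i] v(1)[of j] by (simp add: q_def nonneg_matrix_def less_imp_le)
  have q2: "0 < q i j" if "0 < A $ i $ j" for i j
    using that u(1)[of i] v(1)[of j] by (simp add: q_def)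
  obtain c where c: "c > 0" "\<And>g::real^'k. a \<bullet> g = 0 \<Longrightarrow>
      c * (g \<bullet> g) \<le> (\<Sum>i\<in>UNIV. \<Sum>j\<in>UNIV. q i j * (g $ i - g $ j)\<^sup>2)"
    using dirichlet_form_gap[of A a q, OF irr a_pos q1 q2] by blast
  have q_row: "(\<Sum>j\<in>UNIV. q i j) = l * a $ i" for i
    using arg_cong[OF v(2), of "\<lambda>x. u $ i * x $ i"]
    by (simp add: q_def a_def mat_vec_mult_nth sum_distrib_left mult_ac)
  have q_col: "(\<Sum>i\<in>UNIV. q i j) = l * a $ j" for j
  proof -
    have "(\<Sum>i\<in>UNIV. q i j) = (u v* A) $ j * v $ j"
      by (simp add: q_def vec_mult_nth sum_distrib_right)
    then show ?thesis by (simp add: u(2) a_def)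
  qed
  have "?Z y \<bullet> ?Z (y v* A) \<le> (l - c / 2) * (?Z y \<bullet> ?Z y)" for y
  proof -
    define g where "g = (\<chi> i. (y $ i - (y \<bullet> v) * u $ i) / u $ i)"
    have y: "y $ i = u $ i * g $ i + (y \<bullet> v) * u $ i" for i
      using u(1)[of i] by (simp add: g_def field_simps)
    have "a \<bullet> g = (\<Sum>i\<in>UNIV. (y $ i - (y \<bullet> v) * u $ i) * v $ i)"
      unfolding a_def g_def inner_vec_def using u(1)
      by (intro sum.cong refl) (simp add: less_imp_neq[THEN not_sym] field_simps)
    also have "\<dots> = y \<bullet> v - (y \<bullet> v) * (u \<bullet> v)"
      by (simp add: inner_vec_def left_diff_distrib sum_subtractf sum_distrib_left mult.assoc)
    finally have g0: "a \<bullet> g = 0" using uv by simp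
    have "(y v* A) \<bullet> v = y \<bullet> (A *v v)" by (rule dot_lmul_matrix)
    then have yAv: "(y v* A) \<bullet> v = l * (y \<bullet> v)" using v(2) by simp
    have y': "y $ i - (y \<bullet> v) * u $ i = u $ i * g $ i" for i
      using y[of i] by simp
    have Z_inner: "?Z y \<bullet> ?Z w = (\<Sum>i\<in>UNIV. v $ i * g $ i * (w $ i - (w \<bullet> v) * u $ i))" for w
    proof -
      have wt: "sqrt (v $ i / u $ i) * (u $ i * p) * (sqrt (v $ i / u $ i) * r) = v $ i * p * r" for i p r
      proof -
        have "sqrt (v $ i / u $ i) * sqrt (v $ i / u $ i) = v $ i / u $ i"
          using u(1)[of i] v(1)[of i] by (simp add: less_imp_le)
        moreover have "sqrt (v $ i / u $ i) * (u $ i * p) * (sqrt (v $ i / u $ i) * r)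
            = (sqrt (v $ i / u $ i) * sqrt (v $ i / u $ i)) * (u $ i * p * r)"
          by (simp only: mult_ac)
        ultimately show ?thesis using u(1)[of i] by simp
      qed
      show ?thesis
        unfolding inner_vec_def[of "?Z y" "?Z w"]
        unfolding perron_deviation_def vec_lambda_beta inner_real_def y' wt ..
    qed
    have ZZ: "?Z y \<bullet> ?Z y = (\<Sum>i\<in>UNIV. a $ i * (g $ i)\<^sup>2)"
      unfolding Z_inner y' by (simp add: a_def power2_eq_square mult_ac)
    have yA: "(y v* A) $ i - ((y v* A) \<bullet> v) * u $ i = (\<Sum>j\<in>UNIV. u $ j * g $ j * A $ j $ i)" for i
    proof -
      have "(y v* A) $ i = (\<Sum>j\<in>UNIV. (u $ j * g $ j + (y \<bullet> v) * u $ j) * A $ j $ i)"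
        unfolding vec_mult_nth by (subst y) simp
      also have "\<dots> = (\<Sum>j\<in>UNIV. u $ j * g $ j * A $ j $ i) + (y \<bullet> v) * (\<Sum>j\<in>UNIV. u $ j * A $ j $ i)"
        by (simp add: distrib_right sum.distrib sum_distrib_left mult.assoc)
      also have "(\<Sum>j\<in>UNIV. u $ j * A $ j $ i) = l * u $ i"
        using arg_cong[OF u(2), of "\<lambda>x. x $ i"] by (simp add: vec_mult_nth)
      finally show ?thesis by (simp add: yAv)
    qed
    have "?Z y \<bullet> ?Z (y v* A) = (\<Sum>i\<in>UNIV. \<Sum>j\<in>UNIV. q j i * (g $ j * g $ i))"
      unfolding Z_inner yA by (simp add: q_def sum_distrib_left mult_ac)
    then have ZA: "?Z y \<bullet> ?Z (y v* A) = (\<Sum>i\<in>UNIV. \<Sum>j\<in>UNIV. q i j * (g $ i * g $ j))"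
      by (subst sum.swap) (simp add: )
    have "(\<Sum>i\<in>UNIV. \<Sum>j\<in>UNIV. q i j * (g $ i - g $ j)\<^sup>2)
       = (\<Sum>i\<in>UNIV. (\<Sum>j\<in>UNIV. q i j) * (g $ i)\<^sup>2) + (\<Sum>i\<in>UNIV. \<Sum>j\<in>UNIV. q i j * (g $ j)\<^sup>2)
         - 2 * (\<Sum>i\<in>UNIV. \<Sum>j\<in>UNIV. q i j * (g $ i * g $ j))"
      by (simp add: power2_diff algebra_simps sum.distrib sum_subtractf sum_distrib_left sum_distrib_right)
    also have "(\<Sum>i\<in>UNIV. \<Sum>j\<in>UNIV. q i j * (g $ j)\<^sup>2) = (\<Sum>j\<in>UNIV. (\<Sum>i\<in>UNIV. q i j) * (g $ j)\<^sup>2)"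
      by (subst sum.swap) (simp add: sum_distrib_right)
    also have "(\<Sum>i\<in>UNIV. (\<Sum>j\<in>UNIV. q i j) * (g $ i)\<^sup>2) = l * (?Z y \<bullet> ?Z y)"
      by (simp add: q_row ZZ sum_distrib_left mult.assoc)
    also have "(\<Sum>j\<in>UNIV. (\<Sum>i\<in>UNIV. q i j) * (g $ j)\<^sup>2) = l * (?Z y \<bullet> ?Z y)"
      by (simp add: q_col ZZ sum_distrib_left mult.assoc)
    finally have "c * (g \<bullet> g) \<le> 2 * l * (?Z y \<bullet> ?Z y) - 2 * (?Z y \<bullet> ?Z (y v* A))"
      using c(2)[OF g0] ZA by simp
    moreover have "?Z y \<bullet> ?Z y \<le> g \<bullet> g"
    proof -
      have "a $ i * (g $ i)\<^sup>2 \<le> g $ i * g $ i" for i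
        using a_le[of i] less_imp_le[OF a_pos[of i]]
        by (simp add: power2_eq_square[symmetric] mult_left_le_one_le)
      then show ?thesis unfolding ZZ by (auto simp: inner_vec_def intro: sum_mono)
    qed
    then have "c * (?Z y \<bullet> ?Z y) \<le> c * (g \<bullet> g)" using c(1) by simp
    ultimately show ?thesis by (simp add: algebra_simps)
  qed
  then show ?thesis using c(1) by (intro exI[of _ "c / 2"]) auto
qed

text \<open>The deviation of \<open>y A\<close> depends linearly on the deviation of \<open>y\<close>, because \<open>u\<close> is an eigenvector.\<close>

lemma perron_deviation_mult_bounded:
  fixes A :: "real^'k^'k"
  assumes u: "\<And>i. 0 < u $ i" "u v* A = l *\<^sub>R u" and v: "\<And>i. 0 < v $ i" and uv: "u \<bullet> v = 1"
  shows "\<exists>c>0. \<forall>y. norm (perron_deviation u v (y v* A)) \<le> c * norm (perron_deviation u v y)"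
proof -
  let ?Z = "perron_deviation u v"
  define D where "D = (\<lambda>z::real^'k. \<chi> i. z $ i / sqrt (v $ i / u $ i))"
  have "linear (\<lambda>z. ?Z (D z v* A))"
  proof -
    have "D (x + y) = D x + D y" "D (t *\<^sub>R x) = t *\<^sub>R D x" for x y t
      by (auto simp: D_def vec_eq_iff add_divide_distrib)
    then have "linear (\<lambda>z. D z v* A)"
      by (intro linearI) (simp_all add: vector_matrix_left_distrib scaleR_vector_matrix_assoc)
    then show ?thesis using linear_compose[OF _ perron_deviation_linear] by (simp add: o_def)
  qed
  then obtain c where c: "c > 0" "\<And>z. norm (?Z (D z v* A)) \<le> c * norm z"
    using linear_bounded_pos by blast
  have "?Z (D (?Z y) v* A) = ?Z (y v* A)" for y
  proof -
    have D: "D (?Z y) = y - (y \<bullet> v) *\<^sub>R u"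
    proof -
      have "v $ i / u $ i \<noteq> 0" for i using u(1)[of i] v(1)[of i] by auto
      then show ?thesis by (auto simp: D_def perron_deviation_def vec_eq_iff)
    qed
    have "?Z u = 0" by (simp add: perron_deviation_def uv vec_eq_iff)
    then show ?thesis
      unfolding D vector_matrix_mult_diff_distrib scaleR_vector_matrix_assoc u(2)
      by (simp add: linear_diff[OF perron_deviation_linear] linear_cmul[OF perron_deviation_linear])
  qed
  then show ?thesis using c by metis
qed

section \<open>The deterministic urn recursion\<close>

text \<open>The excess of \<open>r\<close> over any positive level shrinks by the factors \<open>1 - b n \<le> exp (- b n)\<close>, whose product
  vanishes because the series of the \<open>b n\<close> diverges.\<close>

lemma damped_recursion_tendsto_0:
  fixes r b e :: "nat \<Rightarrow> real"
  assumes r: "\<And>n. 0 \<le> r n"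
    and rec: "\<forall>\<^sub>F n in sequentially. r (Suc n) \<le> (1 - b n) * r n + b n * e n"
    and b: "\<forall>\<^sub>F n in sequentially. 0 \<le> b n \<and> b n \<le> 1" "\<not> summable b"
    and e: "e \<longlonglongrightarrow> 0"
  shows "r \<longlonglongrightarrow> 0"
proof (rule LIMSEQ_I)
  fix \<epsilon> :: real assume "0 < \<epsilon>"
  then have "\<forall>\<^sub>F n in sequentially. e n < \<epsilon> / 2" using e by (intro order_tendstoD) auto
  with rec b(1) have "\<forall>\<^sub>F n in sequentially. r (Suc n) \<le> (1 - b n) * r n + b n * e n
      \<and> 0 \<le> b n \<and> b n \<le> 1 \<and> e n < \<epsilon> / 2"
    by eventually_elim auto
  then obtain k where k: "\<And>n. n \<ge> k \<Longrightarrow> r (Suc n) \<le> (1 - b n) * r n + b n * e n"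
      "\<And>n. n \<ge> k \<Longrightarrow> 0 \<le> b n" "\<And>n. n \<ge> k \<Longrightarrow> b n \<le> 1" "\<And>n. n \<ge> k \<Longrightarrow> e n < \<epsilon> / 2"
    unfolding eventually_sequentially by blast
  define d where "d = (\<lambda>n. max (r (n + k) - \<epsilon> / 2) 0)"
  define B where "B = (\<lambda>n. \<Sum>i<n. b (i + k))"
  have d_Suc: "d (Suc n) \<le> (1 - b (n + k)) * d n" for n
  proof -
    have "b (n + k) * e (n + k) \<le> b (n + k) * (\<epsilon> / 2)"
      using k(2,4)[of "n + k"] by (intro mult_left_mono) auto
    then have "r (Suc n + k) - \<epsilon> / 2 \<le> (1 - b (n + k)) * (r (n + k) - \<epsilon> / 2)"
      using k(1)[of "n + k"] by (simp add: algebra_simps)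
    also have "\<dots> \<le> (1 - b (n + k)) * d n"
      using k(3)[of "n + k"] by (intro mult_left_mono) (auto simp: d_def)
    finally have "r (Suc n + k) - \<epsilon> / 2 \<le> (1 - b (n + k)) * d n" .
    moreover have "0 \<le> (1 - b (n + k)) * d n"
      using k(3)[of "n + k"] by (auto simp: d_def)
    ultimately show ?thesis by (simp add: d_def)
  qed
  have d_le: "d n \<le> d 0 * exp (- B n)" for n
  proof (induction n)
    case (Suc n)
    have "d (Suc n) \<le> (1 - b (n + k)) * d n" by (rule d_Suc)
    also have "\<dots> \<le> exp (- b (n + k)) * (d 0 * exp (- B n))"
      using k(3)[of "n + k"] Suc exp_ge_add_one_self[of "- b (n + k)"]
      by (intro mult_mono) (auto simp: d_def)
    also have "\<dots> = d 0 * exp (- B (Suc n))"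
      by (simp add: B_def exp_add[symmetric] exp_minus mult_ac exp_diff field_simps)
    finally show ?case .
  qed (simp add: B_def)
  have "\<not> summable (\<lambda>n. b (n + k))" using b(2) by (simp add: summable_iff_shift)
  then have B_unbounded: "\<exists>n. Z < B n" for Z
    using summableI_nonneg_bounded[of "\<lambda>n. b (n + k)" Z] k(2) by (force simp: B_def not_le)
  have "incseq B" unfolding B_def using k(2) by (intro incseq_SucI) auto
  then have "filterlim B at_top sequentially"
    unfolding filterlim_at_top eventually_sequentially
    using B_unbounded by (meson incseqD less_imp_le order_trans)
  then have "filterlim (\<lambda>n. - B n) at_bot sequentially"
    by (simp add: filterlim_uminus_at_bot)
  then have "(\<lambda>n. exp (- B n)) \<longlonglongrightarrow> 0"
    using filterlim_compose[OF exp_at_bot] by blast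
  then have "(\<lambda>n. d 0 * exp (- B n)) \<longlonglongrightarrow> 0" by (rule tendsto_mult_right_zero)
  then have "\<forall>\<^sub>F n in sequentially. d 0 * exp (- B n) < \<epsilon> / 2"
    using \<open>0 < \<epsilon>\<close> by (intro order_tendstoD) auto
  then obtain N where N: "\<And>n. n \<ge> N \<Longrightarrow> d 0 * exp (- B n) < \<epsilon> / 2"
    unfolding eventually_sequentially by blast
  show "\<exists>no. \<forall>n\<ge>no. norm (r n - 0) < \<epsilon>"
  proof (intro exI allI impI)
    fix n assume "n \<ge> N + k"
    then have "d (n - k) < \<epsilon> / 2" using N[of "n - k"] d_le[of "n - k"] by force
    then show "norm (r n - 0) < \<epsilon>" using r[of n] \<open>n \<ge> N + k\<close> by (auto simp: d_def max_def split: if_splits)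
  qed
qed

text \<open>Two quantities grow by factors \<open>1 + \<kappa> \<sigma> n\<close> and \<open>1 + l \<sigma> n\<close> with \<open>\<kappa> < l\<close>. Their ratio is damped at the rate
  \<open>(l - \<kappa>) \<sigma> n\<close>, which is at least of order \<open>1 / m n\<close> and hence of order \<open>1 / n\<close>, so that the damping
  is not summable. The errors \<open>e n\<close> are divided by \<open>m n\<close> and are thus negligible against the damping.\<close>

lemma growth_gap_ratio_tendsto_0:
  fixes a m \<sigma> e :: "nat \<Rightarrow> real"
  assumes a: "\<And>n. 0 \<le> a n"
    and rec_a: "\<forall>\<^sub>F n in sequentially. a (Suc n) \<le> (1 + \<kappa> * \<sigma> n) * a n + e n"
    and rec_m: "\<forall>\<^sub>F n in sequentially. (1 + l * \<sigma> n) * m n - e n \<le> m (Suc n)"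
    and gap: "\<kappa> < l"
    and \<sigma>m: "c1 > 0" "\<forall>\<^sub>F n in sequentially. c1 \<le> \<sigma> n * m n"
    and m_pos: "\<And>n. 0 \<le> m n" and m_top: "filterlim m at_top sequentially" 
    and m_le: "c2 > 0" "\<And>n. m n \<le> c2 * real n"
    and am: "\<And>n. a n \<le> c3 * m n"
    and e: "e \<longlonglongrightarrow> 0"
  shows "(\<lambda>n. a n / m n) \<longlonglongrightarrow> 0"
proof -
  define G where "G = (l - \<kappa>) * c1"
  define b where "b = (\<lambda>n. G / m (Suc n))"
  define f where "f = (\<lambda>n. (\<bar>c3\<bar> + 1) / G * \<bar>e n\<bar>)"
  have gap': "0 < G" using gap \<sigma>m(1) by (simp add: G_def)
  have m_top': "filterlim (\<lambda>n. m (Suc n)) at_top sequentially"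
    using m_top by (simp add: filterlim_sequentially_Suc)
  show ?thesis
  proof (rule damped_recursion_tendsto_0[where b = b and e = f])
    show "0 \<le> a n / m n" for n using a m_pos by simp
    have "\<forall>\<^sub>F n in sequentially. 0 < m n" "\<forall>\<^sub>F n in sequentially. 0 < m (Suc n)"
      using m_top m_top' unfolding filterlim_at_top_dense by auto
    with rec_a rec_m \<sigma>m(2)
    show "\<forall>\<^sub>F n in sequentially. a (Suc n) / m (Suc n) \<le> (1 - b n) * (a n / m n) + b n * f n"
    proof eventually_elim
      case (elim n)
      define r where "r = a n / m n"
      have r: "a n = r * m n" "0 \<le> r" using elim a[of n] by (auto simp: r_def)
      have r_le: "r \<le> \<bar>c3\<bar>" using am[of n] elim by (simp add: r_def divide_le_eq)
         (meson abs_ge_self less_imp_le mult_right_mono order_trans)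
      have "r * ((1 + l * \<sigma> n) * m n) \<le> r * (m (Suc n) + e n)"
        using elim(2) r(2) by (intro mult_left_mono) auto
      moreover have "(r * (l - \<kappa>)) * c1 \<le> (r * (l - \<kappa>)) * (\<sigma> n * m n)"
        using elim(3) r(2) gap by (intro mult_left_mono) auto
      moreover have "r * e n \<le> \<bar>c3\<bar> * \<bar>e n\<bar>"
      proof -
        have "r * e n \<le> r * \<bar>e n\<bar>" using r(2) by (intro mult_left_mono) auto
        also have "\<dots> \<le> \<bar>c3\<bar> * \<bar>e n\<bar>" using r_le by (intro mult_right_mono) auto
        finally show ?thesis .
      qed
      moreover have "a (Suc n) \<le> r * ((1 + l * \<sigma> n) * m n) - (r * (l - \<kappa>)) * (\<sigma> n * m n) + e n"
        using elim(1) by (simp add: r algebra_simps)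
      ultimately have "a (Suc n) \<le> r * m (Suc n) - r * G + (\<bar>c3\<bar> + 1) * \<bar>e n\<bar>"
        by (simp add: G_def distrib_left distrib_right mult.assoc)
      then have "a (Suc n) / m (Suc n) \<le> (r * m (Suc n) - r * G + (\<bar>c3\<bar> + 1) * \<bar>e n\<bar>) / m (Suc n)"
        using elim(5) by (intro divide_right_mono) auto
      also have "\<dots> = (1 - b n) * r + b n * f n"
        using elim(5) gap' by (simp add: b_def f_def field_simps)
      finally show ?case by (simp add: r_def)
    qed
    have "\<forall>\<^sub>F n in sequentially. max 1 G \<le> m (Suc n)"
      using m_top' unfolding filterlim_at_top by blast
    then show "\<forall>\<^sub>F n in sequentially. 0 \<le> b n \<and> b n \<le> 1"
      by eventually_elim (use gap' in \<open>auto simp: b_def divide_le_eq\<close>)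
    show "\<not> summable b"
    proof
      assume "summable b"
      then have "summable (\<lambda>n. c2 / G * b n)" by (rule summable_mult)
      moreover have "\<forall>\<^sub>F n in sequentially. norm (inverse (real (Suc n))) \<le> c2 / G * b n"
        using \<open>\<forall>\<^sub>F n in sequentially. 0 < m (Suc n)\<close>
      proof eventually_elim
        case (elim n)
        have "c2 / G * b n = c2 / m (Suc n)" using gap' by (simp add: b_def)
        moreover have "1 / real (Suc n) \<le> c2 / m (Suc n)"
          using m_le(2)[of "Suc n"] elim by (simp add: field_simps del: of_nat_Suc)
        ultimately show ?case by (simp add: inverse_eq_divide del: of_nat_Suc)
      qed
      ultimately have "summable (\<lambda>n. inverse (real (Suc n)))"
        by (rule summable_comparison_test_ev[rotated])
      then have "summable (\<lambda>n. inverse (real n))"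
        using summable_Suc_iff[of "\<lambda>n. inverse (real n)"] by blast
      then show False using not_summable_harmonic[where 'a = real] by blast
    qed
    have "(\<lambda>n. \<bar>e n\<bar>) \<longlonglongrightarrow> 0" using e by (rule tendsto_rabs_zero)
    then show "f \<longlonglongrightarrow> 0" unfolding f_def by (rule tendsto_mult_right_zero)
  qed
qed

text \<open>If the contents are \<open>y A\<close> up to an error \<open>o(n)\<close>, where \<open>y\<close> accumulates the proportions, then
  \<open>y\<close> itself follows \<open>y (Suc n) = y n (I + A / s n) + o(1)\<close>. This is the linear flow of \<open>A\<close> in a slowed
  down time. The weighted mass \<open>m n = y n \<bullet> v\<close> grows at the rate \<open>l\<close> and the deviation from the Perron
  direction at a rate strictly below \<open>l\<close>, so the direction of \<open>y\<close> converges.\<close>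

theorem mean_field_urn_limit:
  fixes C :: "nat \<Rightarrow> real^'k" and A :: "real^'k^'k"
  defines "s \<equiv> (\<lambda>n. \<Sum>i\<in>UNIV. C n $ i)"
  defines "y \<equiv> (\<lambda>n. \<Sum>k<n. (1 / s k) *\<^sub>R C k)"
  assumes irr: "irreducible_matrix A"
    and C: "\<And>n i. 0 \<le> C n $ i" "\<And>n. 0 < s n"
    and lim: "(\<lambda>n. (1 / real n) *\<^sub>R (C n - y n v* A)) \<longlonglongrightarrow> 0"
  shows "(\<lambda>n. (1 / real n) *\<^sub>R y n) \<longlonglongrightarrow> perron_vector A"
proof (rule perron_frobenius[OF irr])
  let ?l = "dominant_eigenvalue A" and ?u = "perron_vector A"
  fix v
  assume l: "0 < ?l" and u: "\<And>i. 0 < ?u $ i" "(\<Sum>i\<in>UNIV. ?u $ i) = 1" "?u v* A = ?l *\<^sub>R ?u"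
    and v: "\<And>i. 0 < v $ i" "A *v v = ?l *\<^sub>R v" and uv: "?u \<bullet> v = 1"
  let ?Z = "perron_deviation ?u v"
  have nn: "nonneg_matrix A" using irr by (simp add: irreducible_matrix_def)
  define \<sigma> where "\<sigma> = (\<lambda>n. 1 / s n)"
  define d where "d = (\<lambda>n. C n - y n v* A)"
  define m where "m = (\<lambda>n. y n \<bullet> v)"
  define p where "p = (MIN i. v $ i)"
  define P where "P = (MAX i. v $ i)"
  have p: "0 < p" "\<And>i. p \<le> v $ i"
    and P: "0 < P" "\<And>i. v $ i \<le> P"
  proof -
    have "p \<in> range (\<lambda>i. v $ i)" unfolding p_def by (intro Min_in) auto
    then show "0 < p" using v(1) by auto
    have "P \<in> range (\<lambda>i. v $ i)" unfolding P_def by (intro Max_in) auto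
    then show "0 < P" using v(1) by auto
  qed (auto simp: p_def P_def)
  have inner_v: "p * (\<Sum>i\<in>UNIV. w $ i) \<le> w \<bullet> v" "w \<bullet> v \<le> P * (\<Sum>i\<in>UNIV. w $ i)"
    if "\<And>i. 0 \<le> w $ i" for w :: "real^'k"
    unfolding inner_vec_def sum_distrib_left inner_real_def
    using that p(2) P(2) by (auto intro!: sum_mono simp: mult.commute[of _ "w $ _"] mult_left_mono)
  have y_nn: "0 \<le> y n $ i" for n i
    unfolding y_def using C(1) less_imp_le[OF C(2)] by (auto intro!: sum_nonneg)
  have y_sum: "(\<Sum>i\<in>UNIV. y n $ i) = real n" for n
  proof -
    have "(\<Sum>i\<in>UNIV. y n $ i) = (\<Sum>k<n. \<Sum>i\<in>UNIV. (1 / s k) * C k $ i)"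
      unfolding y_def by (simp add: sum.swap[of _ "{..<n}" UNIV])
    also have "\<dots> = (\<Sum>k<n. (1 / s k) * s k)" by (simp add: s_def sum_distrib_left)
    also have "\<dots> = real n" using C(2) by (simp add: less_imp_neq[THEN not_sym])
    finally show ?thesis .
  qed
  have yA_nn: "0 \<le> (y n v* A) $ i" for n i
    using nn y_nn by (rule vec_mult_nonneg)
  have m_bounds: "p * real n \<le> m n" "m n \<le> P * real n" for n
    using inner_v[of "y n"] y_nn by (auto simp: m_def y_sum)
  have m_nn: "0 \<le> m n" for n
    using m_bounds(1)[of n] p(1) by (meson less_imp_le mult_nonneg_nonneg of_nat_0_le_iff order_trans)
  have yAv: "(y n v* A) \<bullet> v = ?l * m n" for n
    using v(2) by (simp add: dot_lmul_matrix m_def)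
  have m_top: "filterlim m at_top sequentially"
  proof (rule filterlim_at_top_mono)
    show "filterlim (\<lambda>n. p * real n) at_top sequentially"
      by (rule filterlim_tendsto_pos_mult_at_top[OF tendsto_const p(1) filterlim_real_sequentially])
  qed (use m_bounds in auto)
  \<comment> \<open>The total content is comparable to \<open>n\<close>, because the weighted total content \<open>(y A) \<bullet> v\<close> is.\<close>
  define c0 where "c0 = ?l / p + ?l / (2 * P)"
  have c0: "0 < c0" unfolding c0_def using l p P by (intro add_pos_pos) auto
  \<comment> \<open>The constant \<open>\<eta>\<close> makes the error at most half of the lower bound \<open>l / P\<close> for the main term, relative to \<open>m n\<close>.\<close>
  define \<eta> where "\<eta> = ?l * p / (2 * P)"
  have "\<eta> > 0" using l p P by (simp add: \<eta>_def)
  have d_sum: "(\<lambda>n. \<bar>\<Sum>i\<in>UNIV. d n $ i\<bar> / real n) \<longlonglongrightarrow> 0"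
  proof -
    have "(\<lambda>n. \<Sum>i\<in>UNIV. ((1 / real n) *\<^sub>R d n) $ i) \<longlonglongrightarrow> (\<Sum>i\<in>UNIV. (0::real^'k) $ i)"
      using lim unfolding d_def by (intro tendsto_sum tendsto_vec_nth)
    then have "(\<lambda>n. (\<Sum>i\<in>UNIV. d n $ i) / real n) \<longlonglongrightarrow> 0"
      by (simp add: sum_divide_distrib)
    then show ?thesis using tendsto_rabs_zero by fastforce
  qed
  then have "\<forall>\<^sub>F n in sequentially. \<bar>\<Sum>i\<in>UNIV. d n $ i\<bar> / real n < \<eta>"
    using \<open>\<eta> > 0\<close> by (intro order_tendstoD) auto
  with eventually_gt_at_top[of 0]
  have s_bounds: "\<forall>\<^sub>F n in sequentially. ?l / (2 * P) * m n \<le> s n \<and> s n \<le> c0 * m n"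
  proof eventually_elim
    case (elim n)
    let ?t = "\<Sum>i\<in>UNIV. (y n v* A) $ i"
    have s: "s n = ?t + (\<Sum>i\<in>UNIV. d n $ i)"
      by (simp add: s_def d_def sum_subtractf)
    have "\<bar>\<Sum>i\<in>UNIV. d n $ i\<bar> \<le> \<eta> * real n" using elim by (simp add: field_simps)
    also have "\<dots> = ?l / (2 * P) * (p * real n)" by (simp add: \<eta>_def)
    also have "\<dots> \<le> ?l / (2 * P) * m n"
      using m_bounds(1) l P by (intro mult_left_mono) auto
    finally have D: "\<bar>\<Sum>i\<in>UNIV. d n $ i\<bar> \<le> ?l / (2 * P) * m n" .
    have "p * ?t \<le> ?l * m n" "?l * m n \<le> P * ?t"
      using inner_v[of "y n v* A"] yA_nn yAv by auto
    then have "?l / P * m n \<le> ?t" "?t \<le> ?l / p * m n" using p(1) P(1) by (auto simp: field_simps)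
    moreover have "?l / P * m n = 2 * (?l / (2 * P) * m n)" by simp
    ultimately show ?case using s D unfolding c0_def distrib_right by linarith
  qed
  have m_pos: "\<forall>\<^sub>F n in sequentially. 0 < m n"
    using m_top unfolding filterlim_at_top_dense by auto
  have \<sigma>m: "\<forall>\<^sub>F n in sequentially. 1 / c0 \<le> \<sigma> n * m n"
    using s_bounds
  proof eventually_elim
    case (elim n)
    then show ?case using c0 C(2)[of n] by (simp add: \<sigma>_def field_simps)
  qed
  have \<sigma>n: "\<forall>\<^sub>F n in sequentially. \<sigma> n * real n \<le> 2 * P / (?l * p)"
    using s_bounds
  proof eventually_elim
    case (elim n)
    have "?l / (2 * P) * (p * real n) \<le> ?l / (2 * P) * m n"
      using m_bounds(1) l P by (intro mult_left_mono) auto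
    also have "\<dots> \<le> s n" using elim by simp
    finally show ?case using C(2)[of n] l p P by (simp add: \<sigma>_def field_simps)
  qed
  have \<sigma>_nn: "0 \<le> \<sigma> n" for n using C(2)[of n] by (simp add: \<sigma>_def)
  have \<sigma>_lim: "\<sigma> \<longlonglongrightarrow> 0"
  proof (rule tendsto_sandwich[where f = "\<lambda>_. 0"])
    show "(\<lambda>n. (2 * P / (?l * p)) * (1 / real n)) \<longlonglongrightarrow> 0"
      by (rule tendsto_mult_right_zero) (rule lim_1_over_n)
    show "\<forall>\<^sub>F n in sequentially. \<sigma> n \<le> (2 * P / (?l * p)) * (1 / real n)"
      using \<sigma>n eventually_gt_at_top[of 0]
    proof eventually_elim
      case (elim n)
      then show ?case using pos_le_divide_eq[of "real n" "\<sigma> n" "2 * P / (?l * p)"] by simp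
    qed
  qed (auto simp: \<sigma>_nn)
  have \<sigma>d: "(\<lambda>n. norm (\<sigma> n *\<^sub>R d n)) \<longlonglongrightarrow> 0"
  proof (rule tendsto_sandwich[where f = "\<lambda>_. 0"])
    show "(\<lambda>n. (2 * P / (?l * p)) * norm ((1 / real n) *\<^sub>R d n)) \<longlonglongrightarrow> 0"
      by (intro tendsto_mult_right_zero tendsto_norm_zero) (use lim in \<open>simp add: d_def\<close>)
    show "\<forall>\<^sub>F n in sequentially. norm (\<sigma> n *\<^sub>R d n) \<le> (2 * P / (?l * p)) * norm ((1 / real n) *\<^sub>R d n)"
      using \<sigma>n eventually_gt_at_top[of 0]
    proof eventually_elim
      case (elim n)
      have "norm (\<sigma> n *\<^sub>R d n) = (\<sigma> n * real n) * norm ((1 / real n) *\<^sub>R d n)"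
        using elim \<sigma>_nn[of n] by simp
      also have "\<dots> \<le> (2 * P / (?l * p)) * norm ((1 / real n) *\<^sub>R d n)"
        using elim by (intro mult_right_mono) auto
      finally show ?case .
    qed
  qed auto
  have y_Suc: "y (Suc n) = y n + \<sigma> n *\<^sub>R (y n v* A) + \<sigma> n *\<^sub>R d n" for n
    by (simp add: y_def \<sigma>_def d_def scaleR_diff_right)
  obtain c where c: "c > 0" "\<And>w. ?Z w \<bullet> ?Z (w v* A) \<le> (?l - c) * (?Z w \<bullet> ?Z w)"
    using perron_deviation_gap[OF irr u(1,3) v uv] by blast
  obtain cA where cA: "cA > 0" "\<And>w. norm (?Z (w v* A)) \<le> cA * norm (?Z w)"
    using perron_deviation_mult_bounded[OF u(1,3) v(1) uv] by blast
  obtain cZ where cZ: "cZ > 0" "\<And>w. norm (?Z w) \<le> cZ * norm w"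
    using linear_bounded_pos[OF perron_deviation_linear] by blast
  define a where "a = (\<lambda>n. norm (?Z (y n)))"
  define e where "e = (\<lambda>n. (cZ + norm v) * norm (\<sigma> n *\<^sub>R d n))"
  \<comment> \<open>Half of the gap pays for the term of second order in \<open>\<sigma> n\<close>, which is where \<open>cA\<close> enters.\<close>
  define \<kappa> where "\<kappa> = ?l - c / 2"
  have "(\<lambda>n. a n / m n) \<longlonglongrightarrow> 0"
  proof (rule growth_gap_ratio_tendsto_0[where \<sigma> = \<sigma> and e = e and \<kappa> = \<kappa> and l = ?l
      and ?c1.0 = "1 / c0" and ?c2.0 = P])
    show "0 \<le> a n" for n by (simp add: a_def)
    show "e \<longlonglongrightarrow> 0" unfolding e_def using \<sigma>d by (rule tendsto_mult_right_zero)
    show "\<kappa> < ?l" using c by (simp add: \<kappa>_def)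
    show "a n \<le> (cZ / p) * m n" for n
    proof -
      have "norm (y n) \<le> (\<Sum>i\<in>UNIV. \<bar>y n $ i\<bar>)" by (rule norm_le_l1_cart)
      also have "\<dots> = real n" using y_nn y_sum by simp
      also have "\<dots> \<le> m n / p" using m_bounds(1)[of n] p(1) by (simp add: field_simps)
      finally have "cZ * norm (y n) \<le> cZ * (m n / p)" using cZ(1) by (intro mult_left_mono) auto
      then show ?thesis using cZ(2)[of "y n"] by (simp add: a_def)
    qed
    show "\<forall>\<^sub>F n in sequentially. (1 + ?l * \<sigma> n) * m n - e n \<le> m (Suc n)"
    proof (rule always_eventually, rule allI)
      fix n
      have "m (Suc n) = (1 + ?l * \<sigma> n) * m n + (\<sigma> n *\<^sub>R d n) \<bullet> v"
        by (simp add: m_def y_Suc inner_add_left yAv[unfolded m_def] distrib_right)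
      moreover have "\<bar>(\<sigma> n *\<^sub>R d n) \<bullet> v\<bar> \<le> norm (\<sigma> n *\<^sub>R d n) * norm v"
        by (rule Cauchy_Schwarz_ineq2)
      moreover have "0 \<le> cZ * norm (\<sigma> n *\<^sub>R d n)" using cZ(1) by simp
      ultimately show "(1 + ?l * \<sigma> n) * m n - e n \<le> m (Suc n)"
        unfolding e_def distrib_right by (simp only: mult.commute[of "norm v"])
    qed
    have "(\<lambda>n. \<sigma> n * cA\<^sup>2) \<longlonglongrightarrow> 0"
      by (rule tendsto_mult_left_zero[OF \<sigma>_lim])
    then have small1: "\<forall>\<^sub>F n in sequentially. \<sigma> n * cA\<^sup>2 < c"
      using c(1) by (rule order_tendstoD)
    have "(\<lambda>n. 1 + \<sigma> n * \<kappa>) \<longlonglongrightarrow> 1 + 0 * \<kappa>"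
      by (intro tendsto_intros \<sigma>_lim)
    then have small2: "\<forall>\<^sub>F n in sequentially. 0 < 1 + \<sigma> n * \<kappa>"
      by (rule order_tendstoD) simp
    show "\<forall>\<^sub>F n in sequentially. a (Suc n) \<le> (1 + \<kappa> * \<sigma> n) * a n + e n"
      using small1 small2
    proof eventually_elim
      case (elim n)
      let ?w = "?Z (y n) + \<sigma> n *\<^sub>R ?Z (y n v* A)"
      have Z_Suc: "?Z (y (Suc n)) = ?w + ?Z (\<sigma> n *\<^sub>R d n)"
        by (simp add: y_Suc linear_add[OF perron_deviation_linear] linear_cmul[OF perron_deviation_linear])
      have "(norm ?w)\<^sup>2 = (a n)\<^sup>2 + 2 * \<sigma> n * (?Z (y n) \<bullet> ?Z (y n v* A)) + (\<sigma> n)\<^sup>2 * (norm (?Z (y n v* A)))\<^sup>2"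
        unfolding a_def power2_norm_eq_inner
        by (simp add: inner_add_left inner_add_right inner_commute power2_eq_square algebra_simps)
      also have "\<dots> \<le> (a n)\<^sup>2 + 2 * \<sigma> n * ((?l - c) * (a n)\<^sup>2) + (\<sigma> n)\<^sup>2 * (cA * a n)\<^sup>2"
        using c(2)[of "y n"] cA(2)[of "y n"] \<sigma>_nn[of n]
        by (intro add_mono mult_left_mono power_mono) (auto simp: a_def power2_norm_eq_inner)
      also have "\<dots> = (a n)\<^sup>2 * (1 + 2 * \<sigma> n * (?l - c) + \<sigma> n * (\<sigma> n * cA\<^sup>2))"
        by (simp add: algebra_simps power2_eq_square)
      also have "\<dots> \<le> (a n)\<^sup>2 * (1 + \<sigma> n * \<kappa>)\<^sup>2"
      proof (intro mult_left_mono)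
        have "\<sigma> n * (\<sigma> n * cA\<^sup>2) \<le> \<sigma> n * c"
          using elim(1) \<sigma>_nn[of n] by (intro mult_left_mono) auto
        moreover have "(1 + \<sigma> n * \<kappa>)\<^sup>2 = 1 + 2 * \<sigma> n * (?l - c) + \<sigma> n * c + (\<sigma> n * \<kappa>)\<^sup>2"
          by (simp add: \<kappa>_def power2_eq_square algebra_simps)
        ultimately show "1 + 2 * \<sigma> n * (?l - c) + \<sigma> n * (\<sigma> n * cA\<^sup>2) \<le> (1 + \<sigma> n * \<kappa>)\<^sup>2"
          using zero_le_power2[of "\<sigma> n * \<kappa>"] by linarith
      qed auto
      also have "\<dots> = ((1 + \<kappa> * \<sigma> n) * a n)\<^sup>2" by (simp add: power_mult_distrib mult_ac)
      finally have "norm ?w \<le> (1 + \<kappa> * \<sigma> n) * a n"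
        by (rule power2_le_imp_le) (use elim in \<open>simp add: a_def mult.commute\<close>)
      moreover have "norm (?Z (\<sigma> n *\<^sub>R d n)) \<le> e n"
        using cZ(2)[of "\<sigma> n *\<^sub>R d n"] unfolding e_def distrib_right
        by (meson add_increasing2 mult_nonneg_nonneg norm_ge_zero)
      ultimately show ?case
        using norm_triangle_ineq[of ?w "?Z (\<sigma> n *\<^sub>R d n)"] unfolding a_def Z_Suc by linarith
    qed
  qed (use c0 \<sigma>m m_nn m_top P m_bounds in auto)
  then have "(\<lambda>n. P * (a n / m n)) \<longlonglongrightarrow> 0" by (rule tendsto_mult_right_zero)
  have dev: "(\<lambda>n. ?Z ((1 / real n) *\<^sub>R y n)) \<longlonglongrightarrow> 0"
  proof (rule Lim_null_comparison)
    show "(\<lambda>n. P * (a n / m n)) \<longlonglongrightarrow> 0" by fact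
    show "\<forall>\<^sub>F n in sequentially. norm (?Z ((1 / real n) *\<^sub>R y n)) \<le> P * (a n / m n)"
      using m_pos eventually_gt_at_top[of 0]
    proof eventually_elim
      case (elim n)
      have "a n * m n \<le> a n * (P * real n)"
        using m_bounds(2)[of n] by (intro mult_left_mono) (auto simp: a_def)
      then have "a n / real n \<le> P * (a n / m n)" using elim by (simp add: field_simps)
      moreover have "norm (?Z ((1 / real n) *\<^sub>R y n)) = a n / real n"
        by (simp add: linear_cmul[OF perron_deviation_linear] a_def)
      ultimately show ?case by simp
    qed
  qed
  \<comment> \<open>The averages lie in the simplex, so summing the coordinates identifies the limit of the scalar \<open>h n\<close>.\<close>
  define h where "h = (\<lambda>n. ((1 / real n) *\<^sub>R y n) \<bullet> v)"
  have comp: "(\<lambda>n. ((1 / real n) *\<^sub>R y n) $ i - h n * ?u $ i) \<longlonglongrightarrow> 0" for i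
  proof -
    have ne: "sqrt (v $ i / ?u $ i) \<noteq> 0" using v(1)[of i] u(1)[of i] by simp
    have "(\<lambda>n. (1 / sqrt (v $ i / ?u $ i)) * ?Z ((1 / real n) *\<^sub>R y n) $ i) \<longlonglongrightarrow> 0"
      by (intro tendsto_mult_right_zero) (use tendsto_vec_nth[OF dev, of i] in simp)
    then show ?thesis using ne by (simp add: perron_deviation_def h_def)
  qed
  have "(\<lambda>n. \<Sum>i\<in>UNIV. ((1 / real n) *\<^sub>R y n) $ i - h n * ?u $ i) \<longlonglongrightarrow> 0"
    using tendsto_sum[of UNIV, OF comp] by simp
  moreover have "\<forall>\<^sub>F n in sequentially. (\<Sum>i\<in>UNIV. ((1 / real n) *\<^sub>R y n) $ i - h n * ?u $ i) = 1 - h n"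
    using eventually_gt_at_top[of 0]
  proof eventually_elim
    case (elim n)
    then show ?case
      using y_sum[of n] u(2) by (simp add: sum_subtractf sum_divide_distrib[symmetric] sum_distrib_left[symmetric])
  qed
  ultimately have "(\<lambda>n. 1 - h n) \<longlonglongrightarrow> 0" by (rule Lim_transform_eventually)
  then have h: "h \<longlonglongrightarrow> 1" using tendsto_diff[OF tendsto_const[of 1], of "\<lambda>n. 1 - h n" 0] by simp
  have "(\<lambda>n. ((1 / real n) *\<^sub>R y n) $ i) \<longlonglongrightarrow> ?u $ i" for i
    using tendsto_add[OF comp[of i] tendsto_mult_right[OF h, of "?u $ i"]] by simp
  then show ?thesis by (rule vec_tendstoI)
qed

section \<open>Measurability of the Perron data\<close>

lemma borel_measurable_vec_iff:
  "(f :: 'b \<Rightarrow> real^'k) \<in> borel_measurable M \<longleftrightarrow> (\<forall>i. (\<lambda>x. f x $ i) \<in> borel_measurable M)"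
  by (subst borel_measurable_euclidean_space) (auto simp: Basis_vec_def inner_axis)

lemma borel_measurable_entry: "(\<lambda>A::real^'k^'m. A $ i $ j) \<in> borel_measurable borel"
  by (intro borel_measurable_continuous_onI continuous_intros)

lemma continuous_on_mat_power_nth: "continuous_on UNIV (\<lambda>A::real^'k^'k. mat_power A n $ i $ j)"
proof (induction n arbitrary: i j)
  case (Suc n)
  show ?case unfolding mat_power_Suc matrix_matrix_mult_def vec_lambda_beta
    by (intro continuous_intros Suc)
qed simp

lemma sets_irreducible: "{A::real^'k^'k. irreducible_matrix A} \<in> sets borel"
proof -
  have "{A::real^'k^'k. irreducible_matrix A}
      = (\<Inter>i. \<Inter>j. {A. 0 \<le> A $ i $ j}) \<inter> (\<Inter>i. \<Inter>j. \<Union>N\<in>{0<..}. {A. 0 < mat_power A N $ i $ j})"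
    by (simp add: irreducible_matrix_def nonneg_matrix_def set_eq_iff Bex_def)
  moreover have "{A::real^'k^'k. 0 \<le> A $ i $ j} \<in> sets borel" for i j
    by (intro borel_closed closed_Collect_le continuous_intros)
  moreover have "{A::real^'k^'k. 0 < mat_power A N $ i $ j} \<in> sets borel" for i j N
    by (intro borel_open open_Collect_less continuous_on_mat_power_nth continuous_intros)
  ultimately show ?thesis by (auto intro!: sets.countable_INT' sets.countable_UN' sets.Int)
qed

text \<open>Without noise the contents are the image of the accumulated proportions under the matrix. The resulting
  recursion, started from the vector of ones, has the Perron vector as the limit of its averages.
  As it depends on the matrix through finitely many arithmetic operations at each time, the
  Perron vector is a measurable function of the matrix.\<close>

primrec noiseless_count :: "real^'k^'k \<Rightarrow> nat \<Rightarrow> real^'k" where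
  "noiseless_count A 0 = 1"
| "noiseless_count A (Suc n) = noiseless_count A n
     + (1 / (\<Sum>i\<in>UNIV. (noiseless_count A n v* A) $ i)) *\<^sub>R (noiseless_count A n v* A)"

lemma noiseless_count_ge_1: "nonneg_matrix A \<Longrightarrow> 1 \<le> noiseless_count A n $ i"
proof (induction n arbitrary: i)
  case (Suc n)
  have "0 \<le> (noiseless_count A n v* A) $ i" for i
    using Suc order_trans[OF zero_le_one] by (blast intro: vec_mult_nonneg)
  then show ?case using Suc.IH[OF Suc.prems, of i] by (simp add: sum_nonneg add_increasing2)
qed simp

lemma noiseless_count_limit:
  fixes A :: "real^'k^'k"
  assumes irr: "irreducible_matrix A"
  shows "(\<lambda>n. (1 / real n) *\<^sub>R noiseless_count A n) \<longlonglongrightarrow> perron_vector A"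
proof -
  have nn: "nonneg_matrix A" using irr by (simp add: irreducible_matrix_def)
  let ?C = "\<lambda>n. noiseless_count A n v* A"
  let ?y = "\<lambda>n. \<Sum>k<n. (1 / (\<Sum>i\<in>UNIV. ?C k $ i)) *\<^sub>R ?C k"
  have count: "noiseless_count A n = 1 + ?y n" for n
    by (induction n) (auto simp: add_ac)
  have C_nn: "0 \<le> ?C n $ i" for n i
    using nn noiseless_count_ge_1[OF nn] order_trans[OF zero_le_one] by (blast intro: vec_mult_nonneg)
  have "0 < (\<Sum>i\<in>UNIV. ?C n $ i)" for n
  proof (rule perron_frobenius[OF irr])
    fix v assume l: "0 < dominant_eigenvalue A"
      and v: "\<And>i. 0 < v $ i" "A *v v = dominant_eigenvalue A *\<^sub>R v"
    have "0 < noiseless_count A n \<bullet> v"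
      unfolding inner_vec_def using v(1) noiseless_count_ge_1[OF nn, of n]
      by (intro sum_pos) (auto intro!: mult_pos_pos intro: less_le_trans[OF zero_less_one])
    then have "0 < ?C n \<bullet> v" using l v(2) by (simp add: dot_lmul_matrix)
    then have "?C n \<noteq> 0" by auto
    then obtain i where "?C n $ i \<noteq> 0" by (auto simp: vec_eq_iff)
    then show ?thesis using C_nn by (intro sum_pos2[of _ i]) (auto simp: less_le)
  qed
  moreover have "(\<lambda>n. (1 / real n) *\<^sub>R (?C n - ?y n v* A)) \<longlonglongrightarrow> 0"
  proof -
    have "?C n - ?y n v* A = 1 v* A" for n
      by (subst count) (simp add: vector_matrix_left_distrib)
    then show ?thesis
      using tendsto_scaleR[OF lim_1_over_n tendsto_const[of "1 v* A"]] by simp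
  qed
  ultimately have "(\<lambda>n. (1 / real n) *\<^sub>R ?y n) \<longlonglongrightarrow> perron_vector A"
    by (intro mean_field_urn_limit[OF irr C_nn])
  then have "(\<lambda>n. (1 / real n) *\<^sub>R (1::real^'k) + (1 / real n) *\<^sub>R ?y n) \<longlonglongrightarrow> 0 *\<^sub>R 1 + perron_vector A"
    by (intro tendsto_add tendsto_scaleR lim_1_over_n tendsto_const)
  then show ?thesis by (subst count) (simp add: scaleR_add_right)
qed

lemma measurable_noiseless_count: "(\<lambda>A::real^'k^'k. noiseless_count A n $ i) \<in> borel_measurable borel"
proof (induction n arbitrary: i)
  case (Suc n)
  show ?case
    unfolding noiseless_count.simps vector_add_component vector_scaleR_component vec_mult_nth
    by (intro borel_measurable_add borel_measurable_scaleR borel_measurable_divide borel_measurable_sum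
        borel_measurable_times borel_measurable_const Suc borel_measurable_entry)
qed simp

lemma perron_vector_measurable: "perron_vector \<in> borel_measurable (borel :: (real^'k^'k) measure)"
proof (rule borel_measurable_LIMSEQ_metric)
  let ?f = "\<lambda>n (A::real^'k^'k). (indicator {A. irreducible_matrix A} A / real n) *\<^sub>R noiseless_count A n"
  have "(\<lambda>A::real^'k^'k. noiseless_count A n) \<in> borel_measurable borel" for n
    using measurable_noiseless_count by (subst borel_measurable_vec_iff) blast
  then show "?f n \<in> borel_measurable borel" for n
    using sets_irreducible
    by (intro borel_measurable_scaleR borel_measurable_divide borel_measurable_indicator) auto
  show "(\<lambda>n. ?f n A) \<longlonglongrightarrow> perron_vector A" for A
    using noiseless_count_limit[of A]
    by (cases "irreducible_matrix A") (auto simp: perron_vector_def)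
qed

lemma dominant_eigenvalue_eq_sum:
  "dominant_eigenvalue A = (\<Sum>j\<in>UNIV. (perron_vector A v* A) $ j)"
proof (cases "irreducible_matrix A")
  case True
  then show ?thesis
    by (rule perron_frobenius) (simp add: sum_distrib_left[symmetric])
next
  case False
  then show ?thesis by (simp add: dominant_eigenvalue_def perron_vector_def)
qed

lemma dominant_eigenvalue_measurable:
  "dominant_eigenvalue \<in> borel_measurable (borel :: (real^'k^'k) measure)"
proof -
  have "(\<lambda>A::real^'k^'k. perron_vector A $ i) \<in> borel_measurable borel" for i
    using perron_vector_measurable by (subst (asm) borel_measurable_vec_iff) blast
  then show ?thesis
    unfolding dominant_eigenvalue_eq_sum[abs_def] vec_mult_nth
    by (intro borel_measurable_sum borel_measurable_times borel_measurable_entry)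
qed

section \<open>Convergence in mean\<close>

text \<open>A version of Vitali's theorem: if the parts of \<open>X n\<close> above a suitable level have small mean for all large \<open>n\<close>,
  almost sure convergence improves to convergence in mean. Fatou's lemma passes the
  bound to the limit, and below the level dominated convergence applies.\<close>

lemma (in prob_space) L1_limit_of_small_excess:
  fixes X :: "nat \<Rightarrow> 'a \<Rightarrow> real"
  assumes X: "\<And>n. integrable M (X n)" "\<And>n. AE \<omega> in M. 0 \<le> X n \<omega>" and Y: "Y \<in> borel_measurable M"
    and lim: "AE \<omega> in M. (\<lambda>n. X n \<omega>) \<longlonglongrightarrow> Y \<omega>"
    and excess: "\<And>\<epsilon>. 0 < \<epsilon> \<Longrightarrow> \<exists>L\<ge>0. \<forall>\<^sub>F n in sequentially. (\<integral>\<omega>. max (X n \<omega> - L) 0 \<partial>M) \<le> \<epsilon>"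
  shows "integrable M Y" "(\<lambda>n. \<integral>\<omega>. \<bar>X n \<omega> - Y \<omega>\<bar> \<partial>M) \<longlonglongrightarrow> 0"
proof -
  note [measurable] = Y borel_measurable_integrable[OF X(1)]
  have "AE \<omega> in M. \<forall>n. 0 \<le> X n \<omega>" using X(2) by (simp add: AE_all_countable)
  with lim have Y_nn: "AE \<omega> in M. 0 \<le> Y \<omega>"
    by eventually_elim (auto intro: LIMSEQ_le_const)
  have X_excess: "integrable M (\<lambda>\<omega>. max (X n \<omega> - L) 0)" for n L
    using X(1) by (intro integrable_max) auto
  have excess_limit: "integrable M (\<lambda>\<omega>. max (Y \<omega> - L) 0) \<and> (\<integral>\<omega>. max (Y \<omega> - L) 0 \<partial>M) \<le> \<epsilon>"
    if ev: "\<forall>\<^sub>F n in sequentially. (\<integral>\<omega>. max (X n \<omega> - L) 0 \<partial>M) \<le> \<epsilon>" and "0 < \<epsilon>" for L \<epsilon>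
  proof -
    have "(\<integral>\<^sup>+\<omega>. ennreal (max (Y \<omega> - L) 0) \<partial>M)
        \<le> (\<integral>\<^sup>+\<omega>. liminf (\<lambda>n. ennreal (max (X n \<omega> - L) 0)) \<partial>M)"
    proof (rule nn_integral_mono_AE, use lim in eventually_elim)
      case (elim \<omega>)
      have "(\<lambda>n. ennreal (max (X n \<omega> - L) 0)) \<longlonglongrightarrow> ennreal (max (Y \<omega> - L) 0)"
        by (intro tendsto_ennrealI tendsto_max tendsto_diff elim tendsto_const)
      then show ?case by (simp add: lim_imp_Liminf)
    qed
    also have "\<dots> \<le> liminf (\<lambda>n. \<integral>\<^sup>+\<omega>. ennreal (max (X n \<omega> - L) 0) \<partial>M)"
      by (rule nn_integral_liminf) measurable
    also have "\<dots> \<le> liminf (\<lambda>n. ennreal \<epsilon>)"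
    proof (rule Liminf_mono, use ev in eventually_elim)
      case (elim n)
      then show ?case by (subst nn_integral_eq_integral[OF X_excess]) (auto intro: ennreal_leI)
    qed
    also have "\<dots> = ennreal \<epsilon>" by (simp add: Liminf_const)
    finally have le: "(\<integral>\<^sup>+\<omega>. ennreal (max (Y \<omega> - L) 0) \<partial>M) \<le> ennreal \<epsilon>" .
    then have int: "integrable M (\<lambda>\<omega>. max (Y \<omega> - L) 0)"
      by (intro integrableI_nonneg) (auto intro: le_less_trans)
    moreover have "ennreal (\<integral>\<omega>. max (Y \<omega> - L) 0 \<partial>M) \<le> ennreal \<epsilon>"
      using le by (subst (asm) nn_integral_eq_integral[OF int]) auto
    ultimately show ?thesis using \<open>0 < \<epsilon>\<close> by (auto simp: ennreal_le_iff)
  qed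
  show Y_int: "integrable M Y"
  proof -
    obtain L where L: "L \<ge> 0" "\<forall>\<^sub>F n in sequentially. (\<integral>\<omega>. max (X n \<omega> - L) 0 \<partial>M) \<le> 1"
      using excess[of 1] by auto
    have "integrable M (\<lambda>\<omega>. L + max (Y \<omega> - L) 0)"
      using excess_limit[OF L(2)] by simp
    then show ?thesis
      by (rule Bochner_Integration.integrable_bound) (use Y_nn in \<open>auto elim!: eventually_mono\<close>)
  qed
  show "(\<lambda>n. \<integral>\<omega>. \<bar>X n \<omega> - Y \<omega>\<bar> \<partial>M) \<longlonglongrightarrow> 0"
  proof (rule LIMSEQ_I)
    fix \<epsilon> :: real assume "0 < \<epsilon>"
    then obtain L where L: "L \<ge> 0" "\<forall>\<^sub>F n in sequentially. (\<integral>\<omega>. max (X n \<omega> - L) 0 \<partial>M) \<le> \<epsilon> / 4"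
      using excess[of "\<epsilon> / 4"] by auto
    note YL = excess_limit[OF L(2)]
    have int_diff: "integrable M (\<lambda>\<omega>. \<bar>min (X n \<omega>) L - min (Y \<omega>) L\<bar>)" for n
      using X(1) Y_int by (intro integrable_abs Bochner_Integration.integrable_diff integrable_min) auto
    have "(\<lambda>n. \<integral>\<omega>. \<bar>min (X n \<omega>) L - min (Y \<omega>) L\<bar> \<partial>M) \<longlonglongrightarrow> (\<integral>\<omega>. 0 \<partial>M)"
    proof (rule integral_dominated_convergence[where w = "\<lambda>_. L"])
      show "AE \<omega> in M. (\<lambda>n. \<bar>min (X n \<omega>) L - min (Y \<omega>) L\<bar>) \<longlonglongrightarrow> 0"
        using lim
      proof eventually_elim
        case (elim \<omega>)
        have "(\<lambda>n. \<bar>min (X n \<omega>) L - min (Y \<omega>) L\<bar>) \<longlonglongrightarrow> \<bar>min (Y \<omega>) L - min (Y \<omega>) L\<bar>"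
          by (intro tendsto_intros tendsto_min elim)
        then show ?case by simp
      qed
      show "AE \<omega> in M. norm \<bar>min (X n \<omega>) L - min (Y \<omega>) L\<bar> \<le> L" for n
        using X(2)[of n] Y_nn by eventually_elim (use L(1) in auto)
    qed auto
    then have "\<forall>\<^sub>F n in sequentially. (\<integral>\<omega>. \<bar>min (X n \<omega>) L - min (Y \<omega>) L\<bar> \<partial>M) < \<epsilon> / 4"
      using \<open>0 < \<epsilon>\<close> by (intro order_tendstoD) auto
    with L(2) have "\<forall>\<^sub>F n in sequentially. (\<integral>\<omega>. \<bar>X n \<omega> - Y \<omega>\<bar> \<partial>M) < \<epsilon>"
    proof eventually_elim
      case (elim n)
      have "(\<integral>\<omega>. \<bar>X n \<omega> - Y \<omega>\<bar> \<partial>M)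
          \<le> (\<integral>\<omega>. \<bar>min (X n \<omega>) L - min (Y \<omega>) L\<bar> + max (X n \<omega> - L) 0 + max (Y \<omega> - L) 0 \<partial>M)"
        using X(1) Y_int X_excess YL \<open>0 < \<epsilon>\<close> int_diff
        by (intro integral_mono Bochner_Integration.integrable_add) auto
      also have "\<dots> = (\<integral>\<omega>. \<bar>min (X n \<omega>) L - min (Y \<omega>) L\<bar> \<partial>M)
          + (\<integral>\<omega>. max (X n \<omega> - L) 0 \<partial>M) + (\<integral>\<omega>. max (Y \<omega> - L) 0 \<partial>M)"
        using X_excess YL \<open>0 < \<epsilon>\<close> int_diff by (simp add: Bochner_Integration.integral_add)
      also have "\<dots> < \<epsilon>" using elim YL \<open>0 < \<epsilon>\<close> by auto
      finally show ?case .
    qed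
    then show "\<exists>no. \<forall>n\<ge>no. norm ((\<integral>\<omega>. \<bar>X n \<omega> - Y \<omega>\<bar> \<partial>M) - 0) < \<epsilon>"
      unfolding eventually_sequentially by simp
  qed
qed

lemma tendsto_L1_vec:
  fixes X :: "nat \<Rightarrow> 'a \<Rightarrow> real^'k"
  assumes "\<And>i. tendsto_L1 M (\<lambda>n \<omega>. X n \<omega> $ i) (\<lambda>\<omega>. Y \<omega> $ i)"
  shows "tendsto_L1 M X Y"
proof -
  have int: "integrable M f" if comp: "\<And>i. integrable M (\<lambda>\<omega>. f \<omega> $ i)" for f :: "'a \<Rightarrow> real^'k"
  proof (rule Bochner_Integration.integrable_bound)
    show "integrable M (\<lambda>\<omega>. \<Sum>i\<in>UNIV. \<bar>f \<omega> $ i\<bar>)" using comp by auto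
    show "f \<in> borel_measurable M" using comp by (auto simp: borel_measurable_vec_iff)
    show "AE \<omega> in M. norm (f \<omega>) \<le> norm (\<Sum>i\<in>UNIV. \<bar>f \<omega> $ i\<bar>)"
      by (intro AE_I2) (auto intro: order_trans[OF norm_le_l1_cart])
  qed
  have X: "integrable M (X n)" and Y: "integrable M Y" for n
    using assms by (auto simp: tendsto_L1_def intro: int)
  have diff: "integrable M (\<lambda>\<omega>. \<bar>X n \<omega> $ i - Y \<omega> $ i\<bar>)" for n i
    using assms by (auto simp: tendsto_L1_def)
  have "(\<lambda>n. \<integral>\<omega>. norm (X n \<omega> - Y \<omega>) \<partial>M) \<longlonglongrightarrow> 0"
  proof (rule tendsto_sandwich[where f = "\<lambda>_. 0"])
    have "(\<lambda>n. \<Sum>i\<in>UNIV. \<integral>\<omega>. \<bar>X n \<omega> $ i - Y \<omega> $ i\<bar> \<partial>M) \<longlonglongrightarrow> (\<Sum>i\<in>(UNIV :: 'k set). 0)"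
      using assms by (intro tendsto_sum) (auto simp: tendsto_L1_def)
    then show "(\<lambda>n. \<Sum>i\<in>UNIV. \<integral>\<omega>. \<bar>X n \<omega> $ i - Y \<omega> $ i\<bar> \<partial>M) \<longlonglongrightarrow> 0" by simp
    have "(\<integral>\<omega>. norm (X n \<omega> - Y \<omega>) \<partial>M) \<le> (\<integral>\<omega>. (\<Sum>i\<in>UNIV. \<bar>X n \<omega> $ i - Y \<omega> $ i\<bar>) \<partial>M)" for n
    proof (rule integral_mono)
      show "norm (X n \<omega> - Y \<omega>) \<le> (\<Sum>i\<in>UNIV. \<bar>X n \<omega> $ i - Y \<omega> $ i\<bar>)" for \<omega>
        using norm_le_l1_cart[of "X n \<omega> - Y \<omega>"] by simp
    qed (use X Y diff in auto)
    then show "\<forall>\<^sub>F n in sequentially. (\<integral>\<omega>. norm (X n \<omega> - Y \<omega>) \<partial>M)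
        \<le> (\<Sum>i\<in>UNIV. \<integral>\<omega>. \<bar>X n \<omega> $ i - Y \<omega> $ i\<bar> \<partial>M)"
      using diff by (simp add: Bochner_Integration.integral_sum)
  qed auto
  then show ?thesis using X Y by (simp add: tendsto_L1_def)
qed

lemma (in prob_space) tendsto_L1_unit_interval:
  fixes X :: "nat \<Rightarrow> 'a \<Rightarrow> real"
  assumes X: "\<And>n. X n \<in> borel_measurable M" "\<And>n. AE \<omega> in M. 0 \<le> X n \<omega> \<and> X n \<omega> \<le> 1"
    and Y: "Y \<in> borel_measurable M" and lim: "AE \<omega> in M. (\<lambda>n. X n \<omega>) \<longlonglongrightarrow> Y \<omega>"
  shows "tendsto_L1 M X Y"
proof -
  have X_int: "integrable M (X n)" for n
    by (rule integrable_const_bound[where B = 1]) (use X[of n] in \<open>auto elim: eventually_mono\<close>)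
  have nn: "AE \<omega> in M. 0 \<le> X n \<omega>" for n using X(2)[of n] by (auto elim: eventually_mono)
  have excess: "\<exists>L\<ge>0. \<forall>\<^sub>F n in sequentially. (\<integral>\<omega>. max (X n \<omega> - L) 0 \<partial>M) \<le> \<epsilon>" if "0 < \<epsilon>" for \<epsilon>
  proof (intro exI[of _ 1] conjI always_eventually allI)
    fix n
    have "(\<integral>\<omega>. max (X n \<omega> - 1) 0 \<partial>M) = (\<integral>\<omega>. 0 \<partial>M)"
    proof (rule integral_cong_AE)
      show "AE \<omega> in M. max (X n \<omega> - 1) 0 = 0" using X(2)[of n] by eventually_elim auto
    qed (use X in measurable)
    then show "(\<integral>\<omega>. max (X n \<omega> - 1) 0 \<partial>M) \<le> \<epsilon>" using that by simp
  qed simp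
  show ?thesis
    using L1_limit_of_small_excess[OF X_int nn Y lim excess] X_int by (simp add: tendsto_L1_def)
qed

section \<open>Martingale differences\<close>

text \<open>The averages of \<open>\<bar>x k\<bar>\<close> satisfy a damped recursion with damping \<open>1 / (n + 1)\<close>.\<close>

lemma cesaro_mean_null:
  fixes x :: "nat \<Rightarrow> real"
  assumes "x \<longlonglongrightarrow> 0"
  shows "(\<lambda>n. (1 / real n) * (\<Sum>k<n. x k)) \<longlonglongrightarrow> 0"
proof -
  have "(\<lambda>n. (1 / real n) * (\<Sum>k<n. \<bar>x k\<bar>)) \<longlonglongrightarrow> 0"
  proof (rule damped_recursion_tendsto_0[where b = "\<lambda>n. inverse (real (Suc n))" and e = "\<lambda>n. \<bar>x n\<bar>"])
    show "\<forall>\<^sub>F n in sequentially. (1 / real (Suc n)) * (\<Sum>k<Suc n. \<bar>x k\<bar>)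
      \<le> (1 - inverse (real (Suc n))) * ((1 / real n) * (\<Sum>k<n. \<bar>x k\<bar>)) + inverse (real (Suc n)) * \<bar>x n\<bar>"
      using eventually_gt_at_top[of 0]
    proof eventually_elim
      case (elim n)
      have "(1 - inverse (real (Suc n))) * (1 / real n) = inverse (real (Suc n))"
        using elim by (simp add: divide_simps)
      then have "(1 - inverse (real (Suc n))) * ((1 / real n) * (\<Sum>k<n. \<bar>x k\<bar>))
          = inverse (real (Suc n)) * (\<Sum>k<n. \<bar>x k\<bar>)"
        by (simp only: mult.assoc[symmetric])
      then show ?case by (simp add: inverse_eq_divide add_divide_distrib)
    qed
    show "\<not> summable (\<lambda>n. inverse (real (Suc n)))"
      using not_summable_harmonic[where 'a = real] summable_Suc_iff[of "\<lambda>n. inverse (real n)"] by blast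
    show "(\<lambda>n. \<bar>x n\<bar>) \<longlonglongrightarrow> 0" using assms by (rule tendsto_rabs_zero)
  qed (auto simp: sum_nonneg inverse_le_1_iff)
  then show ?thesis
  proof (rule Lim_null_comparison[rotated])
    show "\<forall>\<^sub>F n in sequentially. norm ((1 / real n) * (\<Sum>k<n. x k)) \<le> (1 / real n) * (\<Sum>k<n. \<bar>x k\<bar>)"
      by (intro always_eventually allI) (auto simp: abs_mult intro!: divide_right_mono sum_abs)
  qed
qed

text \<open>Kronecker's lemma, by summation by parts.\<close>

lemma kronecker_mean_null:
  fixes x :: "nat \<Rightarrow> real"
  assumes "summable (\<lambda>k. x k / real (Suc k))"
  shows "(\<lambda>n. (1 / real n) * (\<Sum>k<n. x k)) \<longlonglongrightarrow> 0"
proof -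
  define b where "b = (\<lambda>n. \<Sum>k<n. x k / real (Suc k))"
  define s where "s = (\<Sum>k. x k / real (Suc k))"
  have b: "b \<longlonglongrightarrow> s"
    using assms unfolding b_def s_def by (rule summable_LIMSEQ)
  have parts: "(\<Sum>k<n. x k) = real n * b n - (\<Sum>k<n. b k)" for n
  proof (induction n)
    case (Suc n)
    have "real (Suc n) * b (Suc n) = real n * b n + b n + x n"
      by (simp add: b_def field_simps)
    then show ?case using Suc by simp
  qed simp
  have "(\<lambda>n. b n - s) \<longlonglongrightarrow> 0" using b by (simp add: LIM_zero)
  then have "(\<lambda>n. (b n - s) - (1 / real n) * (\<Sum>k<n. b k - s)) \<longlonglongrightarrow> 0 - 0"
    using cesaro_mean_null by (intro tendsto_diff) auto
  moreover have "\<forall>\<^sub>F n in sequentially. (b n - s) - (1 / real n) * (\<Sum>k<n. b k - s) = (1 / real n) * (\<Sum>k<n. x k)"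
    using eventually_gt_at_top[of 0] by eventually_elim (simp add: parts sum_subtractf field_simps)
  ultimately show ?thesis using Lim_transform_eventually by force
qed

lemma (in prob_space) AE_summable_of_summable_integral:
  fixes X :: "nat \<Rightarrow> 'a \<Rightarrow> real"
  assumes X: "\<And>n. integrable M (X n)" and sum: "summable (\<lambda>n. \<integral>\<omega>. \<bar>X n \<omega>\<bar> \<partial>M)"
  shows "AE \<omega> in M. summable (\<lambda>n. X n \<omega>)"
proof -
  note [measurable] = borel_measurable_integrable[OF X]
  have "(\<integral>\<^sup>+\<omega>. (\<Sum>n. ennreal \<bar>X n \<omega>\<bar>) \<partial>M) = (\<Sum>n. \<integral>\<^sup>+\<omega>. ennreal \<bar>X n \<omega>\<bar> \<partial>M)"
    by (rule nn_integral_suminf) measurable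
  also have "\<dots> = (\<Sum>n. ennreal (\<integral>\<omega>. \<bar>X n \<omega>\<bar> \<partial>M))"
    by (subst nn_integral_eq_integral) (auto intro: integrable_abs X)
  also have "\<dots> \<noteq> \<infinity>" using sum by (simp add: suminf_ennreal2)
  finally have "AE \<omega> in M. (\<Sum>n. ennreal \<bar>X n \<omega>\<bar>) \<noteq> \<infinity>"
    by (intro nn_integral_PInf_AE) auto
  then show ?thesis
  proof eventually_elim
    case (elim \<omega>)
    have "summable (\<lambda>n. \<bar>X n \<omega>\<bar>)"
      by (rule summable_suminf_not_top) (use elim in simp_all)
    then show ?case by (rule summable_rabs_cancel)
  qed
qed

locale filtered_prob_space = prob_space M for M :: "'a measure" +
  fixes F :: "nat \<Rightarrow> 'a measure"
  assumes subalg_F: "\<And>n. subalgebra M (F n)"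
    and F_mono: "\<And>m n. m \<le> n \<Longrightarrow> sets (F m) \<subseteq> sets (F n)"
begin

lemma sigma_finite_F: "sigma_finite_subalgebra M (F n)"
  by (intro finite_measure_subalgebra_is_sigma_finite finite_measure_subalgebra.intro
      finite_measure_axioms finite_measure_subalgebra_axioms.intro subalg_F)

lemma space_F: "space (F n) = space M"
  using subalg_F by (simp add: subalgebra_def)

lemma measurable_F_mono: "m \<le> n \<Longrightarrow> f \<in> borel_measurable (F m) \<Longrightarrow> f \<in> borel_measurable (F n)"
  using F_mono[of m n] by (auto simp: measurable_def space_F)

lemma measurable_F_M: "f \<in> borel_measurable (F n) \<Longrightarrow> f \<in> borel_measurable M"
  by (rule measurable_from_subalg[OF subalg_F])

text \<open>Differences with vanishing conditional mean are orthogonal, and multiplying them by predictable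
  factors of modulus at most one preserves this and does not increase their second moments.\<close>

lemma square_sum_transform_le:
  fixes D :: "nat \<Rightarrow> 'a \<Rightarrow> real"
  assumes D: "\<And>n. D n \<in> borel_measurable (F (Suc n))" "\<And>n. integrable M (\<lambda>\<omega>. (D n \<omega>)\<^sup>2)"
      "\<And>n. AE \<omega> in M. real_cond_exp M (F n) (D n) \<omega> = 0"
    and G: "\<And>n. G n \<in> borel_measurable (F n)" "\<And>n \<omega>. \<bar>G n \<omega>\<bar> \<le> 1"
  defines "W \<equiv> (\<lambda>n \<omega>. \<Sum>k<n. G k \<omega> * D k \<omega>)"
  shows "W n \<in> borel_measurable (F n)" "integrable M (\<lambda>\<omega>. (W n \<omega>)\<^sup>2)"
    "(\<integral>\<omega>. (W n \<omega>)\<^sup>2 \<partial>M) \<le> (\<Sum>k<n. \<integral>\<omega>. (D k \<omega>)\<^sup>2 \<partial>M)"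
proof -
  show W_meas: "W n \<in> borel_measurable (F n)" for n
    unfolding W_def
  proof (intro borel_measurable_sum borel_measurable_times)
    fix k assume "k \<in> {..<n}"
    then show "G k \<in> borel_measurable (F n)" "D k \<in> borel_measurable (F n)"
      using measurable_F_mono[OF _ G(1)[of k]] measurable_F_mono[OF _ D(1)[of k]] by auto
  qed
  note [measurable] = measurable_F_M[OF W_meas] measurable_F_M[OF G(1)] measurable_F_M[OF D(1)]
  have "integrable M (\<lambda>\<omega>. (W n \<omega>)\<^sup>2) \<and> (\<integral>\<omega>. (W n \<omega>)\<^sup>2 \<partial>M) \<le> (\<Sum>k<n. \<integral>\<omega>. (D k \<omega>)\<^sup>2 \<partial>M)"
  proof (induction n)
    case (Suc n)
    interpret sigma_finite_subalgebra M "F n" by (rule sigma_finite_F)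
    have G_sq: "(G n \<omega> * D n \<omega>)\<^sup>2 \<le> (D n \<omega>)\<^sup>2" for \<omega>
      unfolding power_mult_distrib using abs_square_le_1[THEN iffD2, OF G(2)[of n \<omega>]]
      by (intro mult_left_le_one_le) auto
    have GD: "integrable M (\<lambda>\<omega>. (G n \<omega> * D n \<omega>)\<^sup>2)"
      by (rule Bochner_Integration.integrable_bound[OF D(2)[of n]]) (use G_sq in auto)
    have cross_le: "\<bar>x * y\<bar> \<le> x\<^sup>2 + y\<^sup>2" for x y :: real
    proof -
      have "0 \<le> (\<bar>x\<bar> - \<bar>y\<bar>)\<^sup>2 + \<bar>x\<bar> * \<bar>y\<bar>" by simp
      also have "\<dots> = x\<^sup>2 + y\<^sup>2 - \<bar>x * y\<bar>" by (simp add: power2_diff abs_mult)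
      finally show ?thesis by simp
    qed
    have cross: "integrable M (\<lambda>\<omega>. (W n \<omega> * G n \<omega>) * D n \<omega>)"
    proof (rule Bochner_Integration.integrable_bound)
      show "integrable M (\<lambda>\<omega>. (W n \<omega>)\<^sup>2 + (G n \<omega> * D n \<omega>)\<^sup>2)" using Suc GD by simp
      show "AE \<omega> in M. norm ((W n \<omega> * G n \<omega>) * D n \<omega>) \<le> norm ((W n \<omega>)\<^sup>2 + (G n \<omega> * D n \<omega>)\<^sup>2)"
        using cross_le by (auto simp: mult.assoc)
    qed measurable
    have "(\<integral>\<omega>. (W n \<omega> * G n \<omega>) * D n \<omega> \<partial>M) = (\<integral>\<omega>. (W n \<omega> * G n \<omega>) * real_cond_exp M (F n) (D n) \<omega> \<partial>M)"
      by (rule real_cond_exp_intg(2)[symmetric, OF cross])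
         (use W_meas G in \<open>auto intro: borel_measurable_times\<close>)
    also have "\<dots> = (\<integral>\<omega>. 0 \<partial>M)"
      using D(3)[of n] by (intro integral_cong_AE) (auto intro: measurable_F_M borel_measurable_cond_exp)
    finally have cross0: "(\<integral>\<omega>. (W n \<omega> * G n \<omega>) * D n \<omega> \<partial>M) = 0" by simp
    have sq: "(W (Suc n) \<omega>)\<^sup>2 = (W n \<omega>)\<^sup>2 + 2 * ((W n \<omega> * G n \<omega>) * D n \<omega>) + (G n \<omega> * D n \<omega>)\<^sup>2" for \<omega>
      by (simp add: W_def power2_sum mult_ac)
    have "(\<integral>\<omega>. (W (Suc n) \<omega>)\<^sup>2 \<partial>M) = (\<integral>\<omega>. (W n \<omega>)\<^sup>2 \<partial>M) + (\<integral>\<omega>. (G n \<omega> * D n \<omega>)\<^sup>2 \<partial>M)"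
      unfolding sq using Suc cross GD cross0 by simp
    moreover have "(\<integral>\<omega>. (G n \<omega> * D n \<omega>)\<^sup>2 \<partial>M) \<le> (\<integral>\<omega>. (D n \<omega>)\<^sup>2 \<partial>M)"
      using GD D(2) G_sq by (intro integral_mono)
    moreover have "integrable M (\<lambda>\<omega>. (W (Suc n) \<omega>)\<^sup>2)"
      unfolding sq using Suc cross GD by simp
    ultimately show ?case using Suc by simp
  qed (simp add: W_def)
  then show "integrable M (\<lambda>\<omega>. (W n \<omega>)\<^sup>2)"
    "(\<integral>\<omega>. (W n \<omega>)\<^sup>2 \<partial>M) \<le> (\<Sum>k<n. \<integral>\<omega>. (D k \<omega>)\<^sup>2 \<partial>M)" by auto
qed

text \<open>Kolmogorov's maximal inequality. The partial sums stopped when they first reach the level \<open>\<epsilon>\<close> are a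
  transform of the differences by predictable indicators, and they end at or above the level in modulus
  if the partial sums ever were there.\<close>

lemma kolmogorov_maximal_inequality:
  fixes D :: "nat \<Rightarrow> 'a \<Rightarrow> real"
  assumes D: "\<And>n. D n \<in> borel_measurable (F (Suc n))" "\<And>n. integrable M (\<lambda>\<omega>. (D n \<omega>)\<^sup>2)"
      "\<And>n. AE \<omega> in M. real_cond_exp M (F n) (D n) \<omega> = 0"
    and \<epsilon>: "0 < \<epsilon>"
  shows "\<epsilon>\<^sup>2 * prob {\<omega>\<in>space M. \<exists>j\<le>n. \<epsilon> \<le> \<bar>\<Sum>k<j. D k \<omega>\<bar>} \<le> (\<Sum>k<n. \<integral>\<omega>. (D k \<omega>)\<^sup>2 \<partial>M)"
proof -
  define P where "P = (\<lambda>j \<omega>. \<Sum>k<j. D k \<omega>)"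
  define G where "G = (\<lambda>k \<omega>. of_bool (\<forall>j\<le>k. \<bar>P j \<omega>\<bar> < \<epsilon>) :: real)"
  have P_meas: "P j \<in> borel_measurable (F k)" if "j \<le> k" for j k
    unfolding P_def
  proof (intro borel_measurable_sum)
    fix i assume "i \<in> {..<j}"
    then show "D i \<in> borel_measurable (F k)" using measurable_F_mono[OF _ D(1)[of i]] that by auto
  qed
  have G_meas: "G k \<in> borel_measurable (F k)" for k
  proof -
    have "G k = (\<lambda>\<omega>. \<Prod>j\<le>k. of_bool (\<bar>P j \<omega>\<bar> < \<epsilon>))"
      by (auto simp: G_def fun_eq_iff of_bool_def)
    moreover have "(\<lambda>\<omega>. of_bool (\<bar>P j \<omega>\<bar> < \<epsilon>) :: real) \<in> borel_measurable (F k)" if "j \<le> k" for j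
    proof -
      note [measurable] = P_meas[OF that]
      show ?thesis by measurable
    qed
    ultimately show ?thesis by (auto intro!: borel_measurable_prod)
  qed
  have G_le: "\<bar>G k \<omega>\<bar> \<le> 1" for k \<omega> by (simp add: G_def)
  define W where "W = (\<lambda>n \<omega>. \<Sum>k<n. G k \<omega> * D k \<omega>)"
  have W: "W n \<in> borel_measurable (F n)" "integrable M (\<lambda>\<omega>. (W n \<omega>)\<^sup>2)"
      "(\<integral>\<omega>. (W n \<omega>)\<^sup>2 \<partial>M) \<le> (\<Sum>k<n. \<integral>\<omega>. (D k \<omega>)\<^sup>2 \<partial>M)"
    unfolding W_def by (rule square_sum_transform_le[OF D G_meas G_le])+
  have W_ge: "\<epsilon> \<le> \<bar>W n \<omega>\<bar>" if ex: "\<exists>j\<le>n. \<epsilon> \<le> \<bar>P j \<omega>\<bar>" for \<omega>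
  proof -
    define j where "j = (LEAST j. \<epsilon> \<le> \<bar>P j \<omega>\<bar>)"
    have j: "\<epsilon> \<le> \<bar>P j \<omega>\<bar>" unfolding j_def by (rule LeastI_ex) (use ex in auto)
    have below: "\<bar>P i \<omega>\<bar> < \<epsilon>" if "i < j" for i
      using not_less_Least[of i] that unfolding j_def by fastforce
    have "j \<le> n" unfolding j_def using ex by (auto intro: Least_le order_trans)
    have "W n \<omega> = (\<Sum>k<n. if k < j then D k \<omega> else 0)"
      unfolding W_def
    proof (intro sum.cong refl)
      fix k
      show "G k \<omega> * D k \<omega> = (if k < j then D k \<omega> else 0)"
      proof (cases "k < j")
        case True
        then have "\<forall>i\<le>k. \<bar>P i \<omega>\<bar> < \<epsilon>" using below by auto
        then show ?thesis using True by (simp add: G_def)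
      next
        case False
        then have "\<not> (\<forall>i\<le>k. \<bar>P i \<omega>\<bar> < \<epsilon>)" using j by (meson not_le)
        then show ?thesis using False by (simp add: G_def)
      qed
    qed
    also have "\<dots> = (\<Sum>k\<in>{..<n} \<inter> {k. k < j}. D k \<omega>)"
      by (subst sum.inter_restrict) auto
    also have "{..<n} \<inter> {k. k < j} = {..<j}" using \<open>j \<le> n\<close> by auto
    finally show ?thesis using j by (simp add: P_def)
  qed
  note [measurable] = measurable_F_M[OF W(1)] measurable_F_M[OF P_meas[OF order_refl]]
  have "\<epsilon>\<^sup>2 * prob {\<omega>\<in>space M. \<exists>j\<le>n. \<epsilon> \<le> \<bar>P j \<omega>\<bar>}
      = (\<integral>\<omega>. \<epsilon>\<^sup>2 * indicator {\<omega>\<in>space M. \<exists>j\<le>n. \<epsilon> \<le> \<bar>P j \<omega>\<bar>} \<omega> \<partial>M)"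
    by simp
  also have "\<dots> \<le> (\<integral>\<omega>. (W n \<omega>)\<^sup>2 \<partial>M)"
  proof (rule integral_mono)
    show "integrable M (\<lambda>\<omega>. \<epsilon>\<^sup>2 * indicator {\<omega>\<in>space M. \<exists>j\<le>n. \<epsilon> \<le> \<bar>P j \<omega>\<bar>} \<omega>)"
      by (intro integrable_mult_right integrable_real_indicator) (auto simp: less_top[symmetric])
    show "integrable M (\<lambda>\<omega>. (W n \<omega>)\<^sup>2)" by (rule W(2))
    show "\<epsilon>\<^sup>2 * indicator {\<omega>\<in>space M. \<exists>j\<le>n. \<epsilon> \<le> \<bar>P j \<omega>\<bar>} \<omega> \<le> (W n \<omega>)\<^sup>2" for \<omega>
      using W_ge[of \<omega>] \<epsilon> power_mono[of \<epsilon> "\<bar>W n \<omega>\<bar>" 2] by (auto split: split_indicator)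
  qed
  also have "\<dots> \<le> (\<Sum>k<n. \<integral>\<omega>. (D k \<omega>)\<^sup>2 \<partial>M)" by (rule W(3))
  finally show ?thesis by (simp add: P_def)
qed

text \<open>The maximal inequality for the shifted sequence bounds the probability that the partial sums after
  time \<open>m\<close> ever move by \<open>\<epsilon>\<close> through the tail of the series of variances.
  Hence the partial sums are almost surely Cauchy.\<close>

theorem square_summable_martingale_converges:
  fixes D :: "nat \<Rightarrow> 'a \<Rightarrow> real"
  assumes D: "\<And>n. D n \<in> borel_measurable (F (Suc n))" "\<And>n. integrable M (\<lambda>\<omega>. (D n \<omega>)\<^sup>2)"
      "\<And>n. AE \<omega> in M. real_cond_exp M (F n) (D n) \<omega> = 0"
    and sum: "summable (\<lambda>n. \<integral>\<omega>. (D n \<omega>)\<^sup>2 \<partial>M)"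
  shows "AE \<omega> in M. summable (\<lambda>n. D n \<omega>)"
proof -
  note [measurable] = measurable_F_M[OF D(1)]
  define v where "v = (\<lambda>n. \<integral>\<omega>. (D n \<omega>)\<^sup>2 \<partial>M)"
  define tail where "tail = (\<lambda>m. \<Sum>k. v (k + m))"
  have v_nn: "0 \<le> v n" for n by (simp add: v_def)
  have sum_v: "summable (\<lambda>k. v (k + m))" for m
    by (rule summable_ignore_initial_segment) (use sum in \<open>simp add: v_def\<close>)
  have tail: "tail \<longlonglongrightarrow> 0"
    unfolding tail_def
    by (rule LIMSEQ_I) (use suminf_exist_split[OF _ sum_v[of 0]] in simp)
  define B where "B = (\<lambda>\<epsilon> m. {\<omega>\<in>space M. \<exists>j. \<epsilon> \<le> \<bar>\<Sum>k<j. D (k + m) \<omega>\<bar>})"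
  have B_meas [measurable]: "B \<epsilon> m \<in> sets M" for \<epsilon> m unfolding B_def by measurable
  have B_le: "\<epsilon>\<^sup>2 * prob (B \<epsilon> m) \<le> tail m" if "0 < \<epsilon>" for \<epsilon> m
  proof -
    define E where "E = (\<lambda>n. {\<omega>\<in>space M. \<exists>j\<le>n. \<epsilon> \<le> \<bar>\<Sum>k<j. D (k + m) \<omega>\<bar>})"
    \<comment> \<open>The sequence shifted by \<open>m\<close> is adapted to the shifted filtration.\<close>
    interpret shifted: filtered_prob_space M "\<lambda>n. F (n + m)"
      by unfold_locales (use subalg_F F_mono in auto)
    have E_le: "\<epsilon>\<^sup>2 * prob (E n) \<le> tail m" for n
    proof -
      have "\<epsilon>\<^sup>2 * prob (E n) \<le> (\<Sum>k<n. v (k + m))"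
        unfolding E_def v_def
      proof (rule shifted.kolmogorov_maximal_inequality[where D = "\<lambda>k. D (k + m)"])
        show "D (k + m) \<in> borel_measurable (F (Suc k + m))" for k using D(1)[of "k + m"] by simp
      qed (fact D that)+
      also have "\<dots> \<le> tail m"
        unfolding tail_def by (rule sum_le_suminf[OF sum_v]) (auto simp: v_nn)
      finally show ?thesis .
    qed
    have "E n \<in> sets M" for n unfolding E_def by measurable
    moreover have "incseq E" by (intro incseq_SucI) (auto simp: E_def intro: le_SucI)
    ultimately have "(\<lambda>n. prob (E n)) \<longlonglongrightarrow> prob (\<Union>n. E n)"
      by (intro finite_Lim_measure_incseq) auto
    moreover have "(\<Union>n. E n) = B \<epsilon> m" by (auto simp: E_def B_def)
    ultimately have "(\<lambda>n. \<epsilon>\<^sup>2 * prob (E n)) \<longlonglongrightarrow> \<epsilon>\<^sup>2 * prob (B \<epsilon> m)"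
      by (intro tendsto_mult_left) simp
    then show ?thesis by (rule LIMSEQ_le_const2) (use E_le in auto)
  qed
  have null: "AE \<omega> in M. \<exists>m. \<omega> \<notin> B \<epsilon> m" if "0 < \<epsilon>" for \<epsilon>
  proof -
    have [measurable]: "(\<Inter>m. B \<epsilon> m) \<in> sets M" by measurable
    have "\<epsilon>\<^sup>2 * prob (\<Inter>m. B \<epsilon> m) \<le> tail n" for n
    proof -
      have "prob (\<Inter>m. B \<epsilon> m) \<le> prob (B \<epsilon> n)" by (intro finite_measure_mono) auto
      then have "\<epsilon>\<^sup>2 * prob (\<Inter>m. B \<epsilon> m) \<le> \<epsilon>\<^sup>2 * prob (B \<epsilon> n)" by (intro mult_left_mono) auto
      then show ?thesis using B_le[OF that, of n] by linarith
    qed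
    then have "\<epsilon>\<^sup>2 * prob (\<Inter>m. B \<epsilon> m) \<le> 0"
      by (intro LIMSEQ_le_const[OF tail]) auto
    then have "prob (\<Inter>m. B \<epsilon> m) \<le> 0" using that by (simp add: mult_le_0_iff)
    then have "prob (\<Inter>m. B \<epsilon> m) = 0" by (intro antisym measure_nonneg)
    then have "AE \<omega> in M. \<omega> \<notin> (\<Inter>m. B \<epsilon> m)"
      by (subst (asm) prob_eq_0) auto
    then show ?thesis by simp
  qed
  have "AE \<omega> in M. \<forall>p. \<exists>m. \<omega> \<notin> B (inverse (real (Suc p))) m"
    by (subst AE_all_countable) (intro allI null, simp)
  with AE_space show ?thesis
  proof eventually_elim
    case (elim \<omega>)
    show "summable (\<lambda>n. D n \<omega>)"
      unfolding summable_Cauchy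
    proof (intro allI impI)
      fix \<epsilon> :: real assume "0 < \<epsilon>"
      then obtain p where p: "inverse (real (Suc p)) < \<epsilon> / 2"
        using reals_Archimedean[of "\<epsilon> / 2"] by auto
      obtain m where "\<omega> \<notin> B (inverse (real (Suc p))) m" using elim by blast
      have small: "\<bar>\<Sum>k<j. D (k + m) \<omega>\<bar> < \<epsilon> / 2" for j
        proof -
        have "\<not> inverse (real (Suc p)) \<le> \<bar>\<Sum>k<j. D (k + m) \<omega>\<bar>"
          using elim(1) \<open>\<omega> \<notin> B (inverse (real (Suc p))) m\<close> by (simp add: B_def)
        then show ?thesis using p by linarith
      qed
      have block: "(\<Sum>k\<in>{m..<q}. D k \<omega>) = (\<Sum>k<q - m. D (k + m) \<omega>)" if "m \<le> q" for q
        using sum.shift_bounds_nat_ivl[of "\<lambda>k. D k \<omega>" 0 m "q - m"] that by (simp add: lessThan_atLeast0)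
      show "\<exists>N. \<forall>a\<ge>N. \<forall>b. norm (\<Sum>k\<in>{a..<b}. D k \<omega>) < \<epsilon>"
      proof (intro exI allI impI)
        fix a b assume "m \<le> a"
        show "norm (\<Sum>k\<in>{a..<b}. D k \<omega>) < \<epsilon>"
        proof (cases "a \<le> b")
          case True
          then have "(\<Sum>k\<in>{a..<b}. D k \<omega>) = (\<Sum>k\<in>{m..<b}. D k \<omega>) - (\<Sum>k\<in>{m..<a}. D k \<omega>)"
            using sum.atLeastLessThan_concat[of m a b "\<lambda>k. D k \<omega>"] \<open>m \<le> a\<close> by simp
          then show ?thesis
            using small[of "a - m"] small[of "b - m"] block[of a, OF \<open>m \<le> a\<close>]
              block[of b, OF order_trans[OF \<open>m \<le> a\<close> True]]
            unfolding real_norm_def by linarith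
        qed (use \<open>0 < \<epsilon>\<close> in simp)
      qed
    qed
  qed
qed

end

section \<open>A strong law under the moment condition\<close>

text \<open>The growth conditions on \<open>phi\<close> are asymptotic. The threshold \<open>a\<close> collects them: from \<open>a\<close> on they all hold.\<close>

locale moment_gauge =
  fixes phi :: "real \<Rightarrow> real" and a :: real
  assumes a_ge_1: "1 \<le> a"
    and nonneg: "\<And>x. 0 \<le> x \<Longrightarrow> 0 \<le> phi x"
    and pos: "\<And>x. a \<le> x \<Longrightarrow> 0 < phi x"
    and mono: "\<And>x y. a \<le> x \<Longrightarrow> x \<le> y \<Longrightarrow> phi x \<le> phi y"
    and ratio_mono: "\<And>x y. a \<le> x \<Longrightarrow> x \<le> y \<Longrightarrow> x / phi x \<le> y / phi y"
    and summable_recip: "summable (\<lambda>k. 1 / (real (Suc k) * phi (real (Suc k))))"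

lemma moment_gauge_exists:
  fixes phi :: "real \<Rightarrow> real"
  assumes nonneg: "\<And>x. 0 \<le> x \<Longrightarrow> 0 \<le> phi x"
    and pos: "\<forall>\<^sub>F x in at_top. 0 < phi x"
    and mono: "\<exists>a. mono_on {a..} phi"
    and summable: "\<exists>n0. (\<forall>n\<ge>n0. 0 < real n * phi (real n)) \<and>
          summable (\<lambda>n. 1 / (real (n + n0) * phi (real (n + n0))))"
    and ratio_mono: "\<exists>a. mono_on {a..} (\<lambda>x. x / phi x)"
  shows "\<exists>a. moment_gauge phi a"
proof -
  obtain a1 where a1: "\<And>x. a1 \<le> x \<Longrightarrow> 0 < phi x" using pos by (auto simp: eventually_at_top_linorder)
  obtain a2 where a2: "mono_on {a2..} phi" using mono by blast
  obtain a3 where a3: "mono_on {a3..} (\<lambda>x. x / phi x)" using ratio_mono by blast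
  obtain n0 where "summable (\<lambda>n. 1 / (real (n + n0) * phi (real (n + n0))))" using summable by blast
  then have "summable (\<lambda>n. 1 / (real n * phi (real n)))"
    by (subst (asm) summable_iff_shift[of "\<lambda>n. 1 / (real n * phi (real n))"])
  then have sum: "summable (\<lambda>n. 1 / (real (Suc n) * phi (real (Suc n))))"
    by (subst summable_Suc_iff[of "\<lambda>n. 1 / (real n * phi (real n))"])
  let ?a = "max 1 (max a1 (max a2 a3))"
  have "moment_gauge phi ?a"
  proof
    fix x y assume x: "?a \<le> x" "x \<le> y"
    show "phi x \<le> phi y" using x by (intro mono_onD[OF a2]) auto
    show "x / phi x \<le> y / phi y" using x by (intro mono_onD[OF a3]) auto
  qed (use a1 nonneg sum in auto)
  then show ?thesis ..
qed

context moment_gauge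
begin

lemma moment_nonneg: "0 \<le> y \<Longrightarrow> 0 \<le> y * phi y"
  using nonneg by simp

lemma tail_le:
  assumes "a \<le> x" "0 \<le> y"
  shows "(if x < y then y else 0) \<le> y * phi y / phi x"
proof (cases "x < y")
  case True
  then have "y * phi x \<le> y * phi y" using mono[of x y] assms by (intro mult_left_mono) auto
  then show ?thesis using True pos[OF assms(1)] by (simp add: pos_le_divide_eq)
next
  case False
  then show ?thesis using moment_nonneg[OF assms(2)] pos[OF assms(1)] by simp
qed

lemma square_le:
  assumes x: "a \<le> x" and y: "0 \<le> y" "y \<le> x"
  shows "y\<^sup>2 \<le> a\<^sup>2 + y * phi y * (x / phi x)"
proof (cases "a \<le> y")
  case True
  have "y\<^sup>2 = y * phi y * (y / phi y)" using pos[OF True] by (simp add: power2_eq_square)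
  also have "\<dots> \<le> y * phi y * (x / phi x)"
    using ratio_mono[OF True y(2)] moment_nonneg[OF y(1)] by (intro mult_left_mono)
  finally show ?thesis by (simp add: add_increasing)
next
  case False
  then have "y\<^sup>2 \<le> a\<^sup>2" using y by (intro power_mono) auto
  moreover have "0 \<le> y * phi y * (x / phi x)"
    using mult_nonneg_nonneg[OF moment_nonneg[OF y(1)], of "x / phi x"] pos[OF x] x a_ge_1 by simp
  ultimately show ?thesis by linarith
qed

text \<open>Otherwise the series of \<open>1 / (n phi n)\<close> would dominate a multiple of the harmonic series.\<close>

lemma unbounded: "\<exists>x\<ge>a. c \<le> phi x"
proof (rule ccontr)
  assume "\<not> ?thesis"
  then have less: "phi x < c" if "a \<le> x" for x using that by force
  have "0 < c" using less[of a] pos[of a] by simp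
  have "\<forall>\<^sub>F k in sequentially. a \<le> real (Suc k)"
    using eventually_ge_at_top[of "nat \<lceil>a\<rceil>"] by eventually_elim linarith
  then have "\<forall>\<^sub>F k in sequentially. norm (inverse (real (Suc k))) \<le> c * (1 / (real (Suc k) * phi (real (Suc k))))"
  proof eventually_elim
    case (elim k)
    have "1 \<le> c / phi (real (Suc k))" using less[OF elim] pos[OF elim] by (simp add: pos_le_divide_eq)
    then have "inverse (real (Suc k)) * 1 \<le> inverse (real (Suc k)) * (c / phi (real (Suc k)))"
      by (intro mult_left_mono) auto
    then show ?case by (simp add: divide_inverse mult_ac del: of_nat_Suc)
  qed
  then have "summable (\<lambda>k. inverse (real (Suc k)))"
    by (rule summable_comparison_test_ev) (intro summable_mult summable_recip)
  then have "summable (\<lambda>k. inverse (real k))" using summable_Suc_iff[of "\<lambda>n. inverse (real n)"] by blast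
  then show False using not_summable_harmonic[where 'a = real] by blast
qed

end

text \<open>Replace \<open>X k\<close> by zero where \<open>Y k > k + 1\<close>, and write \<open>x = k + 1\<close> and \<open>y = Y k\<close>. The truncated
  variables have summable scaled second moments, because \<open>y\<^sup>2 \<le> y phi y \<cdot> x / phi x\<close> for large \<open>y \<le> x\<close>; centred
  and scaled by \<open>x\<close>, they form the differences of a convergent martingale. The remainders have summable scaled first moments,
  because \<open>y \<le> y phi y / phi x\<close> for \<open>y > x\<close>. In both cases Kronecker's lemma finishes the proof.\<close>

theorem (in filtered_prob_space) conditional_strong_law:
  fixes X Y :: "nat \<Rightarrow> 'a \<Rightarrow> real"
  assumes gauge: "moment_gauge phi a"
    and X: "\<And>n. X n \<in> borel_measurable (F (Suc n))" and Y: "\<And>n. Y n \<in> borel_measurable (F (Suc n))"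
    and XY: "\<And>n \<omega>. \<omega> \<in> space M \<Longrightarrow> \<bar>X n \<omega>\<bar> \<le> Y n \<omega>" and Y_int: "\<And>n. integrable M (Y n)"
    and moment: "\<And>n. integrable M (\<lambda>\<omega>. Y n \<omega> * phi (Y n \<omega>))"
      "\<And>n. (\<integral>\<omega>. Y n \<omega> * phi (Y n \<omega>) \<partial>M) \<le> B"
  shows "AE \<omega> in M. (\<lambda>n. (1 / real n) * (\<Sum>k<n. X k \<omega> - real_cond_exp M (F k) (X k) \<omega>)) \<longlonglongrightarrow> 0"
proof -
  interpret moment_gauge phi a by (rule gauge)
  define T where "T = (\<lambda>k \<omega>. if Y k \<omega> \<le> real (Suc k) then X k \<omega> else 0)"
  define U where "U = (\<lambda>k \<omega>. X k \<omega> - T k \<omega>)"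
  define P where "P = (\<lambda>k. real_cond_exp M (F k) (T k))"
  define Q where "Q = (\<lambda>k. real_cond_exp M (F k) (U k))"
  define D where "D = (\<lambda>k \<omega>. (T k \<omega> - P k \<omega>) / real (Suc k))"
  have T_meas: "T k \<in> borel_measurable (F (Suc k))" for k
  proof -
    note [measurable] = X[of k] Y[of k]
    show ?thesis unfolding T_def by measurable
  qed
  have P_meas: "P k \<in> borel_measurable (F k)" for k unfolding P_def by (rule borel_measurable_cond_exp)
  note [measurable] = measurable_F_M[OF X] measurable_F_M[OF Y] measurable_F_M[OF T_meas]
    measurable_F_M[OF P_meas]
  have [measurable]: "U k \<in> borel_measurable M" for k unfolding U_def by measurable
  have Y_nn: "0 \<le> Y k \<omega>" if "\<omega> \<in> space M" for k \<omega> using XY[OF that, of k] by linarith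
  have T_le: "\<bar>T k \<omega>\<bar> \<le> real (Suc k)" if "\<omega> \<in> space M" for k \<omega>
    using XY[OF that, of k] by (auto simp: T_def)
  have X_int: "integrable M (X k)" for k
    by (rule Bochner_Integration.integrable_bound[OF Y_int[of k]]) (use XY Y_nn in auto)
  have T_int: "integrable M (T k)" and T2_int: "integrable M (\<lambda>\<omega>. (T k \<omega>)\<^sup>2)" for k
  proof -
    show "integrable M (T k)"
      by (rule integrable_const_bound[where B = "real (Suc k)"]) (use T_le in auto)
    show "integrable M (\<lambda>\<omega>. (T k \<omega>)\<^sup>2)"
      by (rule integrable_const_bound[where B = "(real (Suc k))\<^sup>2"])
         (use power_mono[OF T_le[of _ k], of _ 2] in auto)
  qed
  have U_int: "integrable M (U k)" for k
    unfolding U_def using X_int T_int by simp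
  have large: "\<forall>\<^sub>F k in sequentially. a \<le> real (Suc k)"
    using eventually_ge_at_top[of "nat \<lceil>a\<rceil>"] by eventually_elim linarith

  have D_int: "integrable M (\<lambda>\<omega>. (D k \<omega>)\<^sup>2)"
    and D_var: "(\<integral>\<omega>. (D k \<omega>)\<^sup>2 \<partial>M) \<le> (\<integral>\<omega>. (T k \<omega>)\<^sup>2 \<partial>M) / (real (Suc k))\<^sup>2" for k
  proof -
    interpret sigma_finite_subalgebra M "F k" by (rule sigma_finite_F)
    have P_int: "integrable M (P k)" unfolding P_def by (rule real_cond_exp_int(1)[OF T_int])
    have PT: "integrable M (\<lambda>\<omega>. P k \<omega> * T k \<omega>)"
    proof (rule Bochner_Integration.integrable_bound)
      show "integrable M (\<lambda>\<omega>. real (Suc k) * P k \<omega>)" using P_int by simp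
      show "AE \<omega> in M. norm (P k \<omega> * T k \<omega>) \<le> norm (real (Suc k) * P k \<omega>)"
        using T_le[of _ k] by (intro AE_I2) (auto simp: abs_mult mult.commute intro!: mult_left_mono)
    qed measurable
    have PP: "integrable M (\<lambda>\<omega>. P k \<omega> * P k \<omega>)"
      and PP_eq: "(\<integral>\<omega>. P k \<omega> * P k \<omega> \<partial>M) = (\<integral>\<omega>. P k \<omega> * T k \<omega> \<partial>M)"
      unfolding P_def
      by (rule real_cond_exp_intg; use PT P_meas in \<open>simp add: P_def\<close>)+
    have sq: "(D k \<omega>)\<^sup>2 = ((T k \<omega>)\<^sup>2 - 2 * (P k \<omega> * T k \<omega>) + P k \<omega> * P k \<omega>) / (real (Suc k))\<^sup>2" for \<omega>
      by (simp add: D_def power_divide power2_eq_square algebra_simps)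
    show "integrable M (\<lambda>\<omega>. (D k \<omega>)\<^sup>2)"
      unfolding sq using PT PP T2_int by simp
    have "(\<integral>\<omega>. (D k \<omega>)\<^sup>2 \<partial>M) = ((\<integral>\<omega>. (T k \<omega>)\<^sup>2 \<partial>M) - (\<integral>\<omega>. P k \<omega> * P k \<omega> \<partial>M)) / (real (Suc k))\<^sup>2"
      unfolding sq using PT PP T2_int by (simp add: PP_eq)
    also have "\<dots> \<le> (\<integral>\<omega>. (T k \<omega>)\<^sup>2 \<partial>M) / (real (Suc k))\<^sup>2"
      by (intro divide_right_mono) auto
    finally show "(\<integral>\<omega>. (D k \<omega>)\<^sup>2 \<partial>M) \<le> (\<integral>\<omega>. (T k \<omega>)\<^sup>2 \<partial>M) / (real (Suc k))\<^sup>2" .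
  qed
  have "AE \<omega> in M. summable (\<lambda>k. D k \<omega>)"
  proof (rule square_summable_martingale_converges)
    show "D k \<in> borel_measurable (F (Suc k))" for k
      unfolding D_def using T_meas measurable_F_mono[OF _ P_meas[of k], of "Suc k"]
      by (intro borel_measurable_divide borel_measurable_diff) auto
    show "AE \<omega> in M. real_cond_exp M (F k) (D k) \<omega> = 0" for k
    proof -
      interpret sigma_finite_subalgebra M "F k" by (rule sigma_finite_F)
      have P_int: "integrable M (P k)" unfolding P_def by (rule real_cond_exp_int(1)[OF T_int])
      have "AE \<omega> in M. real_cond_exp M (F k) (D k) \<omega> = real_cond_exp M (F k) (\<lambda>\<omega>. T k \<omega> - P k \<omega>) \<omega> / real (Suc k)"
        unfolding D_def using T_int P_int by (intro real_cond_exp_cdiv) auto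
      moreover have "AE \<omega> in M. real_cond_exp M (F k) (\<lambda>\<omega>. T k \<omega> - P k \<omega>) \<omega>
          = real_cond_exp M (F k) (T k) \<omega> - real_cond_exp M (F k) (P k) \<omega>"
        using T_int P_int by (rule real_cond_exp_diff)
      moreover have "AE \<omega> in M. real_cond_exp M (F k) (P k) \<omega> = P k \<omega>"
        using P_int P_meas by (rule real_cond_exp_F_meas)
      ultimately show ?thesis by eventually_elim (simp add: P_def)
    qed
    show "summable (\<lambda>k. \<integral>\<omega>. (D k \<omega>)\<^sup>2 \<partial>M)"
    proof (rule summable_comparison_test_ev)
      show "summable (\<lambda>k. a\<^sup>2 * inverse ((real (Suc k))\<^sup>2) + B * (1 / (real (Suc k) * phi (real (Suc k)))))"
        using summable_Suc_iff[of "\<lambda>n. inverse ((real n)\<^sup>2)"] inverse_power_summable[of 2, where 'a = real]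
        by (intro summable_add summable_mult summable_recip) auto
      show "\<forall>\<^sub>F k in sequentially. norm (\<integral>\<omega>. (D k \<omega>)\<^sup>2 \<partial>M)
          \<le> a\<^sup>2 * inverse ((real (Suc k))\<^sup>2) + B * (1 / (real (Suc k) * phi (real (Suc k))))"
        using large
      proof eventually_elim
        case (elim k)
        let ?x = "real (Suc k)"
        have "(\<integral>\<omega>. (T k \<omega>)\<^sup>2 \<partial>M) \<le> (\<integral>\<omega>. a\<^sup>2 + Y k \<omega> * phi (Y k \<omega>) * (?x / phi ?x) \<partial>M)"
        proof (rule integral_mono)
          fix \<omega> assume \<omega>: "\<omega> \<in> space M"
          show "(T k \<omega>)\<^sup>2 \<le> a\<^sup>2 + Y k \<omega> * phi (Y k \<omega>) * (?x / phi ?x)"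
          proof (cases "Y k \<omega> \<le> ?x")
            case True
            have "(T k \<omega>)\<^sup>2 \<le> (Y k \<omega>)\<^sup>2"
              using True power_mono[OF XY[OF \<omega>, of k], of 2] by (simp add: T_def)
            then show ?thesis using square_le[OF elim Y_nn[OF \<omega>] True] by linarith
          next
            case False
            have "0 \<le> Y k \<omega> * phi (Y k \<omega>) * (?x / phi ?x)"
              using mult_nonneg_nonneg[OF moment_nonneg[OF Y_nn[OF \<omega>, of k]], of "?x / phi ?x"] pos[OF elim]
              by (simp del: of_nat_Suc)
            then show ?thesis using False by (simp add: T_def)
          qed
        qed (use T2_int moment(1) in auto)
        also have "\<dots> = a\<^sup>2 + (\<integral>\<omega>. Y k \<omega> * phi (Y k \<omega>) \<partial>M) * (?x / phi ?x)"
          using moment(1)[of k] by (simp add: prob_space)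
        also have "\<dots> \<le> a\<^sup>2 + B * (?x / phi ?x)"
          using moment(2)[of k] pos[OF elim] by (intro add_left_mono mult_right_mono) auto
        finally have "(\<integral>\<omega>. (T k \<omega>)\<^sup>2 \<partial>M) / ?x\<^sup>2 \<le> (a\<^sup>2 + B * (?x / phi ?x)) / ?x\<^sup>2"
          by (intro divide_right_mono) auto
        also have "\<dots> = a\<^sup>2 * inverse (?x\<^sup>2) + B * (1 / (?x * phi ?x))"
          using pos[OF elim] by (simp add: field_simps power2_eq_square del: of_nat_Suc)
        finally show ?case using D_var[of k] by simp
      qed
    qed
  qed (rule D_int)
  moreover
  have U_mean: "\<forall>\<^sub>F k in sequentially. (\<integral>\<omega>. \<bar>U k \<omega>\<bar> \<partial>M) / real (Suc k) \<le> B * (1 / (real (Suc k) * phi (real (Suc k))))"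
    using large
  proof eventually_elim
    case (elim k)
    let ?x = "real (Suc k)"
    have "(\<integral>\<omega>. \<bar>U k \<omega>\<bar> \<partial>M) \<le> (\<integral>\<omega>. Y k \<omega> * phi (Y k \<omega>) / phi ?x \<partial>M)"
    proof (rule integral_mono)
      fix \<omega> assume \<omega>: "\<omega> \<in> space M"
      have "\<bar>U k \<omega>\<bar> \<le> (if ?x < Y k \<omega> then Y k \<omega> else 0)"
        using XY[OF \<omega>, of k] by (auto simp: U_def T_def)
      then show "\<bar>U k \<omega>\<bar> \<le> Y k \<omega> * phi (Y k \<omega>) / phi ?x"
        using tail_le[OF elim Y_nn[OF \<omega>, of k]] by linarith
    qed (use U_int moment(1) in auto)
    also have "\<dots> \<le> B / phi ?x"
      using moment(2)[of k] pos[OF elim] by (simp add: divide_right_mono del: of_nat_Suc)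
    finally have "(\<integral>\<omega>. \<bar>U k \<omega>\<bar> \<partial>M) / ?x \<le> (B / phi ?x) / ?x" by (intro divide_right_mono) auto
    then show ?case by (simp add: mult.commute del: of_nat_Suc)
  qed
  have "AE \<omega> in M. summable (\<lambda>k. U k \<omega> / real (Suc k))"
  proof (rule AE_summable_of_summable_integral)
    show "summable (\<lambda>k. \<integral>\<omega>. \<bar>U k \<omega> / real (Suc k)\<bar> \<partial>M)"
      by (rule summable_comparison_test_ev[OF _ summable_mult[OF summable_recip, of B]])
         (use U_mean in eventually_elim, simp del: of_nat_Suc)
  qed (use U_int in simp)
  moreover have "AE \<omega> in M. summable (\<lambda>k. Q k \<omega> / real (Suc k))"
  proof (rule AE_summable_of_summable_integral)
    have Q_int: "integrable M (Q k)" for k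
      unfolding Q_def by (rule sigma_finite_subalgebra.real_cond_exp_int(1)[OF sigma_finite_F U_int])
    then show "integrable M (\<lambda>\<omega>. Q k \<omega> / real (Suc k))" for k by simp
    have Q_le: "(\<integral>\<omega>. \<bar>Q k \<omega>\<bar> \<partial>M) \<le> (\<integral>\<omega>. \<bar>U k \<omega>\<bar> \<partial>M)" for k
    proof -
      interpret sigma_finite_subalgebra M "F k" by (rule sigma_finite_F)
      have "(\<integral>\<omega>. \<bar>Q k \<omega>\<bar> \<partial>M) \<le> (\<integral>\<omega>. real_cond_exp M (F k) (\<lambda>\<omega>. \<bar>U k \<omega>\<bar>) \<omega> \<partial>M)"
      proof (rule integral_mono_AE)
        show "AE \<omega> in M. \<bar>Q k \<omega>\<bar> \<le> real_cond_exp M (F k) (\<lambda>\<omega>. \<bar>U k \<omega>\<bar>) \<omega>"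
        proof -
          have "AE \<omega> in M. Q k \<omega> \<le> real_cond_exp M (F k) (\<lambda>\<omega>. \<bar>U k \<omega>\<bar>) \<omega>"
            unfolding Q_def using U_int[of k] by (intro real_cond_exp_mono) auto
          moreover have "AE \<omega> in M. real_cond_exp M (F k) (\<lambda>\<omega>. - 1 * U k \<omega>) \<omega>
              \<le> real_cond_exp M (F k) (\<lambda>\<omega>. \<bar>U k \<omega>\<bar>) \<omega>"
            using U_int[of k] by (intro real_cond_exp_mono) auto
          moreover have "AE \<omega> in M. real_cond_exp M (F k) (\<lambda>\<omega>. - 1 * U k \<omega>) \<omega> = - 1 * Q k \<omega>"
            unfolding Q_def using U_int[of k] by (rule real_cond_exp_cmult)
          ultimately show ?thesis by eventually_elim auto
        qed
      qed (use Q_int U_int real_cond_exp_int in auto)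
      also have "\<dots> = (\<integral>\<omega>. \<bar>U k \<omega>\<bar> \<partial>M)"
        using U_int by (intro real_cond_exp_int) auto
      finally show ?thesis .
    qed
    show "summable (\<lambda>k. \<integral>\<omega>. \<bar>Q k \<omega> / real (Suc k)\<bar> \<partial>M)"
    proof (rule summable_comparison_test_ev[OF _ summable_mult[OF summable_recip, of B]], use U_mean in eventually_elim)
      case (elim k)
      have "(\<integral>\<omega>. \<bar>Q k \<omega>\<bar> \<partial>M) / real (Suc k) \<le> (\<integral>\<omega>. \<bar>U k \<omega>\<bar> \<partial>M) / real (Suc k)"
        using Q_le by (intro divide_right_mono) auto
      then show ?case using elim by (simp del: of_nat_Suc)
    qed
  qed
  moreover have "AE \<omega> in M. \<forall>k. real_cond_exp M (F k) (X k) \<omega> = P k \<omega> + Q k \<omega>"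
  proof (subst AE_all_countable, intro allI)
    fix k
    interpret sigma_finite_subalgebra M "F k" by (rule sigma_finite_F)
    have "X k = (\<lambda>\<omega>. T k \<omega> + U k \<omega>)" by (simp add: U_def)
    then show "AE \<omega> in M. real_cond_exp M (F k) (X k) \<omega> = P k \<omega> + Q k \<omega>"
      unfolding P_def Q_def using real_cond_exp_add[OF T_int U_int] by simp
  qed
  ultimately show ?thesis
  proof eventually_elim
    case (elim \<omega>)
    have "(\<lambda>n. (1 / real n) * (\<Sum>k<n. T k \<omega> - P k \<omega>) + (1 / real n) * (\<Sum>k<n. U k \<omega>)
        - (1 / real n) * (\<Sum>k<n. Q k \<omega>)) \<longlonglongrightarrow> 0 + 0 - 0"
      using elim(1-3) unfolding D_def by (intro tendsto_add tendsto_diff kronecker_mean_null)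
    moreover have "(1 / real n) * (\<Sum>k<n. T k \<omega> - P k \<omega>) + (1 / real n) * (\<Sum>k<n. U k \<omega>)
        - (1 / real n) * (\<Sum>k<n. Q k \<omega>)
        = (1 / real n) * (\<Sum>k<n. X k \<omega> - real_cond_exp M (F k) (X k) \<omega>)" for n
    proof -
      have "(\<Sum>k<n. T k \<omega> - P k \<omega>) + (\<Sum>k<n. U k \<omega>) - (\<Sum>k<n. Q k \<omega>)
          = (\<Sum>k<n. X k \<omega> - real_cond_exp M (F k) (X k) \<omega>)"
        unfolding sum.distrib[symmetric] sum_subtractf[symmetric]
        using elim(4) by (intro sum.cong) (auto simp: U_def)
      then show ?thesis by (simp only: distrib_left[symmetric] right_diff_distrib[symmetric])
    qed
    ultimately show ?case by simp
  qed
qed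

section \<open>Conditional independence and conditional means\<close>

text \<open>The functions \<open>h1\<close> and \<open>h2\<close> serve as densities; the images of the two measures under \<open>Z\<close> agree on Borel sets.\<close>

lemma (in prob_space) integral_mult_eq_of_indicators:
  fixes h1 h2 :: "'a \<Rightarrow> real" and g :: "'b::topological_space \<Rightarrow> real"
  assumes h: "integrable M h1" "integrable M h2" "\<And>\<omega>. 0 \<le> h1 \<omega>" "\<And>\<omega>. 0 \<le> h2 \<omega>"
    and Z: "Z \<in> borel_measurable M" and g: "g \<in> borel_measurable borel"
    and eq: "\<And>B. B \<in> sets borel \<Longrightarrow>
      (\<integral>\<omega>. h1 \<omega> * indicator B (Z \<omega>) \<partial>M) = (\<integral>\<omega>. h2 \<omega> * indicator B (Z \<omega>) \<partial>M)"
  shows "(\<integral>\<omega>. h1 \<omega> * g (Z \<omega>) \<partial>M) = (\<integral>\<omega>. h2 \<omega> * g (Z \<omega>) \<partial>M)"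
proof -
  note [measurable] = Z g borel_measurable_integrable[OF h(1)] borel_measurable_integrable[OF h(2)]
  define \<nu> where "\<nu> = (\<lambda>h::'a \<Rightarrow> real. distr (density M (\<lambda>\<omega>. ennreal (h \<omega>))) borel Z)"
  have emeasure_\<nu>: "emeasure (\<nu> h) B = ennreal (\<integral>\<omega>. h \<omega> * indicator B (Z \<omega>) \<partial>M)"
    if hh: "integrable M h" "\<And>\<omega>. 0 \<le> h \<omega>" and B: "B \<in> sets borel" for h B
  proof -
    note [measurable] = borel_measurable_integrable[OF hh(1)] B
    have int: "integrable M (\<lambda>\<omega>. h \<omega> * indicator B (Z \<omega>))"
      by (rule Bochner_Integration.integrable_bound[OF hh(1)]) (auto split: split_indicator)
    have "emeasure (\<nu> h) B = (\<integral>\<^sup>+\<omega>. ennreal (h \<omega>) * indicator (Z -` B \<inter> space M) \<omega> \<partial>M)"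
      unfolding \<nu>_def by (subst emeasure_distr) (auto simp: emeasure_density)
    also have "\<dots> = (\<integral>\<^sup>+\<omega>. ennreal (h \<omega> * indicator B (Z \<omega>)) \<partial>M)"
      by (intro nn_integral_cong) (auto split: split_indicator)
    also have "\<dots> = ennreal (\<integral>\<omega>. h \<omega> * indicator B (Z \<omega>) \<partial>M)"
      using int hh(2) by (intro nn_integral_eq_integral) (auto split: split_indicator)
    finally show ?thesis .
  qed
  have "\<nu> h1 = \<nu> h2"
  proof (rule measure_eqI)
    show "sets (\<nu> h1) = sets (\<nu> h2)" by (simp add: \<nu>_def)
    fix B assume "B \<in> sets (\<nu> h1)"
    then have "B \<in> sets borel" by (simp add: \<nu>_def)
    then show "emeasure (\<nu> h1) B = emeasure (\<nu> h2) B"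
      using emeasure_\<nu>[OF h(1,3)] emeasure_\<nu>[OF h(2,4)] eq by simp
  qed
  moreover have "integral\<^sup>L (\<nu> h) g = (\<integral>\<omega>. h \<omega> * g (Z \<omega>) \<partial>M)"
    if hh: "integrable M h" "\<And>\<omega>. 0 \<le> h \<omega>" for h
  proof -
    note [measurable] = borel_measurable_integrable[OF hh(1)]
    show ?thesis
      unfolding \<nu>_def using hh(2) by (simp add: integral_distr integral_density)
  qed
  ultimately show ?thesis using h by metis
qed

text \<open>The hypothesis of conditional independence concerns events. For a fixed \<open>F\<close>-event and a fixed \<open>A\<close> it says
  that two finite measures on the values of \<open>Z\<close> agree, so they give the same integral to \<open>g\<close>.\<close>

lemma (in filtered_prob_space) cond_exp_indicator_mult:
  fixes X :: "'a \<Rightarrow> 'b::topological_space" and Z :: "'a \<Rightarrow> 'c::topological_space" and g :: "'c \<Rightarrow> real"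
  assumes indep: "cond_indep M (F n) X Z" and X: "X \<in> borel_measurable M" and Z: "Z \<in> borel_measurable M"
    and A: "A \<in> sets borel" and g: "g \<in> borel_measurable borel" and int: "integrable M (\<lambda>\<omega>. g (Z \<omega>))"
  shows "AE \<omega> in M. real_cond_exp M (F n) (\<lambda>\<omega>. indicator A (X \<omega>) * g (Z \<omega>)) \<omega>
    = cond_prob M (F n) (\<lambda>\<omega>. X \<omega> \<in> A) \<omega> * real_cond_exp M (F n) (\<lambda>\<omega>. g (Z \<omega>)) \<omega>"
proof -
  interpret sigma_finite_subalgebra M "F n" by (rule sigma_finite_F)
  note [measurable] = X Z A g
  define p where "p = cond_prob M (F n) (\<lambda>\<omega>. X \<omega> \<in> A)"
  have F_M: "D \<in> sets M" if "D \<in> sets (F n)" for D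
    using that subalg_F[of n] by (auto simp: subalgebra_def)
  have p_F [measurable]: "p \<in> borel_measurable (F n)" unfolding p_def cond_prob_def by simp
  then have [measurable]: "p \<in> borel_measurable M" by (rule measurable_F_M)
  have ind_int: "integrable M (indicator {\<omega> \<in> space M. X \<omega> \<in> A} :: 'a \<Rightarrow> real)"
    by (intro integrable_real_indicator) (auto simp: less_top[symmetric])
  have p01: "AE \<omega> in M. 0 \<le> p \<omega> \<and> p \<omega> \<le> 1"
  proof -
    have "AE \<omega> in M. p \<omega> \<le> real_cond_exp M (F n) (\<lambda>_. 1) \<omega>"
      unfolding p_def cond_prob_def using ind_int
      by (intro real_cond_exp_mono) (auto split: split_indicator)
    moreover have "AE \<omega> in M. real_cond_exp M (F n) (\<lambda>_. 1) \<omega> = 1"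
      by (intro real_cond_exp_F_meas) auto
    moreover have "AE \<omega> in M. 0 \<le> p \<omega>"
      unfolding p_def cond_prob_def by (intro real_cond_exp_pos) (auto split: split_indicator)
    ultimately show ?thesis by eventually_elim auto
  qed
  have bounded_mult: "integrable M (\<lambda>\<omega>. h \<omega> * f \<omega>)"
    if "integrable M f" "h \<in> borel_measurable M" "AE \<omega> in M. \<bar>h \<omega>\<bar> \<le> 1" for h f :: "'a \<Rightarrow> real"
  proof (rule Bochner_Integration.integrable_bound[OF that(1)])
    show "AE \<omega> in M. norm (h \<omega> * f \<omega>) \<le> norm (f \<omega>)"
      using that(3) by eventually_elim (auto simp: abs_mult intro: mult_left_le_one_le)
  qed (use that in measurable)
  have pg: "integrable M (\<lambda>\<omega>. p \<omega> * g (Z \<omega>))"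
    using p01 by (intro bounded_mult int) (auto elim: eventually_mono)
  show ?thesis
    unfolding p_def[symmetric]
  proof (rule real_cond_exp_charact)
    show "integrable M (\<lambda>\<omega>. indicator A (X \<omega>) * g (Z \<omega>))"
      by (intro bounded_mult int) (auto split: split_indicator)
    show "integrable M (\<lambda>\<omega>. p \<omega> * real_cond_exp M (F n) (\<lambda>\<omega>. g (Z \<omega>)) \<omega>)"
      by (intro real_cond_exp_intg(1) pg) auto
    show "(\<lambda>\<omega>. p \<omega> * real_cond_exp M (F n) (\<lambda>\<omega>. g (Z \<omega>)) \<omega>) \<in> borel_measurable (F n)"
      by measurable
    fix D assume D: "D \<in> sets (F n)"
    then have [measurable]: "D \<in> sets (F n)" "D \<in> sets M" by (auto intro: F_M)
    define h1 where "h1 = (\<lambda>\<omega>. indicator D \<omega> * indicator A (X \<omega>) :: real)"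
    define h2 where "h2 = (\<lambda>\<omega>. indicator D \<omega> * max 0 (p \<omega>))"
    have Dp_le: "AE \<omega> in M. \<bar>indicator D \<omega> * p \<omega>\<bar> \<le> 1"
      using p01 by eventually_elim (auto split: split_indicator)
    have DA: "integrable M (\<lambda>\<omega>. indicator D \<omega> * indicator A (X \<omega>) :: real)"
      by (intro integrable_const_bound[where B = 1]) (auto split: split_indicator)
    have "(\<integral>\<omega>. h1 \<omega> * g (Z \<omega>) \<partial>M) = (\<integral>\<omega>. h2 \<omega> * g (Z \<omega>) \<partial>M)"
    proof (rule integral_mult_eq_of_indicators[where g = g and Z = Z])
      show "integrable M h1" unfolding h1_def by (rule DA)
      show "integrable M h2" unfolding h2_def
        by (rule integrable_const_bound[where B = 1], use p01 in eventually_elim) (auto split: split_indicator)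
      show "0 \<le> h1 \<omega>" "0 \<le> h2 \<omega>" for \<omega> by (auto simp: h1_def h2_def)
      fix B :: "'c set" assume B [measurable]: "B \<in> sets borel"
      let ?i = "indicator {\<omega> \<in> space M. X \<omega> \<in> A \<and> Z \<omega> \<in> B} :: 'a \<Rightarrow> real"
      let ?j = "indicator {\<omega> \<in> space M. Z \<omega> \<in> B} :: 'a \<Rightarrow> real"
      have j_int: "integrable M ?j"
        by (intro integrable_real_indicator) (auto simp: less_top[symmetric])
      have i_int: "integrable M ?i"
        by (intro integrable_real_indicator) (auto simp: less_top[symmetric])
      have "(\<integral>\<omega>. h1 \<omega> * indicator B (Z \<omega>) \<partial>M) = (\<integral>\<omega>. indicator D \<omega> * ?i \<omega> \<partial>M)"
        by (intro Bochner_Integration.integral_cong) (auto simp: h1_def split: split_indicator)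
      also have "\<dots> = (\<integral>\<omega>. indicator D \<omega> * real_cond_exp M (F n) ?i \<omega> \<partial>M)"
        by (intro real_cond_exp_intg(2)[symmetric] bounded_mult i_int) (auto split: split_indicator)
      also have "\<dots> = (\<integral>\<omega>. (indicator D \<omega> * p \<omega>) * real_cond_exp M (F n) ?j \<omega> \<partial>M)"
      proof (rule integral_cong_AE)
        have "AE \<omega> in M. real_cond_exp M (F n) ?i \<omega> = p \<omega> * real_cond_exp M (F n) ?j \<omega>"
          using indep A B unfolding cond_indep_def p_def cond_prob_def by blast
        then show "AE \<omega> in M. indicator D \<omega> * real_cond_exp M (F n) ?i \<omega>
            = (indicator D \<omega> * p \<omega>) * real_cond_exp M (F n) ?j \<omega>"
          by eventually_elim simp
      qed (auto intro!: borel_measurable_times measurable_F_M[OF borel_measurable_cond_exp])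
      also have "\<dots> = (\<integral>\<omega>. (indicator D \<omega> * p \<omega>) * ?j \<omega> \<partial>M)"
        by (intro real_cond_exp_intg(2) bounded_mult j_int Dp_le) auto
      also have "\<dots> = (\<integral>\<omega>. h2 \<omega> * indicator B (Z \<omega>) \<partial>M)"
      proof (rule integral_cong_AE)
        show "AE \<omega> in M. (indicator D \<omega> * p \<omega>) * ?j \<omega> = h2 \<omega> * indicator B (Z \<omega>)"
          using p01 AE_space by eventually_elim (auto simp: h2_def max_def split: split_indicator)
      qed (auto simp: h2_def)
      finally show "(\<integral>\<omega>. h1 \<omega> * indicator B (Z \<omega>) \<partial>M) = (\<integral>\<omega>. h2 \<omega> * indicator B (Z \<omega>) \<partial>M)" .
    qed fact+
    also have "\<dots> = (\<integral>\<omega>. (indicator D \<omega> * p \<omega>) * g (Z \<omega>) \<partial>M)"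
    proof (rule integral_cong_AE)
      show "AE \<omega> in M. h2 \<omega> * g (Z \<omega>) = (indicator D \<omega> * p \<omega>) * g (Z \<omega>)"
        using p01 by eventually_elim (auto simp: h2_def max_def)
    qed (auto simp: h2_def)
    also have "\<dots> = (\<integral>\<omega>. (indicator D \<omega> * p \<omega>) * real_cond_exp M (F n) (\<lambda>\<omega>. g (Z \<omega>)) \<omega> \<partial>M)"
      by (intro real_cond_exp_intg(2)[symmetric] bounded_mult int Dp_le) auto
    finally show "(\<integral>\<omega>\<in>D. (indicator A (X \<omega>) * g (Z \<omega>)) \<partial>M)
        = (\<integral>\<omega>\<in>D. (p \<omega> * real_cond_exp M (F n) (\<lambda>\<omega>. g (Z \<omega>)) \<omega>) \<partial>M)"
      by (simp add: set_lebesgue_integral_def h1_def mult.assoc)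
  qed
qed

section \<open>The urn\<close>

lemma rho_row_le: "(\<Sum>j\<in>UNIV. \<bar>A $ i $ j\<bar>) \<le> rho A"
  unfolding rho_def by (intro Max_ge) auto

lemma rho_nonneg: "0 \<le> rho A"
  using rho_row_le[of A undefined] by (meson order_trans sum_nonneg abs_ge_zero)

lemma rho_entry_le: "\<bar>A $ i $ j\<bar> \<le> rho A"
proof -
  have "\<bar>A $ i $ j\<bar> \<le> (\<Sum>j\<in>UNIV. \<bar>A $ i $ j\<bar>)" by (rule member_le_sum) auto
  then show ?thesis using rho_row_le[of A i] by linarith
qed

lemma rho_le_sum: "rho A \<le> (\<Sum>i\<in>UNIV. \<Sum>j\<in>UNIV. \<bar>A $ i $ j\<bar>)"
  unfolding rho_def
  by (subst Max_le_iff) (auto intro!: member_le_sum sum_nonneg)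

lemma rho_measurable: "rho \<in> borel_measurable (borel :: (real^'k^'k) measure)"
proof -
  note [measurable] = borel_measurable_entry
  show ?thesis unfolding rho_def[abs_def] by measurable
qed

definition urn_events ::
    "'a measure \<Rightarrow> ('a \<Rightarrow> real^'k) \<Rightarrow> (nat \<Rightarrow> 'a \<Rightarrow> real^'k^'k) \<Rightarrow> (nat \<Rightarrow> 'a \<Rightarrow> real^'k) \<Rightarrow> nat \<Rightarrow> 'a set set"
where
  "urn_events M C0 R chi n = {C0 -` A \<inter> space M |A. A \<in> sets borel} \<union>
      (\<Union>m\<in>{1..n}. {R m -` A \<inter> space M |A. A \<in> sets borel} \<union>
                  {chi m -` A \<inter> space M |A. A \<in> sets borel})"

lemma space_urn_filtration: "space (urn_filtration M C0 R chi n) = space M"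
  and sets_urn_filtration:
    "sets (urn_filtration M C0 R chi n) = sigma_sets (space M) (urn_events M C0 R chi n)"
proof -
  have "urn_events M C0 R chi n \<subseteq> Pow (space M)" unfolding urn_events_def by auto
  then show "space (urn_filtration M C0 R chi n) = space M"
    "sets (urn_filtration M C0 R chi n) = sigma_sets (space M) (urn_events M C0 R chi n)"
    unfolding urn_filtration_def urn_events_def[symmetric]
    by (auto simp: space_measure_of sets_measure_of)
qed

context randomized_urn
begin

abbreviation "F \<equiv> urn_filtration M C0 R chi"
abbreviation "C \<equiv> config C0 R chi"
abbreviation "S \<equiv> total_contents C0 R chi"
abbreviation "Hn \<equiv> replacement_mean M C0 R chi"

lemma filtered: "filtered_prob_space M F"
proof
  fix n
  have "sigma_sets (space M) (urn_events M C0 R chi n) \<subseteq> sets M"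
    using C0_measurable R_measurable chi_measurable unfolding urn_events_def
    by (intro sets.sigma_sets_subset) (auto intro: measurable_sets)
  then show "subalgebra M (F n)"
    by (simp add: subalgebra_def space_urn_filtration sets_urn_filtration)
next
  fix m n :: nat assume "m \<le> n"
  then show "sets (F m) \<subseteq> sets (F n)"
    unfolding sets_urn_filtration urn_events_def
    by (intro sigma_sets_mono' Un_mono UN_mono order_refl) auto
qed

sublocale filtered_prob_space M F by (rule filtered)

lemma C0_F: "C0 \<in> borel_measurable (F n)"
  by (rule measurableI) (auto simp: space_urn_filtration sets_urn_filtration urn_events_def intro!: sigma_sets.Basic)

lemma R_F: "1 \<le> m \<Longrightarrow> m \<le> n \<Longrightarrow> R m \<in> borel_measurable (F n)"
  by (rule measurableI) (auto simp: space_urn_filtration sets_urn_filtration urn_events_def intro!: sigma_sets.Basic)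

lemma chi_F: "1 \<le> m \<Longrightarrow> m \<le> n \<Longrightarrow> chi m \<in> borel_measurable (F n)"
  by (rule measurableI) (auto simp: space_urn_filtration sets_urn_filtration urn_events_def intro!: sigma_sets.Basic)

lemma chi_nth_F: "(\<lambda>\<omega>. chi (Suc n) \<omega> $ i) \<in> borel_measurable (F (Suc n))"
  using chi_F[of "Suc n" "Suc n"] by (simp add: borel_measurable_vec_iff)

lemma R_nth_F: "(\<lambda>\<omega>. R (Suc n) \<omega> $ i $ j) \<in> borel_measurable (F (Suc n))"
  using measurable_compose[OF R_F[of "Suc n" "Suc n"] borel_measurable_entry] by simp

lemma C_F: "(\<lambda>\<omega>. C n \<omega> $ i) \<in> borel_measurable (F n)"
proof (induction n arbitrary: i)
  case 0
  show ?case using C0_F[of 0] by (simp add: borel_measurable_vec_iff)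
next
  case (Suc n)
  have "(\<lambda>\<omega>. C n \<omega> $ i) \<in> borel_measurable (F (Suc n))"
    using measurable_F_mono[OF _ Suc] by simp
  then show ?case
    unfolding config.simps vector_add_component vec_mult_nth
    by (intro borel_measurable_add borel_measurable_sum borel_measurable_times chi_nth_F R_nth_F)
qed

lemma S_F: "S n \<in> borel_measurable (F n)"
  unfolding total_contents_def[abs_def] by (intro borel_measurable_sum C_F)

lemma chi_cases:
  assumes "\<omega> \<in> space M"
  obtains i where "chi (Suc n) \<omega> = axis i 1"
  using chi_range[of "Suc n" \<omega>] assms by auto

lemma chi_nth: "\<omega> \<in> space M \<Longrightarrow> chi (Suc n) \<omega> $ i = indicator {axis i 1} (chi (Suc n) \<omega>)"
  by (rule chi_cases[of \<omega> n]) (auto simp: axis_def vec_eq_iff split: split_indicator)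

lemma chi_sum: "\<omega> \<in> space M \<Longrightarrow> (\<Sum>i\<in>UNIV. chi (Suc n) \<omega> $ i) = 1"
  by (rule chi_cases[of \<omega> n]) (auto simp: axis_def)

lemma draw_mean:
  "AE \<omega> in M. real_cond_exp M (F n) (\<lambda>\<omega>. chi (Suc n) \<omega> $ i) \<omega> = C n \<omega> $ i / S n \<omega>"
proof -
  interpret sigma_finite_subalgebra M "F n" by (rule sigma_finite_F)
  have [measurable]: "chi (Suc n) \<in> borel_measurable M" using chi_measurable by simp
  have "AE \<omega> in M. real_cond_exp M (F n) (\<lambda>\<omega>. chi (Suc n) \<omega> $ i) \<omega>
      = real_cond_exp M (F n) (indicator {\<omega> \<in> space M. chi (Suc n) \<omega> = axis i 1}) \<omega>"
    using measurable_F_M[OF chi_nth_F]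
    by (intro real_cond_exp_cong AE_I2) (auto simp: chi_nth split: split_indicator)
  moreover have "AE \<omega> in M. cond_prob M (F n) (\<lambda>\<omega>. chi (Suc n) \<omega> = axis i 1) \<omega> = C n \<omega> $ i / S n \<omega>"
    using draw[of "Suc n" i] by simp
  ultimately show ?thesis by eventually_elim (simp add: cond_prob_def)
qed

lemma R_nth_integrable: "integrable M (\<lambda>\<omega>. R (Suc n) \<omega> $ i $ j)"
  using integrable_bounded_linear[OF bounded_linear_vec_nth
      integrable_bounded_linear[OF bounded_linear_vec_nth R_integrable[of "Suc n"]]] by simp

text \<open>Given the past, drawing color \<open>i\<close> is independent of the replacement matrix, so the mean of what the draw
  adds is the proportion of color \<open>i\<close> times the mean of the \<open>i\<close>-th row.\<close>

lemma addition_mean: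
  "AE \<omega> in M. real_cond_exp M (F n) (\<lambda>\<omega>. chi (Suc n) \<omega> $ i * R (Suc n) \<omega> $ i $ j) \<omega>
    = C n \<omega> $ i / S n \<omega> * Hn n \<omega> $ i $ j"
proof -
  interpret sigma_finite_subalgebra M "F n" by (rule sigma_finite_F)
  have [measurable]: "chi (Suc n) \<in> borel_measurable M" "R (Suc n) \<in> borel_measurable M"
    using chi_measurable R_measurable by simp_all
  note [measurable] = borel_measurable_entry measurable_F_M[OF chi_nth_F] measurable_F_M[OF R_nth_F]
  have "AE \<omega> in M. real_cond_exp M (F n) (\<lambda>\<omega>. indicator {axis i 1} (chi (Suc n) \<omega>) * R (Suc n) \<omega> $ i $ j) \<omega>
    = cond_prob M (F n) (\<lambda>\<omega>. chi (Suc n) \<omega> \<in> {axis i 1}) \<omega>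
      * real_cond_exp M (F n) (\<lambda>\<omega>. R (Suc n) \<omega> $ i $ j) \<omega>"
    using chi_R_cond_indep[of "Suc n"] R_nth_integrable
    by (intro cond_exp_indicator_mult[where g = "\<lambda>A. A $ i $ j"]) auto
  moreover have "AE \<omega> in M. real_cond_exp M (F n) (\<lambda>\<omega>. chi (Suc n) \<omega> $ i * R (Suc n) \<omega> $ i $ j) \<omega>
      = real_cond_exp M (F n) (\<lambda>\<omega>. indicator {axis i 1} (chi (Suc n) \<omega>) * R (Suc n) \<omega> $ i $ j) \<omega>"
    by (intro real_cond_exp_cong AE_I2) (auto simp: chi_nth)
  moreover have "AE \<omega> in M. cond_prob M (F n) (\<lambda>\<omega>. chi (Suc n) \<omega> = axis i 1) \<omega> = C n \<omega> $ i / S n \<omega>"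
    using draw[of "Suc n" i] by simp
  ultimately show ?thesis
    by eventually_elim (simp add: replacement_mean_def cond_exp_matrix_def)
qed

lemma C_nonneg_S_pos: "AE \<omega> in M. \<forall>n. (\<forall>i. 0 \<le> C n \<omega> $ i) \<and> 0 < S n \<omega>"
  using C0_nonneg_nonzero AE_space
proof eventually_elim
  case (elim \<omega>)
  have step: "0 \<le> (chi (Suc n) \<omega> v* R (Suc n) \<omega>) $ i" for n i
    using R_nonneg[of "Suc n" \<omega>] elim(2) by (intro vec_mult_nonneg) (auto simp: chi_nth)
  have "(\<forall>i. 0 \<le> C n \<omega> $ i) \<and> 0 < S n \<omega>" for n
  proof (induction n)
    case 0
    obtain i where "C0 \<omega> $ i \<noteq> 0" using elim(1) by (auto simp: vec_eq_iff)
    then have "0 < (\<Sum>i\<in>UNIV. C0 \<omega> $ i)"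
      using elim(1) by (intro sum_pos2[of _ i]) (auto simp: less_le)
    then show ?case using elim(1) by (simp add: total_contents_def)
  next
    case (Suc n)
    have "0 \<le> (\<Sum>i\<in>UNIV. (chi (Suc n) \<omega> v* R (Suc n) \<omega>) $ i)" by (intro sum_nonneg step)
    then show ?case using Suc step by (auto simp: total_contents_def sum.distrib)
  qed
  then show ?case by blast
qed

end

section \<open>Almost sure limits\<close>

locale urn_with_moments = randomized_urn M C0 R chi + moment_gauge phi a
  for M :: "'a measure" and C0 :: "'a \<Rightarrow> real^'k" and R chi and phi :: "real \<Rightarrow> real" and a :: real +
  fixes b :: real
  assumes moment_int: "\<And>n. integrable M (\<lambda>\<omega>. rho (R (Suc n) \<omega>) * phi (rho (R (Suc n) \<omega>)))"
    and moment_le: "\<And>n. (\<integral>\<omega>. rho (R (Suc n) \<omega>) * phi (rho (R (Suc n) \<omega>)) \<partial>M) \<le> b"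
begin

lemma rho_R_F: "(\<lambda>\<omega>. rho (R (Suc n) \<omega>)) \<in> borel_measurable (F (Suc n))"
  using measurable_compose[OF R_F[of "Suc n" "Suc n"] rho_measurable] by simp

lemma rho_R_int: "integrable M (\<lambda>\<omega>. rho (R (Suc n) \<omega>))"
proof (rule Bochner_Integration.integrable_bound)
  show "integrable M (\<lambda>\<omega>. \<Sum>i\<in>UNIV. \<Sum>j\<in>UNIV. \<bar>R (Suc n) \<omega> $ i $ j\<bar>)"
    using R_nth_integrable by auto
  show "(\<lambda>\<omega>. rho (R (Suc n) \<omega>)) \<in> borel_measurable M" by (rule measurable_F_M[OF rho_R_F])
  show "AE \<omega> in M. norm (rho (R (Suc n) \<omega>)) \<le> norm (\<Sum>i\<in>UNIV. \<Sum>j\<in>UNIV. \<bar>R (Suc n) \<omega> $ i $ j\<bar>)"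
    by (intro AE_I2) (auto simp: rho_nonneg intro: order_trans[OF rho_le_sum])
qed

text \<open>Each entry of the replacement matrix is dominated by its norm \<open>rho\<close>, which satisfies the moment condition.\<close>

lemma addition_noise:
  "AE \<omega> in M. (\<lambda>n. (1 / real n) * (\<Sum>k<n. chi (Suc k) \<omega> $ i * R (Suc k) \<omega> $ i $ j
     - C k \<omega> $ i / S k \<omega> * Hn k \<omega> $ i $ j)) \<longlonglongrightarrow> 0"
proof -
  have "AE \<omega> in M. (\<lambda>n. (1 / real n) * (\<Sum>k<n. chi (Suc k) \<omega> $ i * R (Suc k) \<omega> $ i $ j
     - real_cond_exp M (F k) (\<lambda>\<omega>. chi (Suc k) \<omega> $ i * R (Suc k) \<omega> $ i $ j) \<omega>)) \<longlonglongrightarrow> 0"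
  proof (rule conditional_strong_law[OF moment_gauge_axioms _ rho_R_F _ rho_R_int moment_int moment_le])
    show "(\<lambda>\<omega>. chi (Suc n) \<omega> $ i * R (Suc n) \<omega> $ i $ j) \<in> borel_measurable (F (Suc n))" for n
      by (intro borel_measurable_times chi_nth_F R_nth_F)
    show "\<bar>chi (Suc n) \<omega> $ i * R (Suc n) \<omega> $ i $ j\<bar> \<le> rho (R (Suc n) \<omega>)" if "\<omega> \<in> space M" for n \<omega>
      using rho_entry_le[of "R (Suc n) \<omega>" i j] rho_nonneg[of "R (Suc n) \<omega>"]
      by (auto simp: chi_nth[OF that] split: split_indicator)
  qed
  moreover have "AE \<omega> in M. \<forall>k. real_cond_exp M (F k) (\<lambda>\<omega>. chi (Suc k) \<omega> $ i * R (Suc k) \<omega> $ i $ j) \<omega>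
     = C k \<omega> $ i / S k \<omega> * Hn k \<omega> $ i $ j"
    by (subst AE_all_countable) (intro allI addition_mean)
  ultimately show ?thesis by eventually_elim simp
qed

text \<open>The draws are bounded by the constant \<open>1\<close>, whose moment is \<open>phi 1\<close>.\<close>

lemma draw_noise:
  "AE \<omega> in M. (\<lambda>n. (1 / real n) * (\<Sum>k<n. chi (Suc k) \<omega> $ i - C k \<omega> $ i / S k \<omega>)) \<longlonglongrightarrow> 0"
proof -
  have "AE \<omega> in M. (\<lambda>n. (1 / real n) * (\<Sum>k<n. chi (Suc k) \<omega> $ i
     - real_cond_exp M (F k) (\<lambda>\<omega>. chi (Suc k) \<omega> $ i) \<omega>)) \<longlonglongrightarrow> 0"
  proof (rule conditional_strong_law[OF moment_gauge_axioms chi_nth_F, where Y = "\<lambda>_ _. 1" and B = "phi 1"])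
    show "\<bar>chi (Suc n) \<omega> $ i\<bar> \<le> 1" if "\<omega> \<in> space M" for n \<omega>
      by (auto simp: chi_nth[OF that] split: split_indicator)
  qed (auto simp: prob_space)
  moreover have "AE \<omega> in M. \<forall>k. real_cond_exp M (F k) (\<lambda>\<omega>. chi (Suc k) \<omega> $ i) \<omega> = C k \<omega> $ i / S k \<omega>"
    by (subst AE_all_countable) (intro allI draw_mean)
  ultimately show ?thesis by eventually_elim simp
qed

lemma C_nth_sum:
  "C n \<omega> $ j = C0 \<omega> $ j + (\<Sum>k<n. \<Sum>i\<in>UNIV. chi (Suc k) \<omega> $ i * R (Suc k) \<omega> $ i $ j)"
  by (induction n) (auto simp: vec_mult_nth)

text \<open>The accumulated proportions, the variable in which the urn follows a closed recursion.\<close>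

definition proportions :: "nat \<Rightarrow> 'a \<Rightarrow> real^'k" where
  "proportions n \<omega> = (\<Sum>k<n. (1 / S k \<omega>) *\<^sub>R C k \<omega>)"

lemma proportions_nth: "proportions n \<omega> $ i = (\<Sum>k<n. C k \<omega> $ i / S k \<omega>)"
  by (simp add: proportions_def)

text \<open>The contents are the initial contents, plus the noise of the additions, plus the sum of the conditional
  means \<open>x\<^sub>k H\<^sub>k\<close>. Replacing \<open>H\<^sub>k\<close> by \<open>H\<close> costs at most \<open>rho (H\<^sub>k - H)\<close> in each coordinate, as \<open>x\<^sub>k\<close> is a probability
  vector; these errors vanish on average.\<close>

lemma mean_field_equation:
  fixes H :: "'a \<Rightarrow> real^'k^'k"
  assumes H_limit: "AE \<omega> in M. (\<lambda>n. (1 / real n) * (\<Sum>k<n. rho (Hn k \<omega> - H \<omega>))) \<longlonglongrightarrow> 0"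
  shows "AE \<omega> in M. (\<lambda>n. (1 / real n) *\<^sub>R (C n \<omega> - proportions n \<omega> v* H \<omega>)) \<longlonglongrightarrow> 0"
proof -
  have "AE \<omega> in M. \<forall>i j. (\<lambda>n. (1 / real n) * (\<Sum>k<n. chi (Suc k) \<omega> $ i * R (Suc k) \<omega> $ i $ j
     - C k \<omega> $ i / S k \<omega> * Hn k \<omega> $ i $ j)) \<longlonglongrightarrow> 0"
    unfolding AE_all_countable by (intro allI addition_noise)
  with H_limit C_nonneg_S_pos show ?thesis
  proof eventually_elim
    case (elim \<omega>)
    define x where "x = (\<lambda>k i. C k \<omega> $ i / S k \<omega>)"
    have x_nn: "0 \<le> x k i" for k i using elim(2) by (simp add: x_def less_imp_le)
    have x_sum: "(\<Sum>i\<in>UNIV. x k i) = 1" for k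
      using elim(2) by (simp add: x_def sum_divide_distrib[symmetric] total_contents_def[symmetric]
          less_imp_neq[THEN not_sym])
    show ?case
    proof (rule vec_tendstoI)
      fix j
      let ?e = "\<lambda>n. (1 / real n) * (\<Sum>k<n. \<Sum>i\<in>UNIV. x k i * (Hn k \<omega> - H \<omega>) $ i $ j)"
      have "(\<lambda>n. (1 / real n) * C0 \<omega> $ j) \<longlonglongrightarrow> 0"
        by (rule tendsto_mult_left_zero[OF lim_1_over_n])
      moreover have "(\<lambda>n. \<Sum>i\<in>UNIV. (1 / real n) * (\<Sum>k<n. chi (Suc k) \<omega> $ i * R (Suc k) \<omega> $ i $ j
          - x k i * Hn k \<omega> $ i $ j)) \<longlonglongrightarrow> (\<Sum>i\<in>(UNIV :: 'k set). 0)"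
        using elim(3) unfolding x_def by (intro tendsto_sum) blast
      moreover have "?e \<longlonglongrightarrow> 0"
      proof (rule Lim_null_comparison[OF _ elim(1)], intro always_eventually allI)
        fix n
        have "\<bar>\<Sum>i\<in>UNIV. x k i * (Hn k \<omega> - H \<omega>) $ i $ j\<bar> \<le> rho (Hn k \<omega> - H \<omega>)" for k
        proof -
          have "\<bar>\<Sum>i\<in>UNIV. x k i * (Hn k \<omega> - H \<omega>) $ i $ j\<bar> \<le> (\<Sum>i\<in>UNIV. \<bar>x k i * (Hn k \<omega> - H \<omega>) $ i $ j\<bar>)"
            by (rule sum_abs)
          also have "\<dots> \<le> (\<Sum>i\<in>UNIV. x k i * rho (Hn k \<omega> - H \<omega>))"
            using x_nn rho_entry_le[of "Hn k \<omega> - H \<omega>"]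
            by (intro sum_mono) (auto simp: abs_mult intro!: mult_left_mono)
          also have "\<dots> = rho (Hn k \<omega> - H \<omega>)" by (simp add: sum_distrib_right[symmetric] x_sum)
          finally show ?thesis .
        qed
        then have "\<bar>\<Sum>k<n. \<Sum>i\<in>UNIV. x k i * (Hn k \<omega> - H \<omega>) $ i $ j\<bar> \<le> (\<Sum>k<n. rho (Hn k \<omega> - H \<omega>))"
          by (intro order_trans[OF sum_abs sum_mono])
        then show "norm (?e n) \<le> (1 / real n) * (\<Sum>k<n. rho (Hn k \<omega> - H \<omega>))"
          by (simp add: abs_mult divide_right_mono)
      qed
      ultimately have "(\<lambda>n. (1 / real n) * C0 \<omega> $ j
          + (\<Sum>i\<in>UNIV. (1 / real n) * (\<Sum>k<n. chi (Suc k) \<omega> $ i * R (Suc k) \<omega> $ i $ j - x k i * Hn k \<omega> $ i $ j))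
          + ?e n) \<longlonglongrightarrow> 0 + (\<Sum>i\<in>(UNIV :: 'k set). 0) + 0"
        by (intro tendsto_add)
      moreover have "((1 / real n) *\<^sub>R (C n \<omega> - proportions n \<omega> v* H \<omega>)) $ j = (1 / real n) * C0 \<omega> $ j
          + (\<Sum>i\<in>UNIV. (1 / real n) * (\<Sum>k<n. chi (Suc k) \<omega> $ i * R (Suc k) \<omega> $ i $ j - x k i * Hn k \<omega> $ i $ j))
          + ?e n" for n
      proof -
        have 1: "(proportions n \<omega> v* H \<omega>) $ j = (\<Sum>k<n. \<Sum>i\<in>UNIV. x k i * H \<omega> $ i $ j)"
          unfolding vec_mult_nth proportions_nth x_def sum_distrib_right by (rule sum.swap)
        have 2: "(\<Sum>i\<in>UNIV. (1 / real n) * (\<Sum>k<n. chi (Suc k) \<omega> $ i * R (Suc k) \<omega> $ i $ j - x k i * Hn k \<omega> $ i $ j))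
          = (1 / real n) * (\<Sum>k<n. \<Sum>i\<in>UNIV. chi (Suc k) \<omega> $ i * R (Suc k) \<omega> $ i $ j - x k i * Hn k \<omega> $ i $ j)"
          unfolding sum_distrib_left[symmetric] by (subst sum.swap) (rule refl)
        show ?thesis
          unfolding 2 vector_scaleR_component vector_minus_component 1 C_nth_sum real_scaleR_def
          by (simp add: algebra_simps sum.distrib sum_subtractf)
      qed
      ultimately show "(\<lambda>n. ((1 / real n) *\<^sub>R (C n \<omega> - proportions n \<omega> v* H \<omega>)) $ j) \<longlonglongrightarrow> 0 $ j"
        by simp
    qed
  qed
qed

text \<open>The averaged proportions converge by the deterministic theorem applied to each outcome. The other
  limits are obtained from this one through the mean field equation and the eigenvector equation.\<close>

theorem almost_sure_limits:
  fixes H :: "'a \<Rightarrow> real^'k^'k"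
  assumes H_limit: "AE \<omega> in M. (\<lambda>n. (1 / real n) * (\<Sum>k<n. rho (Hn k \<omega> - H \<omega>))) \<longlonglongrightarrow> 0"
    and irr: "AE \<omega> in M. irreducible_matrix (H \<omega>)"
  shows "AE \<omega> in M. (\<lambda>n. C n \<omega> /\<^sub>R S n \<omega>) \<longlonglongrightarrow> perron_vector (H \<omega>)"
    and "AE \<omega> in M. (\<lambda>n. S n \<omega> / real n) \<longlonglongrightarrow> dominant_eigenvalue (H \<omega>)"
    and "AE \<omega> in M. (\<lambda>n. C n \<omega> /\<^sub>R real n) \<longlonglongrightarrow> dominant_eigenvalue (H \<omega>) *\<^sub>R perron_vector (H \<omega>)"
    and "AE \<omega> in M. (\<lambda>n. color_count chi n \<omega> /\<^sub>R real n) \<longlonglongrightarrow> perron_vector (H \<omega>)"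
proof -
  have avg: "AE \<omega> in M. (\<lambda>n. (1 / real n) *\<^sub>R proportions n \<omega>) \<longlonglongrightarrow> perron_vector (H \<omega>)"
    using mean_field_equation[OF H_limit] irr C_nonneg_S_pos
  proof eventually_elim
    case (elim \<omega>)
    then show ?case
      using mean_field_urn_limit[OF elim(2), of "\<lambda>n. C n \<omega>"]
      unfolding proportions_def total_contents_def by simp
  qed
  show C_lim: "AE \<omega> in M. (\<lambda>n. C n \<omega> /\<^sub>R real n) \<longlonglongrightarrow> dominant_eigenvalue (H \<omega>) *\<^sub>R perron_vector (H \<omega>)"
    using mean_field_equation[OF H_limit] irr avg
  proof eventually_elim
    case (elim \<omega>)
    let ?p = "perron_vector (H \<omega>)"
    have eig: "?p v* H \<omega> = dominant_eigenvalue (H \<omega>) *\<^sub>R ?p"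
      by (rule perron_frobenius[OF elim(2)])
    have "(\<lambda>n. ((1 / real n) *\<^sub>R proportions n \<omega>) v* H \<omega>) \<longlonglongrightarrow> ?p v* H \<omega>"
    proof (rule vec_tendstoI)
      show "(\<lambda>n. (((1 / real n) *\<^sub>R proportions n \<omega>) v* H \<omega>) $ j) \<longlonglongrightarrow> (?p v* H \<omega>) $ j" for j
        unfolding vec_mult_nth by (intro tendsto_sum tendsto_mult tendsto_vec_nth elim(3) tendsto_const)
    qed
    then have "(\<lambda>n. (1 / real n) *\<^sub>R (C n \<omega> - proportions n \<omega> v* H \<omega>)
        + ((1 / real n) *\<^sub>R proportions n \<omega>) v* H \<omega>) \<longlonglongrightarrow> 0 + ?p v* H \<omega>"
      using elim(1) by (intro tendsto_add)
    then show ?case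
      by (simp add: eig scaleR_vector_matrix_assoc scaleR_diff_right inverse_eq_divide)
  qed
  show S_lim: "AE \<omega> in M. (\<lambda>n. S n \<omega> / real n) \<longlonglongrightarrow> dominant_eigenvalue (H \<omega>)"
    using C_lim irr
  proof eventually_elim
    case (elim \<omega>)
    have one: "(\<Sum>i\<in>UNIV. perron_vector (H \<omega>) $ i) = 1" by (rule perron_frobenius[OF elim(2)])
    have "(\<lambda>n. \<Sum>i\<in>UNIV. (C n \<omega> /\<^sub>R real n) $ i)
        \<longlonglongrightarrow> (\<Sum>i\<in>UNIV. (dominant_eigenvalue (H \<omega>) *\<^sub>R perron_vector (H \<omega>)) $ i)"
      by (intro tendsto_sum tendsto_vec_nth elim(1))
    then show ?case
      by (simp add: sum_distrib_left[symmetric] one total_contents_def divide_inverse mult.commute)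
  qed
  show "AE \<omega> in M. (\<lambda>n. C n \<omega> /\<^sub>R S n \<omega>) \<longlonglongrightarrow> perron_vector (H \<omega>)"
    using C_lim S_lim irr
  proof eventually_elim
    case (elim \<omega>)
    have pos: "0 < dominant_eigenvalue (H \<omega>)" by (rule perron_frobenius[OF elim(3)])
    have "(\<lambda>n. inverse (S n \<omega> / real n) *\<^sub>R (C n \<omega> /\<^sub>R real n))
        \<longlonglongrightarrow> inverse (dominant_eigenvalue (H \<omega>)) *\<^sub>R (dominant_eigenvalue (H \<omega>) *\<^sub>R perron_vector (H \<omega>))"
      using pos by (intro tendsto_scaleR tendsto_inverse elim) simp
    then have "(\<lambda>n. inverse (S n \<omega> / real n) *\<^sub>R (C n \<omega> /\<^sub>R real n)) \<longlonglongrightarrow> perron_vector (H \<omega>)"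
      using pos by simp
    moreover have "\<forall>\<^sub>F n in sequentially. inverse (S n \<omega> / real n) *\<^sub>R (C n \<omega> /\<^sub>R real n) = C n \<omega> /\<^sub>R S n \<omega>"
      using eventually_gt_at_top[of 0] by eventually_elim (simp add: divide_inverse)
    ultimately show ?case by (rule Lim_transform_eventually)
  qed
  have "AE \<omega> in M. \<forall>i. (\<lambda>n. (1 / real n) * (\<Sum>k<n. chi (Suc k) \<omega> $ i - C k \<omega> $ i / S k \<omega>)) \<longlonglongrightarrow> 0"
    unfolding AE_all_countable by (intro allI draw_noise)
  with avg show "AE \<omega> in M. (\<lambda>n. color_count chi n \<omega> /\<^sub>R real n) \<longlonglongrightarrow> perron_vector (H \<omega>)"
  proof eventually_elim
    case (elim \<omega>)
    show ?case
    proof (rule vec_tendstoI)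
      fix i
      have "(\<lambda>n. (1 / real n) * (\<Sum>k<n. chi (Suc k) \<omega> $ i - C k \<omega> $ i / S k \<omega>)
          + ((1 / real n) *\<^sub>R proportions n \<omega>) $ i) \<longlonglongrightarrow> 0 + perron_vector (H \<omega>) $ i"
        using elim(2) by (intro tendsto_add tendsto_vec_nth[OF elim(1)]) blast
      moreover have "(1 / real n) * (\<Sum>k<n. chi (Suc k) \<omega> $ i - C k \<omega> $ i / S k \<omega>)
          + ((1 / real n) *\<^sub>R proportions n \<omega>) $ i = (color_count chi n \<omega> /\<^sub>R real n) $ i" for n
        by (simp add: proportions_nth color_count_def sum.atLeast1_atMost_eq sum_subtractf algebra_simps divide_inverse)
      ultimately show "(\<lambda>n. (color_count chi n \<omega> /\<^sub>R real n) $ i) \<longlonglongrightarrow> perron_vector (H \<omega>) $ i" by simp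
    qed
  qed
qed

section \<open>Convergence in mean for the urn\<close>

lemma C0_nth_int: "integrable M (\<lambda>\<omega>. C0 \<omega> $ i)"
  using integrable_bounded_linear[OF bounded_linear_vec_nth C0_integrable] by simp

lemma chi_R_int: "integrable M (\<lambda>\<omega>. chi (Suc n) \<omega> $ i * R (Suc n) \<omega> $ i $ j)"
proof (rule Bochner_Integration.integrable_bound[OF R_nth_integrable])
  show "(\<lambda>\<omega>. chi (Suc n) \<omega> $ i * R (Suc n) \<omega> $ i $ j) \<in> borel_measurable M"
    by (intro measurable_F_M[of _ "Suc n"] borel_measurable_times chi_nth_F R_nth_F)
  show "AE \<omega> in M. norm (chi (Suc n) \<omega> $ i * R (Suc n) \<omega> $ i $ j) \<le> norm (R (Suc n) \<omega> $ i $ j)"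
    by (intro AE_I2) (auto simp: chi_nth split: split_indicator)
qed

lemma C_nth_int: "integrable M (\<lambda>\<omega>. C n \<omega> $ j)"
  unfolding C_nth_sum using C0_nth_int chi_R_int by simp

lemma S_int: "integrable M (S n)"
  unfolding total_contents_def[abs_def] using C_nth_int by simp

lemma S_le: "\<omega> \<in> space M \<Longrightarrow> S n \<omega> \<le> S 0 \<omega> + (\<Sum>k<n. rho (R (Suc k) \<omega>))"
proof (induction n)
  case (Suc n)
  have "(\<Sum>j\<in>UNIV. (chi (Suc n) \<omega> v* R (Suc n) \<omega>) $ j)
      = (\<Sum>i\<in>UNIV. chi (Suc n) \<omega> $ i * (\<Sum>j\<in>UNIV. R (Suc n) \<omega> $ i $ j))"
    unfolding vec_mult_nth sum_distrib_left by (rule sum.swap)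
  also have "\<dots> \<le> (\<Sum>i\<in>UNIV. chi (Suc n) \<omega> $ i * rho (R (Suc n) \<omega>))"
  proof (intro sum_mono mult_left_mono)
    fix i
    have "(\<Sum>j\<in>UNIV. R (Suc n) \<omega> $ i $ j) \<le> (\<Sum>j\<in>UNIV. \<bar>R (Suc n) \<omega> $ i $ j\<bar>)"
      by (intro sum_mono) auto
    then show "(\<Sum>j\<in>UNIV. R (Suc n) \<omega> $ i $ j) \<le> rho (R (Suc n) \<omega>)"
      using rho_row_le[of "R (Suc n) \<omega>" i] by linarith
    show "0 \<le> chi (Suc n) \<omega> $ i" by (simp add: chi_nth[OF Suc.prems])
  qed
  also have "\<dots> = rho (R (Suc n) \<omega>)"
    by (simp add: sum_distrib_right[symmetric] chi_sum[OF Suc.prems])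
  finally show ?case
    using Suc by (simp add: total_contents_def sum.distrib)
qed simp

text \<open>The total content is at most the initial one plus the sum of the \<open>rho (R k)\<close>. The excess of an average over
  \<open>L\<close> is at most the average of the excesses, and these have mean at most \<open>b / phi L\<close>, which is small
  for large \<open>L\<close> because \<open>phi\<close> is unbounded.\<close>

lemma small_excess:
  assumes "0 < \<epsilon>"
  shows "\<exists>L\<ge>0. \<forall>\<^sub>F n in sequentially. (\<integral>\<omega>. max (S n \<omega> / real n - L) 0 \<partial>M) \<le> \<epsilon>"
proof -
  obtain L where L: "a \<le> L" "2 * \<bar>b\<bar> / \<epsilon> + 1 \<le> phi L" using unbounded by blast
  have phi_L: "0 < phi L" by (rule pos[OF L(1)])
  have b_L: "b / phi L \<le> \<epsilon> / 2"
  proof -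
    have "2 * \<bar>b\<bar> / \<epsilon> \<le> phi L" using L(2) by simp
    then have "2 * \<bar>b\<bar> \<le> \<epsilon> * phi L" using assms by (simp add: pos_divide_le_eq mult.commute)
    then have "b \<le> \<epsilon> / 2 * phi L" by simp
    then show ?thesis using phi_L by (simp add: pos_divide_le_eq)
  qed
  define r where "r = (\<lambda>k \<omega>. rho (R (Suc k) \<omega>))"
  have r_ex_int: "integrable M (\<lambda>\<omega>. max (r k \<omega> - L) 0)" for k
    unfolding r_def using rho_R_int by (intro integrable_max) auto
  have r_ex: "(\<integral>\<omega>. max (r k \<omega> - L) 0 \<partial>M) \<le> \<epsilon> / 2" for k
  proof -
    have "(\<integral>\<omega>. max (r k \<omega> - L) 0 \<partial>M) \<le> (\<integral>\<omega>. r k \<omega> * phi (r k \<omega>) / phi L \<partial>M)"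
    proof (rule integral_mono[OF r_ex_int])
      show "integrable M (\<lambda>\<omega>. r k \<omega> * phi (r k \<omega>) / phi L)" unfolding r_def using moment_int by simp
      fix \<omega>
      have "0 \<le> r k \<omega>" by (simp add: r_def rho_nonneg)
      then show "max (r k \<omega> - L) 0 \<le> r k \<omega> * phi (r k \<omega>) / phi L"
        using tail_le[OF L(1), of "r k \<omega>"] L(1) a_ge_1 by (auto split: if_splits)
    qed
    also have "\<dots> \<le> b / phi L" using moment_le[of k] phi_L by (simp add: r_def divide_right_mono)
    finally show ?thesis using b_L by linarith
  qed
  have "(\<lambda>n. (\<integral>\<omega>. \<bar>S 0 \<omega>\<bar> \<partial>M) * (1 / real n)) \<longlonglongrightarrow> 0"
    by (rule tendsto_mult_right_zero[OF lim_1_over_n])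
  then have "\<forall>\<^sub>F n in sequentially. (\<integral>\<omega>. \<bar>S 0 \<omega>\<bar> \<partial>M) * (1 / real n) < \<epsilon> / 2"
    using assms by (intro order_tendstoD) auto
  with eventually_gt_at_top[of 0]
  have "\<forall>\<^sub>F n in sequentially. (\<integral>\<omega>. max (S n \<omega> / real n - L) 0 \<partial>M) \<le> \<epsilon>"
  proof eventually_elim
    case (elim n)
    have "(\<integral>\<omega>. max (S n \<omega> / real n - L) 0 \<partial>M)
        \<le> (\<integral>\<omega>. (\<bar>S 0 \<omega>\<bar> + (\<Sum>k<n. max (r k \<omega> - L) 0)) / real n \<partial>M)"
    proof (rule integral_mono)
      fix \<omega> assume \<omega>: "\<omega> \<in> space M"
      have "S n \<omega> - real n * L \<le> S 0 \<omega> + (\<Sum>k<n. r k \<omega> - L)"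
        using S_le[OF \<omega>, of n] by (simp add: r_def sum_subtractf)
      also have "\<dots> \<le> \<bar>S 0 \<omega>\<bar> + (\<Sum>k<n. max (r k \<omega> - L) 0)"
        by (intro add_mono sum_mono) auto
      finally have "(S n \<omega> - real n * L) / real n \<le> (\<bar>S 0 \<omega>\<bar> + (\<Sum>k<n. max (r k \<omega> - L) 0)) / real n"
        by (intro divide_right_mono) auto
      moreover have "0 \<le> (\<bar>S 0 \<omega>\<bar> + (\<Sum>k<n. max (r k \<omega> - L) 0)) / real n"
        by (intro divide_nonneg_nonneg add_nonneg_nonneg sum_nonneg) auto
      ultimately show "max (S n \<omega> / real n - L) 0 \<le> (\<bar>S 0 \<omega>\<bar> + (\<Sum>k<n. max (r k \<omega> - L) 0)) / real n"
        using elim by (simp add: diff_divide_distrib)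
    qed (use S_int r_ex_int in auto)
    also have "\<dots> = ((\<integral>\<omega>. \<bar>S 0 \<omega>\<bar> \<partial>M) + (\<Sum>k<n. \<integral>\<omega>. max (r k \<omega> - L) 0 \<partial>M)) / real n"
      using S_int[of 0] r_ex_int by (simp add: Bochner_Integration.integral_sum)
    also have "\<dots> \<le> ((\<integral>\<omega>. \<bar>S 0 \<omega>\<bar> \<partial>M) + (\<Sum>k<n. \<epsilon> / 2)) / real n"
      by (intro divide_right_mono add_left_mono sum_mono r_ex) auto
    also have "\<dots> = (\<integral>\<omega>. \<bar>S 0 \<omega>\<bar> \<partial>M) * (1 / real n) + \<epsilon> / 2"
      using elim by (simp add: add_divide_distrib)
    also have "\<dots> \<le> \<epsilon>" using elim by linarith
    finally show ?case .
  qed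
  then show ?thesis using L(1) a_ge_1 by (intro exI[of _ L]) auto
qed

text \<open>Everything bounded by the total content per trial inherits its small excess.\<close>

lemma tendsto_L1_dominated:
  fixes X :: "nat \<Rightarrow> 'a \<Rightarrow> real"
  assumes X: "\<And>n. integrable M (X n)" "\<And>n. AE \<omega> in M. 0 \<le> X n \<omega> \<and> X n \<omega> \<le> S n \<omega> / real n"
    and Y: "Y \<in> borel_measurable M" and lim: "AE \<omega> in M. (\<lambda>n. X n \<omega>) \<longlonglongrightarrow> Y \<omega>"
  shows "tendsto_L1 M X Y"
proof -
  have nn: "AE \<omega> in M. 0 \<le> X n \<omega>" for n using X(2)[of n] by (auto elim: eventually_mono)
  have excess: "\<exists>L\<ge>0. \<forall>\<^sub>F n in sequentially. (\<integral>\<omega>. max (X n \<omega> - L) 0 \<partial>M) \<le> \<epsilon>" if \<epsilon>: "0 < \<epsilon>" for \<epsilon>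
  proof -
    obtain L where L: "0 \<le> L" "\<forall>\<^sub>F n in sequentially. (\<integral>\<omega>. max (S n \<omega> / real n - L) 0 \<partial>M) \<le> \<epsilon>"
      using small_excess[OF \<epsilon>] by blast
    have "(\<integral>\<omega>. max (X n \<omega> - L) 0 \<partial>M) \<le> (\<integral>\<omega>. max (S n \<omega> / real n - L) 0 \<partial>M)" for n
    proof (rule integral_mono_AE)
      show "AE \<omega> in M. max (X n \<omega> - L) 0 \<le> max (S n \<omega> / real n - L) 0"
        using X(2)[of n] by eventually_elim auto
    qed (use X(1) S_int in auto)
    then have "\<forall>\<^sub>F n in sequentially. (\<integral>\<omega>. max (X n \<omega> - L) 0 \<partial>M) \<le> \<epsilon>"
      using L(2) by (auto elim!: eventually_mono intro: order_trans)
    then show ?thesis using L(1) by blast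
  qed
  show ?thesis
    using L1_limit_of_small_excess[OF X(1) nn Y lim excess] X(1) by (simp add: tendsto_L1_def)
qed

theorem L1_limits:
  fixes H :: "'a \<Rightarrow> real^'k^'k"
  assumes H: "H \<in> borel_measurable M"
    and H_limit: "AE \<omega> in M. (\<lambda>n. (1 / real n) * (\<Sum>k<n. rho (Hn k \<omega> - H \<omega>))) \<longlonglongrightarrow> 0"
    and irr: "AE \<omega> in M. irreducible_matrix (H \<omega>)"
  shows "tendsto_L1 M (\<lambda>n \<omega>. C n \<omega> /\<^sub>R S n \<omega>) (\<lambda>\<omega>. perron_vector (H \<omega>))"
    and "tendsto_L1 M (\<lambda>n \<omega>. S n \<omega> / real n) (\<lambda>\<omega>. dominant_eigenvalue (H \<omega>))"
    and "tendsto_L1 M (\<lambda>n \<omega>. C n \<omega> /\<^sub>R real n) (\<lambda>\<omega>. dominant_eigenvalue (H \<omega>) *\<^sub>R perron_vector (H \<omega>))"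
    and "tendsto_L1 M (\<lambda>n \<omega>. color_count chi n \<omega> /\<^sub>R real n) (\<lambda>\<omega>. perron_vector (H \<omega>))"
proof -
  note lim = almost_sure_limits[OF H_limit irr]
  have perron_meas: "(\<lambda>\<omega>. perron_vector (H \<omega>) $ i) \<in> borel_measurable M" for i
    using measurable_compose[OF H perron_vector_measurable] by (simp add: borel_measurable_vec_iff)
  have eig_meas: "(\<lambda>\<omega>. dominant_eigenvalue (H \<omega>)) \<in> borel_measurable M"
    using measurable_compose[OF H dominant_eigenvalue_measurable] by simp
  have nth_lim: "AE \<omega> in M. (\<lambda>n. X n \<omega> $ i) \<longlonglongrightarrow> Y \<omega> $ i"
    if "AE \<omega> in M. (\<lambda>n. X n \<omega>) \<longlonglongrightarrow> Y \<omega>" for X and Y :: "'a \<Rightarrow> real^'k" and i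
    using that by eventually_elim (rule tendsto_vec_nth)
  have C_le_S: "AE \<omega> in M. \<forall>n i. 0 \<le> C n \<omega> $ i \<and> C n \<omega> $ i \<le> S n \<omega> \<and> 0 < S n \<omega>"
    using C_nonneg_S_pos
    by eventually_elim (auto simp: total_contents_def intro!: member_le_sum)
  note [measurable] = measurable_F_M[OF C_F] measurable_F_M[OF S_F]
  show "tendsto_L1 M (\<lambda>n \<omega>. C n \<omega> /\<^sub>R S n \<omega>) (\<lambda>\<omega>. perron_vector (H \<omega>))"
  proof (rule tendsto_L1_vec, rule tendsto_L1_unit_interval[OF _ _ perron_meas nth_lim[OF lim(1)]])
    fix i n
    show "(\<lambda>\<omega>. (C n \<omega> /\<^sub>R S n \<omega>) $ i) \<in> borel_measurable M" by simp
    show "AE \<omega> in M. 0 \<le> (C n \<omega> /\<^sub>R S n \<omega>) $ i \<and> (C n \<omega> /\<^sub>R S n \<omega>) $ i \<le> 1"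
      using C_le_S
    proof eventually_elim
      case (elim \<omega>)
      then have "0 \<le> C n \<omega> $ i" "C n \<omega> $ i \<le> S n \<omega>" "0 < S n \<omega>" by auto
      then show ?case by (simp add: inverse_eq_divide divide_le_eq)
    qed
  qed
  show "tendsto_L1 M (\<lambda>n \<omega>. S n \<omega> / real n) (\<lambda>\<omega>. dominant_eigenvalue (H \<omega>))"
  proof (rule tendsto_L1_dominated[OF _ _ eig_meas lim(2)])
    show "AE \<omega> in M. 0 \<le> S n \<omega> / real n \<and> S n \<omega> / real n \<le> S n \<omega> / real n" for n
      using C_nonneg_S_pos by eventually_elim (simp add: less_imp_le)
  qed (use S_int in auto)
  show "tendsto_L1 M (\<lambda>n \<omega>. C n \<omega> /\<^sub>R real n) (\<lambda>\<omega>. dominant_eigenvalue (H \<omega>) *\<^sub>R perron_vector (H \<omega>))"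
  proof (rule tendsto_L1_vec, rule tendsto_L1_dominated[OF _ _ _ nth_lim[OF lim(3)]])
    fix i n
    show "integrable M (\<lambda>\<omega>. (C n \<omega> /\<^sub>R real n) $ i)" using C_nth_int by simp
    show "(\<lambda>\<omega>. (dominant_eigenvalue (H \<omega>) *\<^sub>R perron_vector (H \<omega>)) $ i) \<in> borel_measurable M"
      using eig_meas perron_meas by simp
    show "AE \<omega> in M. 0 \<le> (C n \<omega> /\<^sub>R real n) $ i \<and> (C n \<omega> /\<^sub>R real n) $ i \<le> S n \<omega> / real n"
      using C_le_S by eventually_elim (auto simp: divide_inverse mult.commute intro!: mult_left_mono)
  qed
  show "tendsto_L1 M (\<lambda>n \<omega>. color_count chi n \<omega> /\<^sub>R real n) (\<lambda>\<omega>. perron_vector (H \<omega>))"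
  proof (rule tendsto_L1_vec, rule tendsto_L1_unit_interval[OF _ _ perron_meas nth_lim[OF lim(4)]])
    fix i n
    have count: "(color_count chi n \<omega> /\<^sub>R real n) $ i = (\<Sum>k<n. chi (Suc k) \<omega> $ i) / real n" for \<omega>
      by (simp add: color_count_def sum.atLeast1_atMost_eq divide_inverse mult.commute)
    show "(\<lambda>\<omega>. (color_count chi n \<omega> /\<^sub>R real n) $ i) \<in> borel_measurable M"
      unfolding count using measurable_F_M[OF chi_nth_F] by simp
    show "AE \<omega> in M. 0 \<le> (color_count chi n \<omega> /\<^sub>R real n) $ i \<and> (color_count chi n \<omega> /\<^sub>R real n) $ i \<le> 1"
    proof (rule AE_I2)
      fix \<omega> assume \<omega>: "\<omega> \<in> space M"
      have "0 \<le> (\<Sum>k<n. chi (Suc k) \<omega> $ i)" by (intro sum_nonneg) (simp add: chi_nth[OF \<omega>])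
      moreover have "(\<Sum>k<n. chi (Suc k) \<omega> $ i) \<le> (\<Sum>k<n. 1)"
        by (intro sum_mono) (simp add: chi_nth[OF \<omega>] indicator_le_1)
      ultimately show "0 \<le> (color_count chi n \<omega> /\<^sub>R real n) $ i \<and> (color_count chi n \<omega> /\<^sub>R real n) $ i \<le> 1"
        unfolding count by (auto simp: divide_le_eq)
    qed
  qed
qed

end

section \<open>The limit theorem\<close>

text \<open>The growth conditions on \<open>phi\<close> provide the threshold of a \<open>moment_gauge\<close>, and the bounded moments the
  constant \<open>b\<close>, so that the general results apply.\<close>

theorem corollary2p6:
  fixes M :: "'a measure"
    and C0 :: "'a \<Rightarrow> real^'k"
    and R :: "nat \<Rightarrow> 'a \<Rightarrow> real^'k^'k"
    and chi :: "nat \<Rightarrow> 'a \<Rightarrow> real^'k"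
    and H :: "'a \<Rightarrow> real^'k^'k"
    and phi :: "real \<Rightarrow> real"
  defines "C \<equiv> config C0 R chi"
    and "S \<equiv> total_contents C0 R chi"
    and "N \<equiv> color_count chi"
  assumes urn: "randomized_urn M C0 R chi"
    and H_measurable: "H \<in> borel_measurable M"
    and H_nonneg: "\<And>\<omega>. \<omega> \<in> space M \<Longrightarrow> nonneg_matrix (H \<omega>)"
    and H_irreducible: "AE \<omega> in M. irreducible_matrix (H \<omega>)"
    and H_limit: "AE \<omega> in M.
          (\<lambda>n. (1 / real n) * (\<Sum>k<n. rho (replacement_mean M C0 R chi k \<omega> - H \<omega>))) \<longlonglongrightarrow> 0"
    and phi_nonneg: "\<And>x. 0 \<le> x \<Longrightarrow> 0 \<le> phi x"
    and phi_pos: "\<forall>\<^sub>F x in at_top. 0 < phi x"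
    and phi_mono: "\<exists>a. mono_on {a..} phi"
    and phi_summable: "\<exists>n0. (\<forall>n\<ge>n0. 0 < real n * phi (real n)) \<and>
          summable (\<lambda>n. 1 / (real (n + n0) * phi (real (n + n0))))"
    and phi_ratio_mono: "\<exists>a. mono_on {a..} (\<lambda>x. x / phi x)"
    and moment_integrable: "\<And>n. 1 \<le> n \<Longrightarrow> integrable M (\<lambda>\<omega>. rho (R n \<omega>) * phi (rho (R n \<omega>)))"
    and moment_bound: "bdd_above ((\<lambda>n. \<integral>\<omega>. rho (R n \<omega>) * phi (rho (R n \<omega>)) \<partial>M) ` {1..})"
  shows "(AE \<omega> in M. (\<lambda>n. C n \<omega> /\<^sub>R S n \<omega>) \<longlonglongrightarrow> perron_vector (H \<omega>))
       \<and> tendsto_L1 M (\<lambda>n \<omega>. C n \<omega> /\<^sub>R S n \<omega>) (\<lambda>\<omega>. perron_vector (H \<omega>))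
       \<and> (AE \<omega> in M. (\<lambda>n. S n \<omega> / real n) \<longlonglongrightarrow> dominant_eigenvalue (H \<omega>))
       \<and> tendsto_L1 M (\<lambda>n \<omega>. S n \<omega> / real n) (\<lambda>\<omega>. dominant_eigenvalue (H \<omega>))
       \<and> (AE \<omega> in M. (\<lambda>n. C n \<omega> /\<^sub>R real n) \<longlonglongrightarrow> dominant_eigenvalue (H \<omega>) *\<^sub>R perron_vector (H \<omega>))
       \<and> tendsto_L1 M (\<lambda>n \<omega>. C n \<omega> /\<^sub>R real n) (\<lambda>\<omega>. dominant_eigenvalue (H \<omega>) *\<^sub>R perron_vector (H \<omega>))
       \<and> (AE \<omega> in M. (\<lambda>n. N n \<omega> /\<^sub>R real n) \<longlonglongrightarrow> perron_vector (H \<omega>))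
       \<and> tendsto_L1 M (\<lambda>n \<omega>. N n \<omega> /\<^sub>R real n) (\<lambda>\<omega>. perron_vector (H \<omega>))"
proof -
  obtain a where gauge: "moment_gauge phi a"
    using moment_gauge_exists[OF phi_nonneg phi_pos phi_mono phi_summable phi_ratio_mono] by blast
  obtain b where b: "\<And>n. 1 \<le> n \<Longrightarrow> (\<integral>\<omega>. rho (R n \<omega>) * phi (rho (R n \<omega>)) \<partial>M) \<le> b"
    using moment_bound unfolding bdd_above_def by auto
  interpret urn_with_moments M C0 R chi phi a b
  proof (intro urn_with_moments.intro urn gauge urn_with_moments_axioms.intro)
    fix n
    show "integrable M (\<lambda>\<omega>. rho (R (Suc n) \<omega>) * phi (rho (R (Suc n) \<omega>)))"
      by (rule moment_integrable) simp
    show "(\<integral>\<omega>. rho (R (Suc n) \<omega>) * phi (rho (R (Suc n) \<omega>)) \<partial>M) \<le> b"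
      by (rule b) simp
  qed
  show ?thesis
    unfolding C_def S_def N_def
    by (intro conjI almost_sure_limits[OF H_limit H_irreducible]
        L1_limits[OF H_measurable H_limit H_irreducible])
qed

end
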